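(* Let $T$ be an oriented tangle diagram subordinate to a disc configuration $(D_0;D_1)$ with signature $(0;0)$. Then $T$ comes from an oriented link diagram $L$, and the partition map $Z_T:\mathbb{Z}[q^{1/2},q^{-1/2}]\to\mathbb{Z}[q^{1/2},q^{-1/2}]$ is multiplication by $J_L(q)$, Khovanov's version of the Jones polynomial of $L$.
   Context: Write $\Lambda=\mathbb{Z}[q^{1/2},q^{-1/2}]$; all tensor products are over $\Lambda$ (an empty tensor product is $\Lambda$). Everything is smooth. Disc configurations and planar diagrams. Let $S$ be an oriented two-sphere. A disc configuration $\mathbb{D}=(D_0;D_1,\dots,D_m)$, $m\ge 0$, is an ordered collection of closed discs embedded in $S$, with a marked point $\ast_i\in\partial D_i$ for each $i$, such that $D_i\subset \mathrm{int}\,D_0$ for $i\ge1$ and $D_i\cap D_j=\emptyset$ for distinct $i,j\ge1$. Each $D_i$ is oriented by $S$ and $\partial D_i$ is oriented as its boundary. Put $\Sigma_{\mathbb{D}}=D_0\setminus\bigcup_{i\ge1}\mathrm{int}\,D_i$. A planar diagram $P$ subordinate to $\mathbb{D}$ is a (possibly empty, finite) set of arcs and circles properly and disjointly embedded in $\Sigma_{\mathbb{D}}$, with endpoints away from the marked points, meeting each $\partial D_i$ in an even number $2n_i$ of points. The points of $P\cap\partial D_i$ are ordered along the oriented interval $\partial D_i\setminus\{\ast_i\}$. The signature is $\mathrm{Sign}(P)=(n_0;n_1,\dots,n_m)$. Cleaved links. For an oriented circle $C\subset S$ (the equator) bounding an inside disc $D$ (with $C$ oriented as $\partial D$), a marked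 point $\ast\in C$ and a set $Q\subset C\setminus\{\ast\}$ of $2n$ points, $\mathcal{CL}_n$ is the set of equivalence classes of pairs $(L,\sigma)$, where $L\subset S$ is a finite disjoint union of embedded circles, each component meets $C$ transversely and non-trivially, $L\cap C=Q$, and $\sigma:\{\text{components of }L\}\to\{+,-\}$ is a decoration. Two pairs are equivalent if an orientation-preserving diffeomorphism of spheres carries one oriented equator, marked point, link and decoration to the other. $\mathcal{I}_{2n}$ is the free $\Lambda$-module with basis $\{I_{(L,\sigma)}:(L,\sigma)\in\mathcal{CL}_n\}$; $\mathcal{I}_0=\Lambda I_0$, where $I_0$ corresponds to the empty link, is identified with $\Lambda$ by $I_0\leftrightarrow1$. Multiply cleaved links. A decorated multiply cleaved link subordinate to $\mathbb{D}$ is a pair $(M,\sigma)$, where $M\subset S$ is a finite (possibly empty) disjoint union of embedded circles, transverse to every $\partial D_i$ and missing every $\ast_i$, with no component contained in $S\setminus D_0$ or in $\mathrm{int}\,D_i$ ($i\ge1$), and $\sigma$ assigns $+$ or $-$ to each component. For a planar diagram $P$ subordinate to $\mathbb{D}$, $\mathcal{M}(P)$ is the set of such $(M,\sigma)$ with $M\cap\Sigma_{\mathbb{D}}=P$, two being identified if they differ by a diffeomorphism of $S$ that is the identity on $\Sigma_{\mathbb{D}}$ and respects decorations. For $0\le i\le m$, the boundary $\partial_i(M,\sigma)\in\mathcal{CL}_{n_i}$ is the cleaved link with equator $\partial D_i$, inside disc $D_i$ and marked point $\ast_i$, consisting of those components of $M$ that meet $\partial D_i$, with the restricted decoration. Weights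 and partition maps. For a component $K$ of $M$, let $N_M(K)$ be the number of circles among $\partial D_0,\dots,\partial D_m$ that meet $K$. The weight is $W(M,\sigma)=\prod_{\sigma(K)=+}q^{1-\frac12N_M(K)}\prod_{\sigma(K)=-}q^{-1+\frac12N_M(K)}\in\Lambda$ ($=1$ if $M=\emptyset$). The partition map $Z_P:\mathcal{I}_{2n_1}\otimes\cdots\otimes\mathcal{I}_{2n_m}\to\mathcal{I}_{2n_0}$ is the $\Lambda$-linear map with $$Z_P\big(I_{(L_1,\sigma_1)}\otimes\cdots\otimes I_{(L_m,\sigma_m)}\big)=\sum W(M,\sigma)\,I_{\partial_0(M,\sigma)},$$ the sum being over $(M,\sigma)\in\mathcal{M}(P)$ with $\partial_i(M,\sigma)=(L_i,\sigma_i)$ for all $i\ge1$. Tangle diagrams. An oriented tangle diagram $T$ subordinate to $\mathbb{D}$ is an oriented tangle diagram (with over/under crossings) drawn in $\Sigma_{\mathbb{D}}$ with endpoints on $\partial\Sigma_{\mathbb{D}}$ away from the marked points, meeting each $\partial D_i$ in an even number $2n_i$ of points; $\mathrm{Sign}(T)=(n_0;n_1,\dots,n_m)$. Let $n_\pm(T)$ be the number of positive/negative crossings. A resolution is a map $\rho:\{\text{crossings of }T\}\to\{0,1\}$; $\rho(T)$ is the planar diagram obtained by smoothing each crossing $c$ by the $\rho(c)$-resolution. The $0$-resolution joins the two regions swept out when the overstrand is rotated counterclockwise to the understrand, and the $1$-resolution is the other smoothing (so the orientation-respecting smoothing is the $0$-resolution at positive crossings and the $1$-resolution at negative crossings). Put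 $h(\rho)=\sum_c\rho(c)$, $\widetilde{Z}_T=\sum_\rho(-q)^{h(\rho)}Z_{\rho(T)}$, and $$Z_T=(-1)^{n_-(T)}q^{\,n_+(T)-2n_-(T)}\,\widetilde{Z}_T:\ \mathcal{I}_{2n_1}\otimes\cdots\otimes\mathcal{I}_{2n_m}\to\mathcal{I}_{2n_0}.$$ Khovanov's version of the Jones polynomial. For an oriented link diagram $L$ (on the sphere, forgetting the discs), $J_L(q)=(-1)^{n_-(L)}q^{\,n_+(L)-2n_-(L)}\widetilde{J}_L(q)$, where $\widetilde{J}$ is determined on unoriented link diagrams by: $\widetilde{J}_U=q+q^{-1}$ for a crossingless circle $U$; $\widetilde{J}_{L\sqcup U}=(q+q^{-1})\widetilde{J}_L$, where $U$ is an additional crossingless circle component disjoint from $L$; and $\widetilde{J}_L=\widetilde{J}_{L_0}-q\,\widetilde{J}_{L_1}$, where $L_0,L_1$ are the $0$- and $1$-resolutions of $L$ at a crossing. For the empty diagram $\widetilde{J}=1$. *)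

theory Defs
  imports "HOL-Analysis.Analysis" "HOL-Library.Poly_Mapping"
begin

section \<open>Smooth maps and submanifolds of Euclidean space\<close>

primrec Ck_on ::
  "nat \<Rightarrow> 'a::euclidean_space set \<Rightarrow> ('a \<Rightarrow> 'b::euclidean_space) \<Rightarrow> bool" where
  "Ck_on 0 U f \<longleftrightarrow> continuous_on U f"
| "Ck_on (Suc k) U f \<longleftrightarrow>
     f differentiable_on U \<and> (\<forall>v. Ck_on k U (\<lambda>x. frechet_derivative f (at x) v))"

text \<open>\<open>Ck_on\<close> is only meaningful on open sets. On an arbitrary set, smooth means that the map
  locally extends to a \<open>C\<^sup>\<infinity>\<close> map on an open subset of the ambient space.\<close>

definition smooth_map ::
  "'a::euclidean_space set \<Rightarrow> ('a \<Rightarrow> 'b::euclidean_space) \<Rightarrow> bool" where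
  "smooth_map X f \<longleftrightarrow>
     (\<forall>x\<in>X. \<exists>U g. open U \<and> x \<in> U \<and> (\<forall>k. Ck_on k U g) \<and> (\<forall>y\<in>X \<inter> U. f y = g y))"

definition diffeo ::
  "'a::euclidean_space set \<Rightarrow> 'b::euclidean_space set \<Rightarrow> ('a \<Rightarrow> 'b) \<Rightarrow> bool" where
  "diffeo X Y f \<longleftrightarrow> bij_betw f X Y \<and> smooth_map X f \<and> smooth_map Y (inv_into X f)"

definition embedded_circle :: "'a::euclidean_space set \<Rightarrow> bool" where
  "embedded_circle K \<longleftrightarrow> (\<exists>f. diffeo (sphere (0::complex) 1) K f)"

definition embedded_disc :: "'a::euclidean_space set \<Rightarrow> bool" where
  "embedded_disc D \<longleftrightarrow> (\<exists>f. diffeo (cball (0::complex) 1) D f)"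

definition circle_union :: "'a::euclidean_space set \<Rightarrow> bool" where
  "circle_union L \<longleftrightarrow> finite (components L) \<and> (\<forall>K\<in>components L. embedded_circle K)"

text \<open>Velocities at \<open>p\<close> of smooth curves that start at \<open>p\<close> and stay in \<open>X\<close>: the tangent space at
  an interior point of a submanifold, a half-line at an endpoint of an arc.\<close>

definition tangent_dirs :: "'a::euclidean_space set \<Rightarrow> 'a \<Rightarrow> 'a set" where
  "tangent_dirs X p =
     {v. \<exists>e>0. \<exists>\<gamma>::real \<Rightarrow> 'a. smooth_map {0..<e} \<gamma> \<and> \<gamma> 0 = p \<and> \<gamma> ` {0..<e} \<subseteq> X \<and>
           (\<gamma> has_vector_derivative v) (at 0 within {0..<e})}"

definition interior_arc_point :: "'a::euclidean_space set \<Rightarrow> 'a \<Rightarrow> bool" where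
  "interior_arc_point X p \<longleftrightarrow>
     (\<exists>U g. open U \<and> p \<in> U \<and> diffeo {-1<..<1::real} (X \<inter> U) g)"

definition arc_endpoint :: "'a::euclidean_space set \<Rightarrow> 'a \<Rightarrow> bool" where
  "arc_endpoint X p \<longleftrightarrow>
     (\<exists>U g. open U \<and> diffeo {0..<1::real} (X \<inter> U) g \<and> g 0 = p)"


section \<open>The oriented sphere\<close>

text \<open>The sphere is the unit sphere of \<open>\<real>\<^sup>3\<close>, oriented by its outward normal: tangent vectors
  \<open>u, v\<close> at \<open>p\<close> form a positive frame iff \<open>p \<bullet> (u \<times> v) > 0\<close>.\<close>

type_synonym point = "real^3"

abbreviation S2 :: "point set" where
  "S2 \<equiv> sphere 0 1"

definition orientation_preserving :: "(point \<Rightarrow> point) \<Rightarrow> bool" where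
  "orientation_preserving f \<longleftrightarrow>
     (\<forall>p\<in>S2. \<exists>f'. (f has_derivative f') (at p within S2) \<and>
        (\<forall>u v. p \<bullet> u = 0 \<longrightarrow> p \<bullet> v = 0 \<longrightarrow> 0 < p \<bullet> cross3 u v \<longrightarrow>
               0 < f p \<bullet> cross3 (f' u) (f' v)))"

definition oriented_chart :: "(complex \<Rightarrow> point) \<Rightarrow> bool" where
  "oriented_chart \<phi> \<longleftrightarrow>
     diffeo (cball 0 1) (\<phi> ` cball 0 1) \<phi> \<and> \<phi> ` cball 0 1 \<subseteq> S2 \<and>
     (\<forall>z\<in>cball 0 1. \<exists>\<phi>'. (\<phi> has_derivative \<phi>') (at z within cball 0 1) \<and>
        0 < \<phi> z \<bullet> cross3 (\<phi>' 1) (\<phi>' \<i>))"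

definition transverse_at :: "point set \<Rightarrow> point set \<Rightarrow> point \<Rightarrow> bool" where
  "transverse_at X C p \<longleftrightarrow> span (tangent_dirs X p \<union> tangent_dirs C p) = {v. p \<bullet> v = 0}"

abbreviation bd :: "point set \<Rightarrow> point set" where
  "bd D \<equiv> top_of_set S2 frontier_of D"

abbreviation inner :: "point set \<Rightarrow> point set" where
  "inner D \<equiv> top_of_set S2 interior_of D"


section \<open>Disc configurations\<close>

text \<open>\<open>(D\<^sub>0; D\<^sub>1, \<dots>, D\<^sub>m)\<close> with \<open>m = holes\<close>; the values of \<open>disc\<close> and \<open>mark\<close> beyond \<open>m\<close> are
  irrelevant.\<close>

record disc_config =
  holes :: nat
  disc :: "nat \<Rightarrow> point set"
  mark :: "nat \<Rightarrow> point"

definition disc_configuration :: "disc_config \<Rightarrow> bool" where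
  "disc_configuration \<D> \<longleftrightarrow>
     (\<forall>i\<le>holes \<D>. disc \<D> i \<subseteq> S2 \<and> embedded_disc (disc \<D> i) \<and> mark \<D> i \<in> bd (disc \<D> i)) \<and>
     (\<forall>i\<in>{1..holes \<D>}. disc \<D> i \<subseteq> inner (disc \<D> 0)) \<and>
     (\<forall>i\<in>{1..holes \<D>}. \<forall>j\<in>{1..holes \<D>}. i \<noteq> j \<longrightarrow> disc \<D> i \<inter> disc \<D> j = {})"

definition dcirc :: "disc_config \<Rightarrow> nat \<Rightarrow> point set" where
  "dcirc \<D> i = bd (disc \<D> i)"

definition Sig :: "disc_config \<Rightarrow> point set" where
  "Sig \<D> = disc \<D> 0 - (\<Union>i\<in>{1..holes \<D>}. inner (disc \<D> i))"

definition Sig_int :: "disc_config \<Rightarrow> point set" where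
  "Sig_int \<D> = inner (disc \<D> 0) - (\<Union>i\<in>{1..holes \<D>}. disc \<D> i)"

definition half_points :: "disc_config \<Rightarrow> point set \<Rightarrow> nat \<Rightarrow> nat" where
  "half_points \<D> X i = card (X \<inter> dcirc \<D> i) div 2"

text \<open>The list \<open>[n\<^sub>0, n\<^sub>1, \<dots>, n\<^sub>m]\<close>.\<close>

definition signature :: "disc_config \<Rightarrow> point set \<Rightarrow> nat list" where
  "signature \<D> X = map (half_points \<D> X) [0..<Suc (holes \<D>)]"


section \<open>Laurent polynomials and free modules\<close>

text \<open>\<open>\<int>[q\<^sup>1\<^sup>/\<^sup>2, q\<^sup>-\<^sup>1\<^sup>/\<^sup>2]\<close> is the group ring of \<open>\<int>\<close>; the exponent \<open>k\<close> stands for \<open>q\<^sup>k\<^sup>/\<^sup>2\<close>.\<close>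

type_synonym laurent = "int \<Rightarrow>\<^sub>0 int"

definition qhalf :: "int \<Rightarrow> laurent" where
  "qhalf k = Poly_Mapping.single k 1"

abbreviation q :: laurent where
  "q \<equiv> qhalf 2"

abbreviation q_inv :: laurent where
  "q_inv \<equiv> qhalf (-2)"

definition scale :: "laurent \<Rightarrow> ('b \<Rightarrow>\<^sub>0 laurent) \<Rightarrow> ('b \<Rightarrow>\<^sub>0 laurent)" where
  "scale r x = Poly_Mapping.map (\<lambda>c. r * c) x"

definition linear_extension ::
  "('b \<Rightarrow> ('c \<Rightarrow>\<^sub>0 laurent)) \<Rightarrow> ('b \<Rightarrow>\<^sub>0 laurent) \<Rightarrow> ('c \<Rightarrow>\<^sub>0 laurent)" where
  "linear_extension f x =
     (\<Sum>b\<in>Poly_Mapping.keys x. scale (Poly_Mapping.lookup x b) (f b))"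


section \<open>Cleaved links\<close>

datatype sgn_dec = Plus | Minus

type_synonym decoration = "point set \<Rightarrow> sgn_dec"

text \<open>A tuple \<open>(D, p, L, \<sigma>)\<close> of the inside disc, the marked point, the link and the decoration.
  The oriented equator is recorded by its inside disc \<open>D\<close>, as \<open>C = \<partial>D\<close>; hence a diffeomorphism
  carries one oriented equator to the other iff it carries one inside disc to the other.\<close>

type_synonym cleaved = "point set \<times> point \<times> point set \<times> decoration"

fun cleaved_link :: "nat \<Rightarrow> cleaved \<Rightarrow> bool" where
  "cleaved_link n (D, p, L, \<sigma>) \<longleftrightarrow>
     D \<subseteq> S2 \<and> embedded_disc D \<and> p \<in> bd D \<and> L \<subseteq> S2 \<and> circle_union L \<and>
     (\<forall>K\<in>components L. K \<inter> bd D \<noteq> {}) \<and> (\<forall>x\<in>L \<inter> bd D. transverse_at L (bd D) x) \<and>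
     p \<notin> L \<and> finite (L \<inter> bd D) \<and> card (L \<inter> bd D) = 2 * n \<and>
     \<sigma> \<in> components L \<rightarrow>\<^sub>E UNIV"

fun cleaved_iso :: "cleaved \<Rightarrow> cleaved \<Rightarrow> bool" where
  "cleaved_iso (D, p, L, \<sigma>) (D', p', L', \<sigma>') \<longleftrightarrow>
     (\<exists>f. diffeo S2 S2 f \<and> orientation_preserving f \<and> f ` D = D' \<and> f p = p' \<and> f ` L = L' \<and>
          (\<forall>K\<in>components L. \<sigma>' (f ` K) = \<sigma> K))"

definition cleaved_equiv :: "nat \<Rightarrow> (cleaved \<times> cleaved) set" where
  "cleaved_equiv n =
     {(X, Y). cleaved_link n X \<and> cleaved_link n Y \<and> cleaved_iso X Y}"

definition CL :: "nat \<Rightarrow> cleaved set set" where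
  "CL n = {X. cleaved_link n X} // cleaved_equiv n"

text \<open>The tensor product \<open>\<I>\<^bsub>2n\<^sub>1\<^esub> \<otimes> \<dots> \<otimes> \<I>\<^bsub>2n\<^sub>m\<^esub>\<close> is realised as the free module on the product of the
  bases, i.e. on the lists \<open>[c\<^sub>1, \<dots>, c\<^sub>m]\<close> with \<open>c\<^sub>i \<in> CL n\<^sub>i\<close>.\<close>

definition tensor_I :: "nat list \<Rightarrow> (cleaved set list \<Rightarrow>\<^sub>0 laurent) set" where
  "tensor_I ns = {x. Poly_Mapping.keys x \<subseteq> listset (map CL ns)}"

text \<open>The class of the empty link with equator \<open>\<partial>D\<^sub>i\<close>, that is \<open>I\<^sub>0\<close>.\<close>

definition empty_class :: "disc_config \<Rightarrow> nat \<Rightarrow> cleaved set" where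
  "empty_class \<D> i =
     cleaved_equiv 0 `` {(disc \<D> i, mark \<D> i, {}, \<lambda>K. undefined)}"


section \<open>Multiply cleaved links and partition maps\<close>

type_synonym multi_link = "point set \<times> decoration"

fun multi_cleaved_link :: "disc_config \<Rightarrow> multi_link \<Rightarrow> bool" where
  "multi_cleaved_link \<D> (M, \<sigma>) \<longleftrightarrow>
     M \<subseteq> S2 \<and> circle_union M \<and>
     (\<forall>i\<le>holes \<D>. mark \<D> i \<notin> M \<and>
        (\<forall>x\<in>M \<inter> dcirc \<D> i. transverse_at M (dcirc \<D> i) x)) \<and>
     (\<forall>K\<in>components M. \<not> K \<subseteq> S2 - disc \<D> 0 \<and>
        (\<forall>i\<in>{1..holes \<D>}. \<not> K \<subseteq> inner (disc \<D> i))) \<and>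
     \<sigma> \<in> components M \<rightarrow>\<^sub>E UNIV"

fun multi_iso :: "disc_config \<Rightarrow> multi_link \<Rightarrow> multi_link \<Rightarrow> bool" where
  "multi_iso \<D> (M, \<sigma>) (M', \<sigma>') \<longleftrightarrow>
     (\<exists>f. diffeo S2 S2 f \<and> (\<forall>x\<in>Sig \<D>. f x = x) \<and> f ` M = M' \<and>
          (\<forall>K\<in>components M. \<sigma>' (f ` K) = \<sigma> K))"

text \<open>A planar diagram enters only through its underlying point set \<open>P\<close>. If \<open>P\<close> is not the
  underlying set of a planar diagram, no \<open>M\<close> satisfies \<open>M \<inter> Sig \<D> = P\<close>.\<close>

definition multi_reps :: "disc_config \<Rightarrow> point set \<Rightarrow> multi_link set" where
  "multi_reps \<D> P = {x. multi_cleaved_link \<D> x \<and> fst x \<inter> Sig \<D> = P}"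

definition MCL :: "disc_config \<Rightarrow> point set \<Rightarrow> multi_link set set" where
  "MCL \<D> P =
     multi_reps \<D> P // {(x, y). x \<in> multi_reps \<D> P \<and> y \<in> multi_reps \<D> P \<and> multi_iso \<D> x y}"

fun boundary_rep :: "disc_config \<Rightarrow> nat \<Rightarrow> multi_link \<Rightarrow> cleaved set" where
  "boundary_rep \<D> i (M, \<sigma>) =
     (let \<K> = {K \<in> components M. K \<inter> dcirc \<D> i \<noteq> {}}
      in cleaved_equiv (half_points \<D> M i) `` {(disc \<D> i, mark \<D> i, \<Union>\<K>, restrict \<sigma> \<K>)})"

definition num_circles_met :: "disc_config \<Rightarrow> point set \<Rightarrow> nat" where
  "num_circles_met \<D> K = card {i \<in> {0..holes \<D>}. K \<inter> dcirc \<D> i \<noteq> {}}"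

fun weight_rep :: "disc_config \<Rightarrow> multi_link \<Rightarrow> laurent" where
  "weight_rep \<D> (M, \<sigma>) =
     (\<Prod>K\<in>components M.
        (case \<sigma> K of Plus \<Rightarrow> qhalf (2 - int (num_circles_met \<D> K))
                   | Minus \<Rightarrow> qhalf (int (num_circles_met \<D> K) - 2)))"

text \<open>Boundary and weight are constant on equivalence classes, hence descend to \<open>MCL\<close>.\<close>

definition boundary :: "disc_config \<Rightarrow> nat \<Rightarrow> multi_link set \<Rightarrow> cleaved set" where
  "boundary \<D> i \<mu> = the_elem (boundary_rep \<D> i ` \<mu>)"

definition weight :: "disc_config \<Rightarrow> multi_link set \<Rightarrow> laurent" where
  "weight \<D> \<mu> = the_elem (weight_rep \<D> ` \<mu>)"

definition partition_basis ::
  "disc_config \<Rightarrow> point set \<Rightarrow> cleaved set list \<Rightarrow> (cleaved set \<Rightarrow>\<^sub>0 laurent)" where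
  "partition_basis \<D> P b =
     (\<Sum>\<mu> | \<mu> \<in> MCL \<D> P \<and> (\<forall>i<holes \<D>. boundary \<D> (Suc i) \<mu> = b ! i).
        Poly_Mapping.single (boundary \<D> 0 \<mu>) (weight \<D> \<mu>))"

definition partition_map ::
  "disc_config \<Rightarrow> point set \<Rightarrow> (cleaved set list \<Rightarrow>\<^sub>0 laurent) \<Rightarrow> (cleaved set \<Rightarrow>\<^sub>0 laurent)" where
  "partition_map \<D> P =
     restrict (linear_extension (partition_basis \<D> P)) (tensor_I (tl (signature \<D> P)))"


section \<open>Tangle and link diagrams\<close>

text \<open>A diagram is its underlying point set, its set of crossings, and for each crossing \<open>c\<close> an
  orientation-preserving disc chart centred at \<open>c\<close> in which the diagram is the coordinate cross,
  with the overstrand on the real axis and the understrand on the imaginary axis. Away from the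
  crossings the point set is a smooth 1-manifold.\<close>

record diagram =
  curve :: "point set"
  crossings :: "point set"
  chart :: "point \<Rightarrow> complex \<Rightarrow> point"

record oriented_diagram = diagram +
  dir :: "point \<Rightarrow> point"

definition diagram_in :: "point set \<Rightarrow> ('a) diagram_scheme \<Rightarrow> bool" where
  "diagram_in R T \<longleftrightarrow>
     compact (curve T) \<and> finite (crossings T) \<and>
     (\<forall>c\<in>crossings T. oriented_chart (chart T c) \<and> chart T c ` cball 0 1 \<subseteq> R \<and> chart T c 0 = c \<and>
        curve T \<inter> chart T c ` cball 0 1 = chart T c ` {z \<in> cball 0 1. Re z = 0 \<or> Im z = 0}) \<and>
     (\<forall>c\<in>crossings T. \<forall>d\<in>crossings T. c \<noteq> d \<longrightarrow>
        chart T c ` cball 0 1 \<inter> chart T d ` cball 0 1 = {}) \<and>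
     (\<forall>p\<in>curve T \<inter> R - crossings T. interior_arc_point (curve T) p)"

definition link_diagram :: "('a) diagram_scheme \<Rightarrow> bool" where
  "link_diagram L \<longleftrightarrow> curve L \<subseteq> S2 \<and> diagram_in S2 L"

definition tangle_diagram :: "disc_config \<Rightarrow> ('a) diagram_scheme \<Rightarrow> bool" where
  "tangle_diagram \<D> T \<longleftrightarrow>
     curve T \<subseteq> Sig \<D> \<and> diagram_in (Sig_int \<D>) T \<and>
     (\<forall>i\<le>holes \<D>. mark \<D> i \<notin> curve T \<and>
        finite (curve T \<inter> dcirc \<D> i) \<and> even (card (curve T \<inter> dcirc \<D> i)) \<and>
        (\<forall>p\<in>curve T \<inter> dcirc \<D> i.
           arc_endpoint (curve T) p \<and> transverse_at (curve T) (dcirc \<D> i) p))"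

text \<open>An orientation is a unit tangent direction at each point other than a crossing, locally
  induced by a parametrisation, and continuing along each of the two strands through a crossing.\<close>

definition is_orientation :: "('a) oriented_diagram_scheme \<Rightarrow> bool" where
  "is_orientation T \<longleftrightarrow>
     (\<forall>p\<in>curve T - crossings T.
        \<exists>J\<in>{{-1<..<1}, {0..<1}, {-1<..0}}. \<exists>U \<gamma>. open U \<and> diffeo J (curve T \<inter> U) \<gamma> \<and> \<gamma> 0 = p \<and>
          (\<forall>t\<in>J. dir T (\<gamma> t) = sgn (vector_derivative \<gamma> (at t within J)))) \<and>
     (\<forall>c\<in>crossings T. \<forall>e\<in>{1, \<i>}. \<exists>s\<in>{1, -1}. \<forall>t\<in>{-1..1} - {0}.
        dir T (chart T c (of_real t * e)) =
          s *\<^sub>R sgn (vector_derivative (\<lambda>u. chart T c (of_real u * e)) (at t within {-1..1})))"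

definition oriented_link_diagram :: "('a) oriented_diagram_scheme \<Rightarrow> bool" where
  "oriented_link_diagram L \<longleftrightarrow> link_diagram L \<and> is_orientation L"

definition oriented_tangle_diagram ::
  "disc_config \<Rightarrow> ('a) oriented_diagram_scheme \<Rightarrow> bool" where
  "oriented_tangle_diagram \<D> T \<longleftrightarrow> tangle_diagram \<D> T \<and> is_orientation T"

text \<open>Directions at a crossing of the overstrand (\<open>e = 1\<close>) and of the understrand (\<open>e = \<i>\<close>).
  The crossing is positive iff (over, under) is a positive frame.\<close>

definition strand_dir :: "('a) oriented_diagram_scheme \<Rightarrow> point \<Rightarrow> complex \<Rightarrow> point" where
  "strand_dir T c e = Lim (at_right 0) (\<lambda>t. dir T (chart T c (of_real t * e)))"

definition n_pos :: "('a) oriented_diagram_scheme \<Rightarrow> nat" where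
  "n_pos T = card {c \<in> crossings T. 0 < c \<bullet> cross3 (strand_dir T c 1) (strand_dir T c \<i>)}"

definition n_neg :: "('a) oriented_diagram_scheme \<Rightarrow> nat" where
  "n_neg T = card {c \<in> crossings T. c \<bullet> cross3 (strand_dir T c 1) (strand_dir T c \<i>) < 0}"

definition writhe_factor :: "('a) oriented_diagram_scheme \<Rightarrow> laurent" where
  "writhe_factor T = (-1) ^ n_neg T * qhalf (2 * (int (n_pos T) - 2 * int (n_neg T)))"


section \<open>Resolutions\<close>

definition flat :: "real \<Rightarrow> real" where
  "flat t = (if 0 < t then exp (- 1 / t) else 0)"

text \<open>The curve \<open>s \<mapsto> flat (1 + s) - \<i> flat (1 - s)\<close> is smooth and embedded. It runs in the fourth
  quadrant of the unit disc from \<open>-\<i>\<close> to \<open>1\<close> (both excluded), and lies on the coordinate axes for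
  \<open>\<bar>s\<bar> \<ge> 1\<close>. Rotating the real axis (overstrand) counterclockwise to the imaginary axis sweeps
  out the first and third quadrants, so smoothing 0 consists of arcs in the second and fourth.\<close>

definition smoothing :: "nat \<Rightarrow> complex set" where
  "smoothing k =
     (let A = range (\<lambda>s. Complex (flat (1 + s)) (if k = 0 then - flat (1 - s) else flat (1 - s)))
      in A \<union> uminus ` A)"

text \<open>Smooth the crossings in \<open>Y\<close>, each \<open>c \<in> Y\<close> by its \<open>\<rho> c\<close>-resolution.\<close>

definition resolve ::
  "('a) diagram_scheme \<Rightarrow> point set \<Rightarrow> (point \<Rightarrow> nat) \<Rightarrow> ('a) diagram_scheme" where
  "resolve T Y \<rho> =
     T\<lparr>curve := (curve T - (\<Union>c\<in>Y. chart T c ` ball 0 1)) \<union> (\<Union>c\<in>Y. chart T c ` smoothing (\<rho> c)),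
       crossings := crossings T - Y\<rparr>"

definition resolutions :: "('a) diagram_scheme \<Rightarrow> (point \<Rightarrow> nat) set" where
  "resolutions T = crossings T \<rightarrow>\<^sub>E {0, 1}"

definition tangle_sum ::
  "disc_config \<Rightarrow> ('a) diagram_scheme \<Rightarrow>
     (cleaved set list \<Rightarrow>\<^sub>0 laurent) \<Rightarrow> (cleaved set \<Rightarrow>\<^sub>0 laurent)" where
  "tangle_sum \<D> T x =
     (\<Sum>\<rho>\<in>resolutions T. scale ((- q) ^ (\<Sum>c\<in>crossings T. \<rho> c))
        (partition_map \<D> (curve (resolve T (crossings T) \<rho>)) x))"

definition tangle_map ::
  "disc_config \<Rightarrow> ('a) oriented_diagram_scheme \<Rightarrow>
     (cleaved set list \<Rightarrow>\<^sub>0 laurent) \<Rightarrow> (cleaved set \<Rightarrow>\<^sub>0 laurent)" where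
  "tangle_map \<D> T x = scale (writhe_factor T) (tangle_sum \<D> T x)"


section \<open>Khovanov's version of the Jones polynomial\<close>

definition bracket_relations :: "(diagram \<Rightarrow> laurent) \<Rightarrow> bool" where
  "bracket_relations J \<longleftrightarrow>
     (\<forall>L. link_diagram L \<longrightarrow> curve L = {} \<longrightarrow> J L = 1) \<and>
     (\<forall>L. link_diagram L \<longrightarrow> crossings L = {} \<longrightarrow> embedded_circle (curve L) \<longrightarrow> J L = q + q_inv) \<and>
     (\<forall>L U. link_diagram L \<longrightarrow> embedded_circle U \<longrightarrow> curve L \<inter> U = {} \<longrightarrow>
        link_diagram (L\<lparr>curve := curve L \<union> U\<rparr>) \<longrightarrow>
        J (L\<lparr>curve := curve L \<union> U\<rparr>) = (q + q_inv) * J L) \<and>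
     (\<forall>L c. link_diagram L \<longrightarrow> c \<in> crossings L \<longrightarrow>
        J L = J (resolve L {c} (\<lambda>_. 0)) - q * J (resolve L {c} (\<lambda>_. 1)))"

definition bracket :: "diagram \<Rightarrow> laurent" where
  "bracket = (THE J. J \<in> extensional {L. link_diagram L} \<and> bracket_relations J)"

definition jones :: "oriented_diagram \<Rightarrow> laurent" where
  "jones L = writhe_factor L * bracket (diagram.truncate L)"

end

theory Submission
  imports Defs
begin

text \<open>
  A tangle of signature \<open>(0;0)\<close> has no endpoints, so it is a link diagram \<open>L\<close> in the interior of an
  annulus. Both sides of the claim are evaluated as the same sum over the resolutions \<open>\<rho>\<close> of \<open>L\<close>,
  \<open>\<Sum>\<rho>. (- q) ^ h(\<rho>) * (q + q\<^sup>-\<^sup>1) ^ c(\<rho>)\<close>, where \<open>c(\<rho>)\<close> is the number of circles of the resolved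
  diagram; the writhe factors of the two sides are equal by definition.

  For the partition map, a multiply cleaved link that extends a resolution \<open>P\<close> has no component
  outside the annulus, because \<open>P\<close> misses the two boundary circles. So the links over \<open>P\<close> are the
  decorations of \<open>P\<close>, and summing their weights \<open>q\<^sup>\<plusminus>\<^sup>1\<close> gives \<open>(q + q\<^sup>-\<^sup>1) ^ c(\<rho>)\<close>
  (\<open>annulus_partition_map\<close>). For the Jones polynomial, the state sum satisfies the defining
  relations of the bracket, and these have only one solution, by induction on the number of
  crossings and then on the number of circles (\<open>bracket_eq_state_sum\<close>).

  Both computations presuppose that a full resolution is a finite disjoint union of smooth
  circles. Diagrams are only known to be compact and to be smooth arcs near each point away from
  the crossings. So two facts of differential topology are proved here. The first is that
  smoothing a crossing yields a smooth one-dimensional manifold again (\<open>link_diagram_resolve\<close>): the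
  smoothing curve agrees with the cross near the boundary of the chart, and the images of open discs
  are open in the sphere by invariance of domain. The second is that a compact one-dimensional
  manifold is a finite disjoint union of circles (\<open>compact_one_manifold_circle_union\<close>). For this,
  local parametrisations by arc length are continued to a curve defined on the whole line. By
  compactness the curve returns to a point it has visited. It does so in the same direction, since
  otherwise it would turn back on itself halfway. Hence it is periodic, and it induces a
  diffeomorphism from the unit circle onto a component.
\<close>

section \<open>Smooth functions on open sets\<close>

lemma Ck_on_cong_imp:
  assumes "open U" "Ck_on k U f" "\<And>x. x \<in> U \<Longrightarrow> f x = g x"
  shows "Ck_on k U g"
  using assms(2,3)
proof (induction k arbitrary: f g)
  case 0
  then show ?case by (simp cong: continuous_on_cong)
next
  case (Suc k)
  have d: "f differentiable at x" if "x \<in> U" for x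
    using Suc.prems(1) that assms(1) by (auto simp: differentiable_on_eq_differentiable_at)
  have hd: "(g has_derivative frechet_derivative f (at x)) (at x)" if "x \<in> U" for x
    by (rule has_derivative_transform_within_open[OF frechet_derivative_works[THEN iffD1, OF d[OF that]] assms(1) that])
       (rule Suc.prems(2))
  have fd: "frechet_derivative g (at x) = frechet_derivative f (at x)" if "x \<in> U" for x
    using frechet_derivative_at[OF hd[OF that]] by simp
  have "Ck_on k U (\<lambda>x. frechet_derivative g (at x) v)" for v
    using Suc.IH[of "\<lambda>x. frechet_derivative f (at x) v" "\<lambda>x. frechet_derivative g (at x) v"] Suc.prems(1)
    by (simp add: fd)
  then show ?case
    using hd assms(1) by (auto simp: differentiable_on_eq_differentiable_at differentiable_def)
qed

lemma Ck_on_Suc_has_derivative: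
  assumes "open U" "Ck_on (Suc k) U f" "x \<in> U"
  shows "(f has_derivative frechet_derivative f (at x)) (at x)"
  using assms by (simp add: differentiable_on_eq_differentiable_at flip: frechet_derivative_works)

lemma Ck_on_SucI:
  assumes "open U" "\<And>x. x \<in> U \<Longrightarrow> (f has_derivative f' x) (at x)"
    and "\<And>v. Ck_on k U (\<lambda>x. f' x v)"
  shows "Ck_on (Suc k) U f"
proof -
  have "f differentiable_on U"
    using assms(1,2) by (auto simp: differentiable_on_eq_differentiable_at differentiable_def)
  moreover have "Ck_on k U (\<lambda>x. frechet_derivative f (at x) v)" for v
    by (rule Ck_on_cong_imp[OF assms(1) assms(3)[of v]]) (simp add: frechet_derivative_at[OF assms(2), symmetric])
  ultimately show ?thesis by simp
qed

lemma Ck_on_Suc_imp: "Ck_on (Suc k) U f \<Longrightarrow> Ck_on k U f"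
proof (induction k arbitrary: f)
  case 0
  then show ?case by (simp add: differentiable_imp_continuous_on)
next
  case (Suc k)
  then show ?case by (metis Ck_on.simps(2))
qed

lemma Ck_on_imp_continuous_on: "Ck_on k U f \<Longrightarrow> continuous_on U f"
  by (cases k) (auto simp: differentiable_imp_continuous_on)

lemma Ck_on_subset:
  assumes "open U" "open V" "V \<subseteq> U" "Ck_on k U f"
  shows "Ck_on k V f"
  using assms(4)
proof (induction k arbitrary: f)
  case 0
  then show ?case using assms(3) by (auto intro: continuous_on_subset)
next
  case (Suc k)
  then show ?case using assms(3) by (auto intro: differentiable_on_subset)
qed

lemma Ck_on_local:
  assumes "\<And>x. x \<in> U \<Longrightarrow> \<exists>V. open V \<and> x \<in> V \<and> Ck_on k V f" "open U"
  shows "Ck_on k U f"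
  using assms(1)
proof (induction k arbitrary: f)
  case 0
  then show ?case
    by (metis Ck_on.simps(1) assms(2) continuous_on_eq_continuous_at)
next
  case (Suc k)
  have "f differentiable (at x)" if "x \<in> U" for x
    using Suc.prems[OF that] by (auto simp: differentiable_on_eq_differentiable_at)
  moreover have "Ck_on k U (\<lambda>x. frechet_derivative f (at x) v)" for v
    using Suc.IH[of "\<lambda>x. frechet_derivative f (at x) v"] Suc.prems by auto
  ultimately show ?case using assms(2) by (auto simp: differentiable_on_eq_differentiable_at)
qed

lemma Ck_on_const: "open U \<Longrightarrow> Ck_on k U (\<lambda>x. c)"
proof (induction k arbitrary: c)
  case (Suc k)
  then show ?case by (intro Ck_on_SucI[where f' = "\<lambda>_ _. 0"]) auto
qed auto

lemma Ck_on_bounded_linear: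
  assumes "open U" "bounded_linear L" shows "Ck_on k U L"
proof (cases k)
  case 0
  then show ?thesis using assms(2) by (simp add: linear_continuous_on)
next
  case (Suc n)
  show ?thesis unfolding Suc
    by (rule Ck_on_SucI[where f' = "\<lambda>_. L"])
       (use assms in \<open>auto simp: bounded_linear_imp_has_derivative Ck_on_const\<close>)
qed

lemma Ck_on_add:
  assumes "open U" "Ck_on k U f" "Ck_on k U g"
  shows "Ck_on k U (\<lambda>x. f x + g x)"
  using assms(2,3)
proof (induction k arbitrary: f g)
  case 0
  then show ?case by (simp add: continuous_on_add)
next
  case (Suc k)
  show ?case
    by (rule Ck_on_SucI[OF assms(1) has_derivative_add[OF Ck_on_Suc_has_derivative[OF assms(1) Suc.prems(1)]
            Ck_on_Suc_has_derivative[OF assms(1) Suc.prems(2)]]])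
       (use Suc in auto)
qed

lemma Ck_on_sum:
  assumes "open U" "\<And>i. i \<in> I \<Longrightarrow> Ck_on k U (f i)"
  shows "Ck_on k U (\<lambda>x. \<Sum>i\<in>I. f i x)"
proof (cases "finite I")
  case True
  from this assms(2) show ?thesis
    by (induction I) (auto intro!: Ck_on_add Ck_on_const assms(1))
qed (simp add: Ck_on_const assms(1))

lemma Ck_on_bilinear:
  assumes "open U" "bounded_bilinear B" "Ck_on k U f" "Ck_on k U g"
  shows "Ck_on k U (\<lambda>x. B (f x) (g x))"
  using assms(3,4)
proof (induction k arbitrary: f g)
  case 0
  then show ?case using bounded_bilinear.continuous_on[OF assms(2)] by simp
next
  case (Suc k)
  have k: "Ck_on k U f" "Ck_on k U g" using Suc.prems Ck_on_Suc_imp by blast+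
  show ?case
    by (rule Ck_on_SucI[OF assms(1) bounded_bilinear.FDERIV[OF assms(2) 
            Ck_on_Suc_has_derivative[OF assms(1) Suc.prems(1)]
            Ck_on_Suc_has_derivative[OF assms(1) Suc.prems(2)]]])
       (use Suc k in \<open>auto intro!: Ck_on_add assms(1)\<close>)
qed

text \<open>The chain rule writes a directional derivative of \<open>g \<circ> f\<close> in the fixed directions of the standard
  basis, so that it becomes a sum of products of functions to which the induction hypothesis and
  the product rule apply.\<close>

lemma Ck_on_compose:
  assumes "open U" "open V" "f ` U \<subseteq> V" "Ck_on k U f" "Ck_on k V g"
  shows "Ck_on k U (\<lambda>x. g (f x))"
  using assms(4,5)
proof (induction k arbitrary: g)
  case 0
  then show ?case using assms(3) by (auto intro: continuous_on_compose2)
next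
  case (Suc k)
  have fk: "Ck_on k U f" using Suc.prems Ck_on_Suc_imp by blast
  let ?Df = "\<lambda>x. frechet_derivative f (at x)" and ?Dg = "\<lambda>x. frechet_derivative g (at x)"
  have df: "(f has_derivative ?Df x) (at x)" if "x \<in> U" for x
    using Ck_on_Suc_has_derivative[OF assms(1) Suc.prems(1) that] .
  have dg: "(g has_derivative ?Dg y) (at y)" if "y \<in> V" for y
    using Ck_on_Suc_has_derivative[OF assms(2) Suc.prems(2) that] .
  have D: "((\<lambda>x. g (f x)) has_derivative (\<lambda>v. \<Sum>b\<in>Basis. (?Df x v \<bullet> b) *\<^sub>R ?Dg (f x) b)) (at x)"
    if "x \<in> U" for x
  proof -
    have fV: "f x \<in> V" using that assms(3) by auto
    have "((\<lambda>x. g (f x)) has_derivative (\<lambda>v. ?Dg (f x) (?Df x v))) (at x)"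
      using has_derivative_compose[OF df[OF that] dg[OF fV]] .
    moreover have "?Dg (f x) w = (\<Sum>b\<in>Basis. (w \<bullet> b) *\<^sub>R ?Dg (f x) b)" for w
    proof -
      have l: "linear (?Dg (f x))" by (rule has_derivative_linear[OF dg[OF fV]])
      have "?Dg (f x) w = ?Dg (f x) (\<Sum>b\<in>Basis. (w \<bullet> b) *\<^sub>R b)"
        by (simp add: euclidean_representation)
      then show ?thesis by (simp add: linear_sum[OF l] linear_scale[OF l])
    qed
    then have "(\<lambda>v. ?Dg (f x) (?Df x v)) = (\<lambda>v. \<Sum>b\<in>Basis. (?Df x v \<bullet> b) *\<^sub>R ?Dg (f x) b)"
      by (intro ext)
    ultimately show ?thesis by (simp only:)
  qed
  show ?case
  proof (rule Ck_on_SucI[OF assms(1) D])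
    fix v
    have Dg: "Ck_on k U (\<lambda>x. ?Dg (f x) b)" for b
      using Suc.IH[OF fk, of "\<lambda>y. ?Dg y b"] Suc.prems(2) by simp
    have Df: "Ck_on k U (\<lambda>x. ?Df x v \<bullet> b)" for b
      using Suc.prems(1) Ck_on_bilinear[OF assms(1) bounded_bilinear_inner _ Ck_on_const[OF assms(1)], of k "\<lambda>x. ?Df x v" b]
      by simp
    show "Ck_on k U (\<lambda>x. \<Sum>b\<in>Basis. (?Df x v \<bullet> b) *\<^sub>R ?Dg (f x) b)"
      by (rule Ck_on_sum[OF assms(1) Ck_on_bilinear[OF assms(1) bounded_bilinear_scaleR Df Dg]])
  qed
qed

text \<open>The derivative of inversion is a product of inversions, which feeds the induction.\<close>

lemma Ck_on_inverse:
  fixes f :: "'a::euclidean_space \<Rightarrow> 'b::{euclidean_space, real_normed_field}"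
  assumes "open U" "Ck_on k U f" "\<And>x. x \<in> U \<Longrightarrow> f x \<noteq> 0"
  shows "Ck_on k U (\<lambda>x. inverse (f x))"
proof -
  have *: "Ck_on k (-{0}) (inverse :: 'b \<Rightarrow> 'b)" for k
  proof (induction k)
    case 0
    then show ?case by (simp add: continuous_on_inverse)
  next
    case (Suc k)
    have neg: "Ck_on k (-{0}) (\<lambda>x. - f x)" if "Ck_on k (-{0}) f" for f :: "'b \<Rightarrow> 'b"
      using Ck_on_compose[OF _ open_UNIV _ that Ck_on_bounded_linear[OF open_UNIV bounded_linear_minus[OF bounded_linear_ident]]]
      by auto
    show ?case
    proof (rule Ck_on_SucI[where f' = "\<lambda>x v. - (inverse x * v * inverse x)"])
      show "open (-{0::'b})" by auto
      show "(inverse has_derivative (\<lambda>v. - (inverse x * v * inverse x))) (at x)" if "x \<in> - {0}" for x :: 'b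
        by (rule has_derivative_inverse') (use that in auto)
      show "Ck_on k (-{0}) (\<lambda>x. - (inverse x * v * inverse x))" for v :: 'b
      proof (rule neg)
        have "Ck_on k (-{0}) (\<lambda>x. inverse x * v)"
          by (rule Ck_on_bilinear[OF _ bounded_bilinear_mult Suc Ck_on_const]) auto
        then show "Ck_on k (-{0}) (\<lambda>x. inverse x * v * inverse x)"
          by (rule Ck_on_bilinear[OF _ bounded_bilinear_mult _ Suc, rotated]) auto
      qed
    qed
  qed
  have fU: "f ` U \<subseteq> -{0}" by (rule image_subsetI) (simp add: assms(3))
  have "open (-{0::'b})" by (rule open_Compl) simp
  then show ?thesis
    using Ck_on_compose[where f=f and g=inverse and V="-{0}" and U=U and k=k] assms(1,2) fU * by simp
qed

text \<open>For curves the directional derivatives reduce to the velocity.\<close>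

lemma Ck_on_Suc_vector_derivative:
  fixes \<gamma> :: "real \<Rightarrow> 'a::euclidean_space"
  assumes "open J" "\<And>t. t \<in> J \<Longrightarrow> (\<gamma> has_vector_derivative \<gamma>' t) (at t)"
  shows "Ck_on (Suc k) J \<gamma> \<longleftrightarrow> Ck_on k J \<gamma>'"
proof
  assume "Ck_on (Suc k) J \<gamma>"
  then have "Ck_on k J (\<lambda>t. frechet_derivative \<gamma> (at t) 1)" by simp
  moreover have "frechet_derivative \<gamma> (at t) 1 = \<gamma>' t" if "t \<in> J" for t
    by (simp flip: frechet_derivative_at[OF assms(2)[OF that, unfolded has_vector_derivative_def]])
  ultimately show "Ck_on k J \<gamma>'" by (rule Ck_on_cong_imp[OF assms(1)])
next
  assume "Ck_on k J \<gamma>'"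
  then have "Ck_on k J (\<lambda>t. v *\<^sub>R \<gamma>' t)" for v
    by (rule Ck_on_bilinear[OF assms(1) bounded_bilinear_scaleR Ck_on_const[OF assms(1)]])
  from Ck_on_SucI[OF assms(1) assms(2)[unfolded has_vector_derivative_def] this]
  show "Ck_on (Suc k) J \<gamma>" .
qed

text \<open>Iterated directional derivatives are only meaningful on open sets, so openness of the domain is
  made part of the notion.\<close>

definition smooth_on :: "'a::euclidean_space set \<Rightarrow> ('a \<Rightarrow> 'b::euclidean_space) \<Rightarrow> bool" where
  "smooth_on U f \<longleftrightarrow> open U \<and> (\<forall>k. Ck_on k U f)"

lemma smooth_on_cong:
  assumes "smooth_on U f" "\<And>x. x \<in> U \<Longrightarrow> f x = g x" shows "smooth_on U g"
proof -
  have U: "open U" "\<And>k. Ck_on k U f" using assms(1) by (auto simp: smooth_on_def)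
  have "Ck_on k U g" for k by (rule Ck_on_cong_imp[OF U]) (rule assms(2))
  then show ?thesis using U(1) by (simp add: smooth_on_def)
qed

lemma smooth_on_subset: "smooth_on U f \<Longrightarrow> open V \<Longrightarrow> V \<subseteq> U \<Longrightarrow> smooth_on V f"
  by (simp add: smooth_on_def Ck_on_subset[of U V _ f])

lemma smooth_on_local:
  assumes "\<And>x. x \<in> U \<Longrightarrow> \<exists>V. x \<in> V \<and> smooth_on V f" "open U"
  shows "smooth_on U f"
  unfolding smooth_on_def
proof (intro conjI allI assms(2) Ck_on_local[OF _ assms(2)])
  fix k x assume "x \<in> U"
  then show "\<exists>V. open V \<and> x \<in> V \<and> Ck_on k V f"
    using assms(1) unfolding smooth_on_def by blast
qed

lemma smooth_on_compose:
  assumes "smooth_on U f" "smooth_on V g" "f ` U \<subseteq> V"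
  shows "smooth_on U (\<lambda>x. g (f x))"
  using assms Ck_on_compose[of U V f _ g] by (simp add: smooth_on_def)

lemma smooth_on_imp_continuous_on: "smooth_on U f \<Longrightarrow> continuous_on U f"
  using Ck_on_imp_continuous_on[of 0 U f] by (simp add: smooth_on_def)

lemma smooth_on_imp_differentiable:
  "smooth_on U f \<Longrightarrow> x \<in> U \<Longrightarrow> f differentiable (at x)"
  using Ck_on_Suc_has_derivative[of U 0 f x] by (auto simp: smooth_on_def differentiable_def simp del: Ck_on.simps)

lemma smooth_on_const: "open U \<Longrightarrow> smooth_on U (\<lambda>x. c)"
  by (simp add: smooth_on_def Ck_on_const)

lemma smooth_on_bounded_linear: "open U \<Longrightarrow> bounded_linear L \<Longrightarrow> smooth_on U L"
  by (simp add: smooth_on_def Ck_on_bounded_linear)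

lemma smooth_on_ident: "open U \<Longrightarrow> smooth_on U (\<lambda>x. x)"
  by (rule smooth_on_bounded_linear) (auto simp: bounded_linear_ident)

lemma smooth_on_add: "smooth_on U f \<Longrightarrow> smooth_on U g \<Longrightarrow> smooth_on U (\<lambda>x. f x + g x)"
  by (simp add: smooth_on_def Ck_on_add)

lemma smooth_on_bilinear:
  "bounded_bilinear B \<Longrightarrow> smooth_on U f \<Longrightarrow> smooth_on U g \<Longrightarrow> smooth_on U (\<lambda>x. B (f x) (g x))"
  by (simp add: smooth_on_def Ck_on_bilinear)

lemmas smooth_on_scaleR = smooth_on_bilinear[OF bounded_bilinear_scaleR]
lemmas smooth_on_mult = smooth_on_bilinear[OF bounded_bilinear_mult]
lemmas smooth_on_inner = smooth_on_bilinear[OF bounded_bilinear_inner]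

lemma smooth_on_linear_compose:
  "bounded_linear L \<Longrightarrow> smooth_on U f \<Longrightarrow> smooth_on U (\<lambda>x. L (f x))"
  by (rule smooth_on_compose[OF _ smooth_on_bounded_linear[OF open_UNIV]]) auto

lemma smooth_on_minus: "smooth_on U f \<Longrightarrow> smooth_on U (\<lambda>x. - f x)"
  by (rule smooth_on_linear_compose[OF bounded_linear_minus[OF bounded_linear_ident]])

lemma smooth_on_diff: "smooth_on U f \<Longrightarrow> smooth_on U g \<Longrightarrow> smooth_on U (\<lambda>x. f x - g x)"
  using smooth_on_add[of U f "\<lambda>x. - g x"] smooth_on_minus[of U g] by simp

lemma smooth_on_curve_iff:
  fixes \<gamma> :: "real \<Rightarrow> 'a::euclidean_space"
  assumes "open J" "\<And>t. t \<in> J \<Longrightarrow> (\<gamma> has_vector_derivative \<gamma>' t) (at t)"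
  shows "smooth_on J \<gamma> \<longleftrightarrow> smooth_on J \<gamma>'"
proof
  assume "smooth_on J \<gamma>"
  then have "Ck_on (Suc k) J \<gamma>" for k by (simp add: smooth_on_def del: Ck_on.simps)
  then have "Ck_on k J \<gamma>'" for k
    using Ck_on_Suc_vector_derivative[OF assms, of k] by blast
  then show "smooth_on J \<gamma>'"
    using assms(1) by (simp add: smooth_on_def)
next
  assume "smooth_on J \<gamma>'"
  then have "Ck_on (Suc k) J \<gamma>" for k
    using Ck_on_Suc_vector_derivative[OF assms, of k] by (simp add: smooth_on_def)
  then have "Ck_on k J \<gamma>" for k by (rule Ck_on_Suc_imp)
  then show "smooth_on J \<gamma>" using assms(1) by (simp add: smooth_on_def)
qed

lemma smooth_on_curve_derivative:
  fixes \<gamma> :: "real \<Rightarrow> 'a::euclidean_space"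
  assumes "smooth_on J \<gamma>" "t \<in> J"
  shows "(\<gamma> has_vector_derivative vector_derivative \<gamma> (at t)) (at t)"
  using smooth_on_imp_differentiable[OF assms] by (simp add: vector_derivative_works)

lemma smooth_on_vector_derivative:
  fixes \<gamma> :: "real \<Rightarrow> 'a::euclidean_space"
  assumes "smooth_on J \<gamma>"
  shows "smooth_on J (\<lambda>t. vector_derivative \<gamma> (at t))"
proof -
  have "open J" using assms by (simp add: smooth_on_def)
  from smooth_on_curve_iff[OF this smooth_on_curve_derivative[OF assms]] assms
  show ?thesis by simp
qed

text \<open>A bootstrap by induction on the order of differentiability: the derivative \<open>1 / h' \<circ> h\<^sup>-\<^sup>1\<close> of the inverse is as regular as the
  inverse itself.\<close>

lemma smooth_on_real_inverse:
  fixes h k :: "real \<Rightarrow> real"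
  assumes "smooth_on J h" "\<And>t. t \<in> J \<Longrightarrow> (h has_real_derivative h' t) (at t)"
    and "\<And>t. t \<in> J \<Longrightarrow> h' t \<noteq> 0"
    and "open I" "k ` I \<subseteq> J" "\<And>y. y \<in> I \<Longrightarrow> h (k y) = y" "continuous_on I k"
  shows "smooth_on I k"
proof -
  have J: "open J" using assms(1) by (simp add: smooth_on_def)
  have h': "smooth_on J h'"
    using smooth_on_curve_iff[OF J, of h h'] assms(1,2) by (simp add: has_real_derivative_iff_has_vector_derivative)
  have dk: "(k has_real_derivative inverse (h' (k y))) (at y)" if yI: "y \<in> I" for y
  proof -
    obtain a b where ab: "a < y" "y < b" "{a<..<b} \<subseteq> I"
    proof -
      obtain e where "e > 0" "ball y e \<subseteq> I" using openE[OF assms(4) yI] .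
      then show ?thesis using that[of "y - e" "y + e"] by (simp add: ball_eq_greaterThanLessThan)
    qed
    show ?thesis
      by (rule DERIV_inverse_function[where f=h and a=a and b=b])
        (use ab assms yI in \<open>auto simp: continuous_on_eq_continuous_at subset_iff\<close>)
  qed
  have "Ck_on n I k" for n
  proof (induction n)
    case 0
    then show ?case using assms(7) by simp
  next
    case (Suc n)
    have "Ck_on n I (\<lambda>y. inverse (h' (k y)))"
      by (intro Ck_on_inverse Ck_on_compose[OF assms(4) J assms(5) Suc])
         (use h' assms(3,4,5) in \<open>auto simp: smooth_on_def\<close>)
    then show ?case
      using Ck_on_Suc_vector_derivative[OF assms(4) dk[unfolded has_real_derivative_iff_has_vector_derivative]]
      by simp
  qed
  then show ?thesis using assms(4) by (simp add: smooth_on_def)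
qed

section \<open>Smooth maps between subsets and diffeomorphisms\<close>

lemma smooth_map_iff:
  "smooth_map X f \<longleftrightarrow> (\<forall>x\<in>X. \<exists>U g. x \<in> U \<and> smooth_on U g \<and> (\<forall>y\<in>X \<inter> U. f y = g y))"
proof -
  have "(\<exists>U g. open U \<and> x \<in> U \<and> (\<forall>k. Ck_on k U g) \<and> (\<forall>y\<in>X \<inter> U. f y = g y)) \<longleftrightarrow>
        (\<exists>U g. x \<in> U \<and> smooth_on U g \<and> (\<forall>y\<in>X \<inter> U. f y = g y))" for x
    unfolding smooth_on_def by (intro ex_cong1) auto
  then show ?thesis unfolding smooth_map_def by simp
qed

lemma smooth_on_imp_smooth_map:
  assumes "smooth_on U f" "X \<subseteq> U" shows "smooth_map X f"
proof -
  have "x \<in> U \<and> smooth_on U f \<and> (\<forall>y\<in>X \<inter> U. f y = f y)" if "x \<in> X" for x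
    using assms that by auto
  then show ?thesis unfolding smooth_map_iff by blast
qed

lemma smooth_mapE:
  assumes "smooth_map X f" "x \<in> X"
  obtains U g where "x \<in> U" "smooth_on U g" "\<And>y. y \<in> X \<inter> U \<Longrightarrow> f y = g y"
proof -
  have "\<exists>U g. x \<in> U \<and> smooth_on U g \<and> (\<forall>y\<in>X \<inter> U. f y = g y)"
    using assms by (simp add: smooth_map_iff)
  then show thesis using that by (elim exE conjE) simp
qed

lemma smooth_map_open:
  assumes "open X" "smooth_map X f" shows "smooth_on X f"
proof (rule smooth_on_local[OF _ assms(1)])
  fix x assume "x \<in> X"
  then obtain U g where U: "x \<in> U" "smooth_on U g" "\<And>y. y \<in> X \<inter> U \<Longrightarrow> f y = g y"
    by (rule smooth_mapE[OF assms(2)]) (rule that)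
  have "smooth_on (X \<inter> U) g"
    by (rule smooth_on_subset[OF U(2)]) (use U assms in \<open>auto simp: smooth_on_def\<close>)
  then have "smooth_on (X \<inter> U) f"
    by (rule smooth_on_cong) (simp add: U(3))
  then show "\<exists>V. x \<in> V \<and> smooth_on V f"
    using U(1) \<open>x \<in> X\<close> by blast
qed

lemma smooth_map_subset:
  assumes "smooth_map X f" "Y \<subseteq> X" shows "smooth_map Y f"
  unfolding smooth_map_iff
proof
  fix x assume "x \<in> Y"
  then have "x \<in> X" using assms(2) by auto
  with assms(1) obtain U g where "x \<in> U" "smooth_on U g" "\<And>y. y \<in> X \<inter> U \<Longrightarrow> f y = g y"
    by (rule smooth_mapE) (rule that)
  then have "x \<in> U \<and> smooth_on U g \<and> (\<forall>y\<in>Y \<inter> U. f y = g y)"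
    using assms(2) by auto
  then show "\<exists>U g. x \<in> U \<and> smooth_on U g \<and> (\<forall>y\<in>Y \<inter> U. f y = g y)"
    by (intro exI)
qed

lemma smooth_map_cong:
  assumes "smooth_map X f" "\<And>x. x \<in> X \<Longrightarrow> f x = g x" shows "smooth_map X g"
  using assms(1) unfolding smooth_map_iff by (simp add: assms(2) cong: conj_cong)

lemma smooth_map_continuous_on:
  assumes "smooth_map X f" shows "continuous_on X f"
  unfolding continuous_on_eq_continuous_within
proof
  fix x assume x: "x \<in> X"
  then obtain U g where U: "x \<in> U" "smooth_on U g" "\<And>y. y \<in> X \<inter> U \<Longrightarrow> f y = g y"
    by (rule smooth_mapE[OF assms]) (rule that)
  have "open U" using U(2) by (simp add: smooth_on_def)
  have "continuous (at x) g"
    using smooth_on_imp_continuous_on[OF U(2)] \<open>open U\<close> U(1) continuous_on_eq_continuous_at by blast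
  then have "continuous (at x within X) g" by (rule continuous_at_imp_continuous_within)
  moreover have "eventually (\<lambda>y. f y = g y) (at x within X)"
    unfolding eventually_at_topological using \<open>open U\<close> U by blast
  moreover have "f x = g x" using U x by blast
  ultimately show "continuous (at x within X) f"
    by (simp add: continuous_within tendsto_cong)
qed

lemma smooth_map_compose:
  assumes f: "smooth_map X f" and g: "smooth_map Y g" and fXY: "f ` X \<subseteq> Y"
  shows "smooth_map X (\<lambda>x. g (f x))"
  unfolding smooth_map_iff
proof
  fix x assume x: "x \<in> X"
  obtain U F where U: "x \<in> U" "smooth_on U F" "\<And>y. y \<in> X \<inter> U \<Longrightarrow> f y = F y"
    by (rule smooth_mapE[OF f x]) (rule that)
  have "f x \<in> Y" using x fXY by auto
  then obtain V G where V: "f x \<in> V" "smooth_on V G" "\<And>y. y \<in> Y \<inter> V \<Longrightarrow> g y = G y"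
    by (rule smooth_mapE[OF g]) (rule that)
  have o: "open U" "open V" using U(2) V(2) by (auto simp: smooth_on_def)
  let ?W = "U \<inter> F -` V"
  have "open ?W"
    using continuous_open_preimage[OF smooth_on_imp_continuous_on[OF U(2)] o] .
  then have "smooth_on ?W (\<lambda>x. G (F x))"
    by (intro smooth_on_compose[OF smooth_on_subset[OF U(2)] V(2)]) auto
  moreover have "x \<in> ?W" using x U V by auto
  moreover have "\<forall>y\<in>X \<inter> ?W. g (f y) = G (F y)" using U(3) V(3) fXY by auto
  ultimately show "\<exists>W h. x \<in> W \<and> smooth_on W h \<and> (\<forall>y\<in>X \<inter> W. g (f y) = h y)"
    by (intro exI conjI)
qed

lemma diffeoI:
  assumes "smooth_map X f" "smooth_map Y g" "f ` X \<subseteq> Y" "g ` Y \<subseteq> X"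
    "\<And>x. x \<in> X \<Longrightarrow> g (f x) = x" "\<And>y. y \<in> Y \<Longrightarrow> f (g y) = y"
  shows "diffeo X Y f"
proof -
  have b: "bij_betw f X Y"
    by (rule bij_betw_byWitness[where f'=g]) (use assms in auto)
  have "inv_into X f y = g y" if "y \<in> Y" for y
    by (rule inv_into_f_eq) (use b assms that in \<open>auto simp: bij_betw_def\<close>)
  then show ?thesis
    unfolding diffeo_def using b assms(1) smooth_map_cong[OF assms(2), of "inv_into X f"] by auto
qed

lemma diffeoE:
  assumes "diffeo X Y f"
  obtains g where "smooth_map X f" "smooth_map Y g" "f ` X = Y" "g ` Y = X"
    "\<And>x. x \<in> X \<Longrightarrow> g (f x) = x" "\<And>y. y \<in> Y \<Longrightarrow> f (g y) = y"
proof
  let ?g = "inv_into X f"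
  have b: "bij_betw f X Y" using assms by (simp add: diffeo_def)
  show "smooth_map X f" "smooth_map Y ?g" using assms by (auto simp: diffeo_def)
  show "f ` X = Y" using b by (auto simp: bij_betw_def)
  show "?g ` Y = X" using bij_betw_inv_into[OF b] by (simp add: bij_betw_def)
  show "\<And>x. x \<in> X \<Longrightarrow> ?g (f x) = x" using b by (simp add: bij_betw_def)
  show "\<And>y. y \<in> Y \<Longrightarrow> f (?g y) = y" using b by (simp add: bij_betw_inv_into_right)
qed

lemma diffeo_compose:
  assumes "diffeo X Y f" "diffeo Y Z g" shows "diffeo X Z (\<lambda>x. g (f x))"
proof -
  obtain f' where f: "smooth_map X f" "smooth_map Y f'" "f ` X = Y" "f' ` Y = X"
    "\<And>x. x \<in> X \<Longrightarrow> f' (f x) = x" "\<And>y. y \<in> Y \<Longrightarrow> f (f' y) = y" by (rule diffeoE[OF assms(1)]) (rule that)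
  obtain g' where g: "smooth_map Y g" "smooth_map Z g'" "g ` Y = Z" "g' ` Z = Y"
    "\<And>x. x \<in> Y \<Longrightarrow> g' (g x) = x" "\<And>y. y \<in> Z \<Longrightarrow> g (g' y) = y" by (rule diffeoE[OF assms(2)]) (rule that)
  show ?thesis
  proof (rule diffeoI[where g="\<lambda>z. f' (g' z)"])
    show "smooth_map X (\<lambda>x. g (f x))" by (rule smooth_map_compose[OF f(1) g(1)]) (simp add: f)
    show "smooth_map Z (\<lambda>z. f' (g' z))" by (rule smooth_map_compose[OF g(2) f(2)]) (simp add: g)
  qed (use f g in auto)
qed

lemma diffeo_restrict:
  assumes "diffeo X Y f" "X' \<subseteq> X" shows "diffeo X' (f ` X') f"
proof -
  obtain f' where f: "smooth_map X f" "smooth_map Y f'" "f ` X = Y" "f' ` Y = X"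
    "\<And>x. x \<in> X \<Longrightarrow> f' (f x) = x" "\<And>y. y \<in> Y \<Longrightarrow> f (f' y) = y" by (rule diffeoE[OF assms(1)]) (rule that)
  have XY: "f ` X' \<subseteq> Y" using f(3) assms(2) by blast
  show ?thesis
  proof (rule diffeoI[where g="f'"])
    show "smooth_map X' f" by (rule smooth_map_subset[OF f(1) assms(2)])
    show "smooth_map (f ` X') f'" by (rule smooth_map_subset[OF f(2) XY])
    show "f' (f x) = x" if "x \<in> X'" for x
      using f(5) assms(2) that by blast
    then show "f' ` f ` X' \<subseteq> X'" by auto
    show "f (f' y) = y" if "y \<in> f ` X'" for y
      using f(6) XY that by blast
  qed simp
qed

lemma smooth_map_ident: "smooth_map X (\<lambda>x. x)"
  by (rule smooth_on_imp_smooth_map[where U=UNIV, OF smooth_on_ident]) auto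

lemma diffeo_id: "diffeo X X (\<lambda>x. x)"
  by (rule diffeoI[where g="\<lambda>x. x"]) (simp_all add: smooth_map_ident)

section \<open>Smooth inverses of curves and closed curves\<close>

lemma local_inverse_real:
  fixes h :: "real \<Rightarrow> real"
  assumes h: "smooth_on J h" and t0: "t0 \<in> J" and pos: "vector_derivative h (at t0) > 0"
  obtains d e k where "0 < d" "0 < e" "{t0-d..t0+d} \<subseteq> J"
    "smooth_on {h t0 - e<..<h t0 + e} k" "k ` {h t0 - e<..<h t0 + e} \<subseteq> {t0-d<..<t0+d}"
    "\<And>y. \<bar>y - h t0\<bar> < e \<Longrightarrow> h (k y) = y" "\<And>t. t \<in> {t0-d..t0+d} \<Longrightarrow> k (h t) = t"
    "\<And>t. t \<in> {t0-d..t0+d} \<Longrightarrow> vector_derivative h (at t) > 0"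
proof -
  let ?h' = "\<lambda>t. vector_derivative h (at t)"
  have J: "open J" using h by (simp add: smooth_on_def)
  have dh: "(h has_real_derivative ?h' t) (at t)" if "t \<in> J" for t
    using smooth_on_curve_derivative[OF h that] by (simp add: has_real_derivative_iff_has_vector_derivative)
  have "continuous_on J ?h'"
    by (rule smooth_on_imp_continuous_on[OF smooth_on_vector_derivative[OF h]])
  then have "open (J \<inter> ?h' -` {0<..})"
    by (rule continuous_open_preimage[OF _ J]) simp
  moreover have "t0 \<in> J \<inter> ?h' -` {0<..}" using t0 pos by simp
  ultimately obtain d0 where d0: "0 < d0" "cball t0 d0 \<subseteq> J \<inter> ?h' -` {0<..}"
    using open_contains_cball[of "J \<inter> ?h' -` {0<..}"] by blast
  define d where "d = d0"
  let ?S = "{t0-d..t0+d}"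
  have d: "0 < d" using d0 d_def by simp
  have SJ: "t \<in> J" "?h' t > 0" if "t \<in> ?S" for t
    using d0(2) that unfolding d_def cball_eq_atLeastAtMost by auto
  have mono: "h s < h t" if "s < t" "s \<in> ?S" "t \<in> ?S" for s t
  proof (rule DERIV_pos_imp_increasing[OF that(1)])
    fix x assume "s \<le> x" "x \<le> t"
    then have "x \<in> ?S" using that by auto
    then show "\<exists>y. DERIV h x :> y \<and> y > 0" using dh[OF SJ(1)] SJ(2) by blast
  qed
  have inj: "inj_on h ?S"
    by (rule linorder_inj_onI) (use mono in force)+
  have hc: "continuous_on ?S h"
    using smooth_on_imp_continuous_on[OF h] by (rule continuous_on_subset) (use SJ in auto)
  define e where "e = min (h t0 - h (t0-d)) (h (t0+d) - h t0)"
  have e: "0 < e" using mono[of "t0-d" t0] mono[of t0 "t0+d"] d by (simp add: e_def)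
  let ?I = "{h t0 - e<..<h t0 + e}"
  define k where "k = the_inv_into ?S h"
  have kh: "k (h t) = t" if "t \<in> ?S" for t
    unfolding k_def by (rule the_inv_into_f_f[OF inj that])
  have surj: "\<exists>t\<in>{t0-d<..<t0+d}. h t = y" if "y \<in> ?I" for y
  proof -
    have y: "h (t0-d) < y" "y < h (t0+d)" using that by (auto simp: e_def)
    obtain t where t: "t0-d \<le> t" "t \<le> t0+d" "h t = y"
      using IVT'[of h "t0-d" y "t0+d"] y hc d by auto
    then have "t \<noteq> t0-d" "t \<noteq> t0+d" using y by auto
    then show ?thesis using t by (intro bexI[of _ t]) auto
  qed
  have kI: "k y \<in> {t0-d<..<t0+d}" "h (k y) = y" if yI: "y \<in> ?I" for y
  proof -
    obtain t where t: "t \<in> {t0-d<..<t0+d}" "h t = y" using surj[OF yI] by auto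
    have "k y = t" using kh[of t] t by auto
    then show "k y \<in> {t0-d<..<t0+d}" "h (k y) = y" using t by auto
  qed
  have "?I \<subseteq> h ` ?S"
  proof
    fix y assume "y \<in> ?I"
    then obtain t where "t \<in> {t0-d<..<t0+d}" "h t = y" using surj by blast
    then show "y \<in> h ` ?S" by force
  qed
  then have kc: "continuous_on ?I k"
    using continuous_on_inv_into[OF hc compact_Icc inj] continuous_on_subset unfolding k_def by blast
  have ks: "smooth_on ?I k"
  proof (rule smooth_on_real_inverse[where h=h and J="{t0-d<..<t0+d}" and h'="?h'"])
    show "smooth_on {t0-d<..<t0+d} h"
      by (rule smooth_on_subset[OF h]) (use SJ in auto)
    show "(h has_real_derivative ?h' t) (at t)" if "t \<in> {t0-d<..<t0+d}" for t
      by (rule dh) (use that SJ in auto)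
    show "?h' t \<noteq> 0" if "t \<in> {t0-d<..<t0+d}" for t
      using SJ(2)[of t] that by auto
    show "k ` ?I \<subseteq> {t0-d<..<t0+d}" using kI by blast
  qed (use kI kc in auto)
  show thesis
  proof (rule that[OF d e _ ks])
    show "?S \<subseteq> J" using SJ by blast
    show "k ` ?I \<subseteq> {t0-d<..<t0+d}" using kI by blast
    show "h (k y) = y" if "\<bar>y - h t0\<bar> < e" for y
      by (rule kI(2)) (use that in auto)
    show "k (h t) = t" if "t \<in> ?S" for t by (rule kh[OF that])
    show "?h' t > 0" if "t \<in> ?S" for t by (rule SJ(2)[OF that])
  qed
qed

text \<open>Project onto the velocity at the chosen parameter: the projected curve is a real function with
  positive derivative, so it has a smooth inverse, and projection followed by that inverse is
  defined and smooth on an open set of the ambient space.\<close>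

lemma curve_local_left_inverse:
  fixes \<alpha> :: "real \<Rightarrow> 'a::euclidean_space"
  assumes \<alpha>: "smooth_on J \<alpha>" and t0: "t0 \<in> J" and nz: "vector_derivative \<alpha> (at t0) \<noteq> 0"
  obtains d W G where "0 < d" "\<alpha> t0 \<in> W" "smooth_on W G" "{t0-d..t0+d} \<subseteq> J"
    "\<And>t. t \<in> {t0-d..t0+d} \<Longrightarrow> G (\<alpha> t) = t"
proof -
  define v where "v = vector_derivative \<alpha> (at t0)"
  define h where "h t = \<alpha> t \<bullet> v" for t
  have J: "open J" using \<alpha> by (simp add: smooth_on_def)
  have h: "smooth_on J h"
    unfolding h_def by (rule smooth_on_inner[OF \<alpha> smooth_on_const[OF J]])
  have "(h has_vector_derivative v \<bullet> v) (at t0)"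
    unfolding h_def v_def
    by (rule bounded_linear.has_vector_derivative[OF bounded_linear_inner_left smooth_on_curve_derivative[OF \<alpha> t0]])
  then have "vector_derivative h (at t0) = v \<bullet> v" by (rule vector_derivative_at)
  then have pos: "vector_derivative h (at t0) > 0" using nz by (simp add: v_def)
  obtain d e k where k: "0 < d" "0 < e" "{t0-d..t0+d} \<subseteq> J"
    "smooth_on {h t0 - e<..<h t0 + e} k"
    "\<And>t. t \<in> {t0-d..t0+d} \<Longrightarrow> k (h t) = t"
    by (rule local_inverse_real[OF h t0 pos]) (rule that)
  let ?W = "(\<lambda>x. x \<bullet> v) -` {h t0 - e<..<h t0 + e}"
  have lin: "bounded_linear (\<lambda>x. x \<bullet> v)" by (rule bounded_linear_inner_left)
  have "open ?W"
    by (rule open_vimage) (auto intro!: continuous_intros)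
  then have "smooth_on ?W (\<lambda>x. x \<bullet> v)" by (rule smooth_on_bounded_linear[OF _ lin])
  then have W: "smooth_on ?W (\<lambda>x. k (x \<bullet> v))"
    by (rule smooth_on_compose[OF _ k(4)]) auto
  show thesis
  proof (rule that[OF k(1) _ W k(3)])
    show "\<alpha> t0 \<in> ?W" using k(2) by (simp add: h_def)
    show "k (\<alpha> t \<bullet> v) = t" if "t \<in> {t0-d..t0+d}" for t
      using k(5)[OF that] by (simp add: h_def)
  qed
qed

lemma int_shift_into_period:
  fixes t a \<tau> :: real assumes "0 < \<tau>"
  obtains n :: int where "a \<le> t + of_int n * \<tau>" "t + of_int n * \<tau> < a + \<tau>"
proof (rule that[of "\<lceil>(a - t) / \<tau>\<rceil>"])
  let ?n = "of_int \<lceil>(a - t) / \<tau>\<rceil> :: real"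
  have n: "(a - t) / \<tau> \<le> ?n" "?n < (a - t) / \<tau> + 1" by linarith+
  have eq: "(a - t) / \<tau> * \<tau> = a - t" using assms by simp
  show "a \<le> t + ?n * \<tau>"
    using mult_right_mono[OF n(1), of \<tau>] assms eq by linarith
  show "t + ?n * \<tau> < a + \<tau>"
    using mult_strict_right_mono[OF n(2) assms] eq by (simp add: distrib_right)
qed

text \<open>A map out of a closed curve is smooth as soon as it is smooth in the parameter. Near a point
  \<open>\<alpha> t0\<close> the rest of one period is a compact set that misses the point, so only parameters close to
  \<open>t0\<close> matter, and there the curve has a smooth left inverse.\<close>

lemma periodic_reparametrisation_smooth:
  fixes \<alpha> :: "real \<Rightarrow> 'a::euclidean_space" and \<beta> :: "real \<Rightarrow> 'b::euclidean_space"
  assumes \<alpha>: "smooth_on UNIV \<alpha>" and nz: "\<And>t. vector_derivative \<alpha> (at t) \<noteq> 0" and \<tau>: "0 < \<tau>"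
    and per: "\<And>s t. \<alpha> s = \<alpha> t \<longleftrightarrow> (\<exists>n::int. s = t + of_int n * \<tau>)"
    and \<beta>: "smooth_on UNIV \<beta>" and f: "\<And>t. f (\<alpha> t) = \<beta> t"
  shows "smooth_map (range \<alpha>) f"
  unfolding smooth_map_iff
proof
  fix x assume "x \<in> range \<alpha>"
  then obtain t0 where t0: "x = \<alpha> t0" by auto
  obtain d W G where G: "0 < d" "\<alpha> t0 \<in> W" "smooth_on W G"
    "\<And>t. t \<in> {t0-d..t0+d} \<Longrightarrow> G (\<alpha> t) = t"
    by (rule curve_local_left_inverse[OF \<alpha> UNIV_I nz]) (rule that)
  \<comment> \<open>the part of one period that stays away from \<open>t0\<close>\<close>
  let ?C = "\<alpha> ` {t0+d..t0+\<tau>-d}"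
  have ac: "continuous_on A \<alpha>" for A
    by (rule continuous_on_subset[OF smooth_on_imp_continuous_on[OF \<alpha>]]) simp
  have "compact ?C" by (rule compact_continuous_image[OF ac compact_Icc])
  then have oC: "open (- ?C)" using compact_imp_closed by blast
  have xC: "x \<notin> ?C"
  proof
    assume "x \<in> ?C"
    then obtain t where t: "t \<in> {t0+d..t0+\<tau>-d}" "\<alpha> t = \<alpha> t0" using t0 by auto
    then obtain n :: int where n: "t = t0 + of_int n * \<tau>" using per by blast
    have tt: "t0 + d \<le> t" "t \<le> t0 + \<tau> - d" using t(1) by auto
    have "0 < real_of_int n * \<tau>" "real_of_int n * \<tau> < 1 * \<tau>"
      unfolding mult_1_left using tt n G(1) by linarith+
    then have "0 < real_of_int n" "real_of_int n < 1"
      using \<tau> zero_less_mult_pos2[of "real_of_int n" \<tau>] mult_less_cancel_right_pos[OF \<tau>, of "real_of_int n" 1]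
      by blast+
    then show False by simp
  qed
  let ?V = "W \<inter> - ?C"
  have sm: "smooth_on ?V (\<lambda>y. \<beta> (G y))"
  proof (rule smooth_on_compose[OF _ \<beta>])
    show "smooth_on ?V G" by (rule smooth_on_subset[OF G(3)]) (use G(3) oC in \<open>auto simp: smooth_on_def\<close>)
  qed simp
  have eq: "f y = \<beta> (G y)" if y: "y \<in> range \<alpha> \<inter> ?V" for y
  proof -
    obtain s where s: "y = \<alpha> s" using y by auto
    obtain n :: int where n: "t0 - d \<le> s + of_int n * \<tau>" "s + of_int n * \<tau> < t0 - d + \<tau>"
      by (rule int_shift_into_period[OF \<tau>]) (rule that)
    define t where "t = s + of_int n * \<tau>"
    have yt: "y = \<alpha> t" using s per[of t s] t_def by auto
    have "t < t0 + d" using y n unfolding yt t_def by auto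
    then have "G y = t" using G(4)[of t] n unfolding yt t_def by auto
    then show ?thesis using yt f by simp
  qed
  have "x \<in> ?V \<and> smooth_on ?V (\<lambda>y. \<beta> (G y)) \<and> (\<forall>y\<in>range \<alpha> \<inter> ?V. f y = \<beta> (G y))"
    using xC G(2) t0 sm eq by simp
  then show "\<exists>U g. x \<in> U \<and> smooth_on U g \<and> (\<forall>y\<in>range \<alpha> \<inter> U. f y = g y)"
    by (intro exI)
qed

lemma periodic_reparametrisation_diffeo:
  fixes \<alpha> :: "real \<Rightarrow> 'a::euclidean_space" and \<beta> :: "real \<Rightarrow> 'b::euclidean_space"
  assumes \<alpha>: "smooth_on UNIV \<alpha>" "\<And>t. vector_derivative \<alpha> (at t) \<noteq> 0" 
    and \<alpha>p: "\<And>s t. \<alpha> s = \<alpha> t \<longleftrightarrow> (\<exists>n::int. s = t + of_int n * \<tau>)" and \<tau>: "0 < \<tau>"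
    and \<beta>: "smooth_on UNIV \<beta>" "\<And>t. vector_derivative \<beta> (at t) \<noteq> 0" 
    and \<beta>p: "\<And>s t. \<beta> s = \<beta> t \<longleftrightarrow> (\<exists>n::int. s = t + of_int n * \<tau>)"
  shows "\<exists>f. diffeo (range \<alpha>) (range \<beta>) f"
proof -
  define f where "f x = \<beta> (inv \<alpha> x)" for x
  define g where "g y = \<alpha> (inv \<beta> y)" for y
  have "\<alpha> (inv \<alpha> (\<alpha> t)) = \<alpha> t" for t by (simp add: f_inv_into_f)
  then have f: "f (\<alpha> t) = \<beta> t" for t unfolding f_def \<alpha>p \<beta>p .
  have "\<beta> (inv \<beta> (\<beta> t)) = \<beta> t" for t by (simp add: f_inv_into_f)
  then have g: "g (\<beta> t) = \<alpha> t" for t unfolding g_def \<alpha>p \<beta>p .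
  have "diffeo (range \<alpha>) (range \<beta>) f"
  proof (rule diffeoI[where g=g])
    show "smooth_map (range \<alpha>) f"
      by (rule periodic_reparametrisation_smooth[OF \<alpha> \<tau> \<alpha>p \<beta>(1) f])
    show "smooth_map (range \<beta>) g"
      by (rule periodic_reparametrisation_smooth[OF \<beta> \<tau> \<beta>p \<alpha>(1) g])
  qed (auto simp: f g)
  then show ?thesis by blast
qed

lemma cis_vector_derivative: "(cis has_vector_derivative \<i> * cis t) (at t)"
proof -
  have "((\<lambda>t. exp (\<i> * complex_of_real t)) has_vector_derivative \<i> * exp (\<i> * complex_of_real t)) (at t)"
    by (rule has_vector_derivative_real_field) (auto intro!: derivative_eq_intros)
  then show ?thesis by (simp add: cis_conv_exp[abs_def])
qed

lemma smooth_on_cis: "smooth_on UNIV cis"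
proof -
  have "Ck_on k UNIV cis" for k
  proof (induction k)
    case 0
    then show ?case by (simp add: continuous_on_cis)
  next
    case (Suc k)
    have "Ck_on k UNIV (\<lambda>t. \<i> * cis t)"
      by (rule Ck_on_bilinear[OF open_UNIV bounded_bilinear_mult Ck_on_const[OF open_UNIV] Suc])
    then show ?case
      using Ck_on_Suc_vector_derivative[OF open_UNIV cis_vector_derivative] by blast
  qed
  then show ?thesis by (simp add: smooth_on_def)
qed

lemma range_cis: "range cis = sphere (0::complex) 1"
proof
  show "range cis \<subseteq> sphere 0 1" by auto
  show "sphere 0 1 \<subseteq> range cis"
  proof
    fix z :: complex assume "z \<in> sphere 0 1"
    then have "z \<noteq> 0" "sgn z = z" by (auto simp: sgn_div_norm)
    then have "cis (Arg z) = z" using cis_Arg[of z] by simp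
    then show "z \<in> range cis" by (metis rangeI)
  qed
qed

text \<open>After rescaling the period to \<open>2\<pi>\<close>, the curve and \<open>cis\<close> are two regular closed curves with the
  same period, so the two parametrisations induce inverse smooth maps between their images.\<close>

lemma embedded_circle_range_periodic:
  fixes \<gamma> :: "real \<Rightarrow> 'a::euclidean_space"
  assumes \<gamma>: "smooth_on UNIV \<gamma>" "\<And>t. vector_derivative \<gamma> (at t) \<noteq> 0" and \<tau>: "0 < \<tau>"
    and per: "\<And>s t. \<gamma> s = \<gamma> t \<longleftrightarrow> (\<exists>n::int. s = t + of_int n * \<tau>)"
  shows "embedded_circle (range \<gamma>)"
proof -
  define c where "c = \<tau> / (2*pi)"
  have c: "0 < c" using \<tau> by (simp add: c_def)
  define \<beta> where "\<beta> t = \<gamma> (c * t)" for t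
  have "smooth_on UNIV (\<lambda>t. c * t)"
    by (rule smooth_on_bounded_linear[OF open_UNIV bounded_linear_mult_right])
  then have \<beta>: "smooth_on UNIV \<beta>"
    unfolding \<beta>_def by (rule smooth_on_compose[OF _ \<gamma>(1)]) simp
  have "(\<beta> has_vector_derivative c *\<^sub>R vector_derivative \<gamma> (at (c*t))) (at t)" for t
  proof -
    have "((\<lambda>t. c * t) has_vector_derivative c) (at t)"
      by (auto intro!: derivative_eq_intros simp flip: has_real_derivative_iff_has_vector_derivative)
    from vector_diff_chain_at[OF this smooth_on_curve_derivative[OF \<gamma>(1) UNIV_I]]
    show ?thesis unfolding \<beta>_def o_def .
  qed
  then have "vector_derivative \<beta> (at t) = c *\<^sub>R vector_derivative \<gamma> (at (c*t))" for t
    by (rule vector_derivative_at)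
  then have nz: "vector_derivative \<beta> (at t) \<noteq> 0" for t
    using \<gamma>(2)[of "c*t"] c by simp
  have \<beta>p: "\<beta> s = \<beta> t \<longleftrightarrow> (\<exists>n::int. s = t + of_int n * (2*pi))" for s t
  proof -
    have "c * s = c * t + of_int n * \<tau> \<longleftrightarrow> s = t + of_int n * (2*pi)" for n :: int
    proof -
      have "c * t + of_int n * \<tau> = c * (t + of_int n * (2*pi))"
        by (simp add: c_def field_simps)
      then show ?thesis using c by simp
    qed
    then show ?thesis by (simp add: \<beta>_def per)
  qed
  have cp: "cis s = cis t \<longleftrightarrow> (\<exists>n::int. s = t + of_int n * (2*pi))" for s t
  proof -
    have "cis s = cis t \<longleftrightarrow> exp (\<i> * of_real s) = exp (\<i> * of_real t)" by (simp add: cis_conv_exp)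
    also have "\<dots> \<longleftrightarrow> (\<exists>n::int. \<i> * of_real s = \<i> * of_real t + (of_int (2 * n) * pi) * \<i>)"
      by (rule exp_eq)
    also have "\<dots> \<longleftrightarrow> (\<exists>n::int. s = t + of_int n * (2*pi))"
      by (simp add: complex_eq_iff algebra_simps)
    finally show ?thesis .
  qed
  have "vector_derivative cis (at t) \<noteq> 0" for t
    using vector_derivative_at[OF cis_vector_derivative] by simp
  then have "\<exists>f. diffeo (range cis) (range \<beta>) f"
    by (rule periodic_reparametrisation_diffeo[OF smooth_on_cis _ cp _ \<beta> nz \<beta>p]) simp
  moreover have "range \<beta> = range \<gamma>"
  proof -
    have "\<gamma> t = \<beta> (t / c)" for t using c by (simp add: \<beta>_def)
    then have "range \<gamma> \<subseteq> range \<beta>" by blast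
    then show ?thesis unfolding \<beta>_def by blast
  qed
  ultimately show ?thesis by (simp add: embedded_circle_def range_cis)
qed

section \<open>Unit speed curves in a one-dimensional manifold\<close>

text \<open>Fixing the speed removes the freedom of reparametrisation: two unit speed curves in a
  one-dimensional manifold differ locally by \<open>t \<mapsto> \<plusminus>t + c\<close>, so local parametrisations can be
  continued to a curve defined for all times.\<close>

definition unit_speed :: "'a::euclidean_space set \<Rightarrow> real set \<Rightarrow> (real \<Rightarrow> 'a) \<Rightarrow> bool" where
  "unit_speed X J \<alpha> \<longleftrightarrow>
     smooth_on J \<alpha> \<and> (\<forall>t\<in>J. norm (vector_derivative \<alpha> (at t)) = 1) \<and> \<alpha> ` J \<subseteq> X"

text \<open>A unit speed parametrisation \<open>\<gamma>\<close> of a relatively open piece \<open>X \<inter> U\<close>, with smooth inverse \<open>G\<close>.\<close>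

definition unit_chart ::
  "'a::euclidean_space set \<Rightarrow> real set \<Rightarrow> (real \<Rightarrow> 'a) \<Rightarrow> 'a set \<Rightarrow> ('a \<Rightarrow> real) \<Rightarrow> bool" where
  "unit_chart X I \<gamma> U G \<longleftrightarrow>
     unit_speed X I \<gamma> \<and> open U \<and> \<gamma> ` I = X \<inter> U \<and> smooth_map (X \<inter> U) G \<and> (\<forall>s\<in>I. G (\<gamma> s) = s)"

lemma unit_speed_open: "unit_speed X J \<alpha> \<Longrightarrow> open J"
  by (simp add: unit_speed_def smooth_on_def)

lemma unit_speed_in: "unit_speed X J \<alpha> \<Longrightarrow> t \<in> J \<Longrightarrow> \<alpha> t \<in> X"
  by (auto simp: unit_speed_def)

lemma unit_speed_continuous: "unit_speed X J \<alpha> \<Longrightarrow> continuous_on J \<alpha>"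
  by (simp add: unit_speed_def smooth_on_imp_continuous_on)

lemma unit_speed_subset: "unit_speed X J \<alpha> \<Longrightarrow> open J' \<Longrightarrow> J' \<subseteq> J \<Longrightarrow> unit_speed X J' \<alpha>"
  unfolding unit_speed_def using smooth_on_subset[of J \<alpha> J'] by auto

lemma unit_speedI:
  assumes "smooth_on J \<alpha>" "\<And>t. t \<in> J \<Longrightarrow> (\<alpha> has_vector_derivative v t) (at t)"
    "\<And>t. t \<in> J \<Longrightarrow> norm (v t) = 1" "\<And>t. t \<in> J \<Longrightarrow> \<alpha> t \<in> X"
  shows "unit_speed X J \<alpha>"
proof -
  have "norm (vector_derivative \<alpha> (at t)) = 1" if "t \<in> J" for t
    using assms(3)[OF that] vector_derivative_at[OF assms(2)[OF that]] by simp
  then show ?thesis using assms(1,4) unfolding unit_speed_def by blast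
qed

lemma unit_speed_affine:
  assumes \<alpha>: "unit_speed X J \<alpha>" and e: "e \<in> {1, -1::real}"
  shows "unit_speed X {t. e * t + c \<in> J} (\<lambda>t. \<alpha> (e * t + c))"
proof -
  let ?J = "{t. e * t + c \<in> J}"
  have J: "open J" by (rule unit_speed_open[OF \<alpha>])
  have "open ((\<lambda>t. e * t + c) -` J)"
    by (rule open_vimage[OF J]) (auto intro!: continuous_intros)
  then have oJ: "open ?J" by (simp add: vimage_def)
  have s: "smooth_on ?J (\<lambda>t. e * t + c)"
    by (rule smooth_on_add[OF smooth_on_bounded_linear[OF oJ bounded_linear_mult_right] smooth_on_const[OF oJ]])
  have \<alpha>s: "smooth_on J \<alpha>" using \<alpha> by (simp add: unit_speed_def)
  show ?thesis
  proof (rule unit_speedI[where v="\<lambda>t. e *\<^sub>R vector_derivative \<alpha> (at (e * t + c))"])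
    show "smooth_on ?J (\<lambda>t. \<alpha> (e * t + c))"
      by (rule smooth_on_compose[OF s \<alpha>s]) auto
    fix t assume t: "t \<in> ?J"
    have "((\<lambda>t. e * t + c) has_vector_derivative e) (at t)"
      by (auto intro!: derivative_eq_intros simp flip: has_real_derivative_iff_has_vector_derivative)
    from vector_diff_chain_at[OF this smooth_on_curve_derivative[OF \<alpha>s]] t
    show "((\<lambda>t. \<alpha> (e * t + c)) has_vector_derivative e *\<^sub>R vector_derivative \<alpha> (at (e * t + c))) (at t)"
      by (simp add: o_def)
    show "norm (e *\<^sub>R vector_derivative \<alpha> (at (e * t + c))) = 1"
      using \<alpha> t e by (auto simp: unit_speed_def)
    show "\<alpha> (e * t + c) \<in> X" using \<alpha> t by (auto simp: unit_speed_def)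
  qed
qed

lemma unit_speed_local:
  assumes "\<And>t. t \<in> J \<Longrightarrow> \<exists>V \<beta>. t \<in> V \<and> unit_speed X V \<beta> \<and> (\<forall>s\<in>V. \<alpha> s = \<beta> s)" "open J"
  shows "unit_speed X J \<alpha>"
proof -
  have *: "(\<exists>V. t \<in> V \<and> smooth_on V \<alpha>) \<and> norm (vector_derivative \<alpha> (at t)) = 1 \<and> \<alpha> t \<in> X"
    if t: "t \<in> J" for t
  proof -
    obtain V \<beta> where V: "t \<in> V" "unit_speed X V \<beta>" "\<forall>s\<in>V. \<alpha> s = \<beta> s" using assms(1)[OF t] by blast
    have \<beta>: "smooth_on V \<beta>" using V(2) by (simp add: unit_speed_def)
    have "smooth_on V \<alpha>" by (rule smooth_on_cong[OF \<beta>]) (use V(3) in simp)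
    moreover have "(\<alpha> has_vector_derivative vector_derivative \<beta> (at t)) (at t)"
      by (rule has_vector_derivative_transform_within_open[OF smooth_on_curve_derivative[OF \<beta> V(1)]
              unit_speed_open[OF V(2)] V(1)])
         (use V(3) in simp)
    then have "vector_derivative \<alpha> (at t) = vector_derivative \<beta> (at t)" by (rule vector_derivative_at)
    ultimately show ?thesis using V by (auto simp: unit_speed_def)
  qed
  have "smooth_on J \<alpha>" by (rule smooth_on_local[OF _ assms(2)]) (use * in simp)
  then show ?thesis using * by (auto simp: unit_speed_def)
qed

lemma unit_chart_restrict:
  assumes c: "unit_chart X I \<gamma> U G" and s: "{s-r<..<s+r} \<subseteq> I"
  shows "\<exists>V\<subseteq>U. unit_chart X {-r<..<r} (\<lambda>t. \<gamma> (t + s)) V (\<lambda>x. G x - s)"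
proof -
  have G: "smooth_map (X \<inter> U) G" "open U" "\<gamma> ` I = X \<inter> U" "\<And>s. s \<in> I \<Longrightarrow> G (\<gamma> s) = s" "unit_speed X I \<gamma>"
    using c by (auto simp: unit_chart_def)
  have "openin (top_of_set (X \<inter> U)) (X \<inter> U \<inter> G -` {s-r<..<s+r})"
    by (rule continuous_openin_preimage_gen[OF smooth_map_continuous_on[OF G(1)]]) simp
  then obtain T where T: "open T" "X \<inter> U \<inter> G -` {s-r<..<s+r} = X \<inter> U \<inter> T"
    unfolding openin_open by auto
  have img: "(\<lambda>t. \<gamma> (t + s)) ` {-r<..<r} = X \<inter> (U \<inter> T)"
  proof -
    have "(\<lambda>t. \<gamma> (t + s)) ` {-r<..<r} = \<gamma> ` ((\<lambda>t. t + s) ` {-r<..<r})" by (simp add: image_image)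
    also have "(\<lambda>t. t + s) ` {-r<..<r} = {s-r<..<s+r}"
    proof -
      have "t \<in> (\<lambda>t. t + s) ` {-r<..<r}" if "t \<in> {s-r<..<s+r}" for t
        by (rule image_eqI[of _ _ "t - s"]) (use that in auto)
      then show ?thesis by auto
    qed
    also have "\<gamma> ` {s-r<..<s+r} = X \<inter> U \<inter> G -` {s-r<..<s+r}"
    proof
      show "\<gamma> ` {s-r<..<s+r} \<subseteq> X \<inter> U \<inter> G -` {s-r<..<s+r}" 
      proof (rule image_subsetI)
        fix t assume t: "t \<in> {s-r<..<s+r}"
        then have tI: "t \<in> I" using s by auto
        then have "\<gamma> t \<in> X \<inter> U" using G(3) by blast
        then show "\<gamma> t \<in> X \<inter> U \<inter> G -` {s-r<..<s+r}" using t G(4)[OF tI] by simp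
      qed
      show "X \<inter> U \<inter> G -` {s-r<..<s+r} \<subseteq> \<gamma> ` {s-r<..<s+r}"
      proof
        fix x assume x: "x \<in> X \<inter> U \<inter> G -` {s-r<..<s+r}"
        then obtain t where t: "t \<in> I" "x = \<gamma> t" using G(3) by blast
        then show "x \<in> \<gamma> ` {s-r<..<s+r}" using x G(4)[OF t(1)] by auto
      qed
    qed
    finally show ?thesis using T(2) by (simp add: Int_assoc)
  qed
  have "unit_speed X {t. 1 * t + s \<in> I} (\<lambda>t. \<gamma> (1 * t + s))"
    by (rule unit_speed_affine[OF G(5)]) simp
  then have us': "unit_speed X {t. t + s \<in> I} (\<lambda>t. \<gamma> (t + s))" by simp
  have "{-r<..<r} \<subseteq> {t. t + s \<in> I}" using s by auto
  from unit_speed_subset[OF us' _ this]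
  have us: "unit_speed X {-r<..<r} (\<lambda>t. \<gamma> (t + s))" by simp
  have "smooth_map (X \<inter> (U \<inter> T)) G" by (rule smooth_map_subset[OF G(1)]) auto
  moreover have "smooth_map UNIV (\<lambda>y::real. y - s)"
    by (rule smooth_on_imp_smooth_map[OF smooth_on_diff[OF smooth_on_ident[OF open_UNIV] smooth_on_const[OF open_UNIV]] order_refl])
  ultimately have "smooth_map (X \<inter> (U \<inter> T)) (\<lambda>x. G x - s)"
    using smooth_map_compose[of "X \<inter> (U \<inter> T)" G UNIV "\<lambda>y. y - s"] by simp
  moreover have "G (\<gamma> (t + s)) - s = t" if "t \<in> {-r<..<r}" for t
    using G(4)[of "t + s"] s that by (simp add: subset_iff)
  ultimately have "unit_chart X {-r<..<r} (\<lambda>t. \<gamma> (t + s)) (U \<inter> T) (\<lambda>x. G x - s)"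
    unfolding unit_chart_def using us img G(2) T(1) by auto
  then show ?thesis by (intro exI[of _ "U \<inter> T"]) auto
qed

lemma smooth_on_norm:
  assumes f: "smooth_on U f" and nz: "\<And>x. x \<in> U \<Longrightarrow> f x \<noteq> 0"
  shows "smooth_on U (\<lambda>x. norm (f x))"
proof -
  have "smooth_on {0<..} sqrt"
  proof (rule smooth_on_real_inverse[where h="\<lambda>t. t * t" and J="{0<..}" and h'="\<lambda>t. 2 * t"])
    show "smooth_on {0<..} (\<lambda>t::real. t * t)"
      by (rule smooth_on_mult[OF smooth_on_ident smooth_on_ident]) auto
  qed (auto intro!: derivative_eq_intros continuous_on_real_sqrt)
  moreover have "smooth_on U (\<lambda>x. f x \<bullet> f x)" by (rule smooth_on_inner[OF f f])
  ultimately have "smooth_on U (\<lambda>x. sqrt (f x \<bullet> f x))"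
    using smooth_on_compose[of U "\<lambda>x. f x \<bullet> f x" "{0<..}" sqrt] nz by (simp add: image_subset_iff)
  then show ?thesis by (simp add: norm_eq_sqrt_inner)
qed

text \<open>Arc length \<open>\<sigma>\<close> turns a local parametrisation \<open>g\<close> into one of unit speed. Arc length is available
  because \<open>g\<close> is regular: its inverse extends to a smooth ambient function \<open>H\<close>, and \<open>H \<circ> g\<close> is the
  identity, so the velocity of \<open>g\<close> cannot vanish.\<close>

lemma unit_chart_exists:
  assumes "interior_arc_point X p" "p \<in> X"
  shows "\<exists>a>0. \<exists>\<gamma> U G. unit_chart X {-a<..<a} \<gamma> U G \<and> \<gamma> 0 = p"
proof -
  let ?J = "{-1<..<1::real}"
  obtain U g where U: "open U" "p \<in> U" "diffeo ?J (X \<inter> U) g"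
    using assms(1) unfolding interior_arc_point_def by blast
  obtain G where G: "smooth_map ?J g" "smooth_map (X \<inter> U) G" "g ` ?J = X \<inter> U" "G ` (X \<inter> U) = ?J"
    "\<And>t. t \<in> ?J \<Longrightarrow> G (g t) = t" "\<And>y. y \<in> X \<inter> U \<Longrightarrow> g (G y) = y"
    by (rule diffeoE[OF U(3)]) (rule that)
  have g: "smooth_on ?J g" by (rule smooth_map_open[OF _ G(1)]) simp
  let ?v = "\<lambda>t. vector_derivative g (at t)"
  have dg: "(g has_vector_derivative ?v t) (at t)" if "t \<in> ?J" for t
    by (rule smooth_on_curve_derivative[OF g that])
  \<comment> \<open>differentiate \<open>H \<circ> g = id\<close>\<close>
  have nz: "?v t \<noteq> 0" if t: "t \<in> ?J" for t
  proof
    assume z: "?v t = 0"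
    have gt: "g t \<in> X \<inter> U" using G(3) t by blast
    obtain W H where W: "g t \<in> W" "smooth_on W H" "\<And>y. y \<in> X \<inter> U \<inter> W \<Longrightarrow> G y = H y"
      by (rule smooth_mapE[OF G(2) gt]) (rule that)
    have oW: "open W" using W(2) by (simp add: smooth_on_def)
    obtain H' where H': "(H has_derivative H') (at (g t))"
      using smooth_on_imp_differentiable[OF W(2,1)] by (auto simp: differentiable_def)
    have "(g has_derivative (\<lambda>x. x *\<^sub>R ?v t)) (at t)"
      using dg[OF t] by (simp add: has_vector_derivative_def)
    from has_derivative_compose[OF this H']
    have 1: "((\<lambda>s. H (g s)) has_derivative (\<lambda>x. 0)) (at t)"
      using z linear_0[OF has_derivative_linear[OF H']] by simp
    have oV: "open (?J \<inter> g -` W)"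
      by (rule continuous_open_preimage[OF smooth_on_imp_continuous_on[OF g] _ oW]) simp
    have "((\<lambda>s. s) has_derivative (\<lambda>x. 0)) (at t)"
    proof (rule has_derivative_transform_within_open[OF 1 oV])
      show "t \<in> ?J \<inter> g -` W" using t W(1) by simp
      fix s assume s: "s \<in> ?J \<inter> g -` W"
      then have "g s \<in> X \<inter> U \<inter> W" using G(3) by blast
      then show "H (g s) = s" using W(3)[of "g s"] G(5)[of s] s by simp
    qed
    from has_derivative_unique[OF this has_derivative_ident]
    have "(\<lambda>x::real. 0::real) = (\<lambda>x. x)" .
    from fun_cong[OF this, of 1] show False by simp
  qed
  define t0 where "t0 = G p"
  have t0: "t0 \<in> ?J" "g t0 = p" using G(4,6) assms(2) U(2) by (auto simp: t0_def)
  obtain d where d: "0 < d" "{t0-d..t0+d} \<subseteq> ?J"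
  proof (rule that[of "min (t0+1) (1-t0) / 2"])
    show "0 < min (t0+1) (1-t0) / 2" using t0(1) by auto
    have "min (t0+1) (1-t0) / 2 < t0+1" "min (t0+1) (1-t0) / 2 < 1-t0" using t0(1) by (auto simp: min_def)
    then show "{t0 - min (t0+1) (1-t0) / 2..t0 + min (t0+1) (1-t0) / 2} \<subseteq> ?J" by auto
  qed
  let ?J1 = "{t0-d<..<t0+d}"
  have J1: "?J1 \<subseteq> {t0-d..t0+d}" "?J1 \<subseteq> ?J" using d by auto
  have vs: "smooth_on ?J ?v" by (rule smooth_on_vector_derivative[OF g])
  have "continuous_on {t0-d..t0+d} (\<lambda>t. norm (?v t))"
    by (rule continuous_on_subset[OF continuous_on_norm[OF smooth_on_imp_continuous_on[OF vs]] d(2)])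
  then obtain \<sigma> where "\<And>t. t \<in> {t0-d..t0+d} \<Longrightarrow> (\<sigma> has_vector_derivative norm (?v t)) (at t within {t0-d..t0+d})"
    by (rule antiderivative_continuous) (rule that)
  then have d\<sigma>: "(\<sigma> has_vector_derivative norm (?v t)) (at t)" if "t \<in> ?J1" for t
    using that J1(1) at_within_Icc_at[of "t0-d" t "t0+d"] by (metis greaterThanLessThan_iff subsetD)
  have "smooth_on ?J1 (\<lambda>t. norm (?v t))"
    by (rule smooth_on_subset[OF smooth_on_norm[OF vs nz]]) (use J1 in auto)
  then have \<sigma>: "smooth_on ?J1 \<sigma>"
    using smooth_on_curve_iff[where J="?J1" and \<gamma>=\<sigma> and \<gamma>'="\<lambda>t. norm (?v t)"] d\<sigma> open_greaterThanLessThan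
    by blast
  have t01: "t0 \<in> ?J1" using d(1) by simp
  have "vector_derivative \<sigma> (at t0) = norm (?v t0)" by (rule vector_derivative_at[OF d\<sigma>[OF t01]])
  then have pos: "0 < vector_derivative \<sigma> (at t0)" using nz[OF t0(1)] by simp
  obtain d' e k where k: "0 < d'" "0 < e" "{t0-d'..t0+d'} \<subseteq> ?J1"
    "smooth_on {\<sigma> t0 - e<..<\<sigma> t0 + e} k" "k ` {\<sigma> t0 - e<..<\<sigma> t0 + e} \<subseteq> {t0-d'<..<t0+d'}"
    "\<And>y. \<bar>y - \<sigma> t0\<bar> < e \<Longrightarrow> \<sigma> (k y) = y" "\<And>t. t \<in> {t0-d'..t0+d'} \<Longrightarrow> k (\<sigma> t) = t"
    by (rule local_inverse_real[OF \<sigma> t01 pos]) (rule that)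
  let ?I = "{\<sigma> t0 - e<..<\<sigma> t0 + e}"
  define A where "A = {t0-d'<..<t0+d'} \<inter> \<sigma> -` ?I"
  have AJ: "A \<subseteq> ?J1" "?J1 \<subseteq> ?J" using k(3) J1 unfolding A_def by auto
  have oA: "open A"
    unfolding A_def
    by (rule continuous_open_preimage[OF continuous_on_subset[OF smooth_on_imp_continuous_on[OF \<sigma>]]])
       (use k(3) in auto)
  have \<sigma>k: "\<sigma> (k y) = y" if "y \<in> ?I" for y using k(6)[of y] that by auto
  have kJ: "k y \<in> ?J1" if "y \<in> ?I" for y using k(5,3) that by fastforce
  have kI: "k ` ?I = A"
  proof
    show "k ` ?I \<subseteq> A" unfolding A_def using k(5) \<sigma>k by auto
    show "A \<subseteq> k ` ?I"
    proof
      fix t assume t: "t \<in> A"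
      then have "t = k (\<sigma> t)" "\<sigma> t \<in> ?I" using k(7)[of t] unfolding A_def by auto
      then show "t \<in> k ` ?I" by (rule image_eqI)
    qed
  qed
  have us: "unit_speed X ?I (\<lambda>y. g (k y))"
  proof (rule unit_speedI[where v="\<lambda>y. vector_derivative k (at y) *\<^sub>R ?v (k y)"])
    show "smooth_on ?I (\<lambda>y. g (k y))"
      by (rule smooth_on_compose[OF k(4) g]) (use kI AJ in blast)
    fix y assume y: "y \<in> ?I"
    have kJ': "k y \<in> ?J" using kJ[OF y] J1(2) by blast
    have dk: "(k has_vector_derivative vector_derivative k (at y)) (at y)"
      by (rule smooth_on_curve_derivative[OF k(4) y])
    show "((\<lambda>y. g (k y)) has_vector_derivative vector_derivative k (at y) *\<^sub>R ?v (k y)) (at y)"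
      using vector_diff_chain_at[OF dk dg[OF kJ']] by (simp add: o_def)
    have "((\<sigma> \<circ> k) has_vector_derivative vector_derivative k (at y) *\<^sub>R norm (?v (k y))) (at y)"
      by (rule vector_diff_chain_at[OF dk d\<sigma>[OF kJ[OF y]]])
    then have "((\<lambda>y. y) has_vector_derivative vector_derivative k (at y) *\<^sub>R norm (?v (k y))) (at y)"
      by (rule has_vector_derivative_transform_within_open[OF _ _ y]) (use \<sigma>k in auto)
    then have "vector_derivative k (at y) * norm (?v (k y)) = 1"
      using vector_derivative_unique_at[OF _ has_vector_derivative_id] by fastforce
    then show "norm (vector_derivative k (at y) *\<^sub>R ?v (k y)) = 1"
      by (metis abs_mult abs_norm_cancel abs_one norm_scaleR)
    show "g (k y) \<in> X" using kJ' G(3) by blast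
  qed
  have "openin (top_of_set (X \<inter> U)) (X \<inter> U \<inter> G -` A)"
    by (rule continuous_openin_preimage_gen[OF smooth_map_continuous_on[OF G(2)] oA])
  then obtain T where T: "open T" "X \<inter> U \<inter> G -` A = X \<inter> U \<inter> T"
    unfolding openin_open by auto
  have img: "(\<lambda>y. g (k y)) ` ?I = X \<inter> (U \<inter> T)"
  proof -
    have "(\<lambda>y. g (k y)) ` ?I = g ` A" unfolding kI[symmetric] by (simp add: image_image)
    also have "g ` A = X \<inter> U \<inter> G -` A"
    proof
      show "g ` A \<subseteq> X \<inter> U \<inter> G -` A"
      proof (rule image_subsetI)
        fix t assume t: "t \<in> A"
        then have tJ: "t \<in> ?J" using AJ by blast
        then have "g t \<in> X \<inter> U" using G(3) by blast
        then show "g t \<in> X \<inter> U \<inter> G -` A" using G(5)[OF tJ] t by simp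
      qed
      show "X \<inter> U \<inter> G -` A \<subseteq> g ` A"
      proof
        fix x assume x: "x \<in> X \<inter> U \<inter> G -` A"
        then have "x = g (G x)" "G x \<in> A" using G(6)[of x] by auto
        then show "x \<in> g ` A" by (rule image_eqI)
      qed
    qed
    finally show ?thesis using T(2) by (simp add: Int_assoc)
  qed
  have GA: "G ` (X \<inter> (U \<inter> T)) \<subseteq> A" using T(2) by auto
  have "smooth_map (X \<inter> (U \<inter> T)) G" by (rule smooth_map_subset[OF G(2)]) auto
  then have "smooth_map (X \<inter> (U \<inter> T)) (\<lambda>x. \<sigma> (G x))"
    by (rule smooth_map_compose[OF _ smooth_on_imp_smooth_map[OF \<sigma> AJ(1)] GA])
  moreover have "\<sigma> (G (g (k y))) = y" if "y \<in> ?I" for y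
    using G(5)[of "k y"] \<sigma>k[OF that] kJ[OF that] J1(2) by (simp add: subset_iff)
  ultimately have "unit_chart X ?I (\<lambda>y. g (k y)) (U \<inter> T) (\<lambda>x. \<sigma> (G x))"
    unfolding unit_chart_def using us img U(1) T(1) by auto
  from unit_chart_restrict[OF this order_refl]
  obtain V where "unit_chart X {-e<..<e} (\<lambda>t. g (k (t + \<sigma> t0))) V (\<lambda>x. \<sigma> (G x) - \<sigma> t0)" by blast
  moreover have "g (k (0 + \<sigma> t0)) = p" using k(7)[of t0] k(1) t0(2) by simp
  ultimately show ?thesis using k(2) by blast
qed

text \<open>Inside a unit speed chart every unit speed curve is the chart read at an affine
  parameter of slope \<open>\<plusminus>1\<close>: the parameter \<open>u\<close> read off in the chart has \<open>\<bar>u'\<bar> = 1\<close>, and by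
  continuity \<open>u'\<close> does not change sign.\<close>

lemma unit_speed_in_chart:
  assumes c: "unit_chart X I \<gamma> U G" and \<alpha>: "unit_speed X J \<alpha>" and J: "connected J" and U: "\<alpha> ` J \<subseteq> U"
  shows "\<exists>e\<in>{1,-1}. \<exists>c. \<forall>t\<in>J. e * t + c \<in> I \<and> \<alpha> t = \<gamma> (e * t + c)"
proof -
  have G: "smooth_map (X \<inter> U) G" "\<gamma> ` I = X \<inter> U" "\<And>s. s \<in> I \<Longrightarrow> G (\<gamma> s) = s" 
    and \<gamma>: "smooth_on I \<gamma>" "\<And>s. s \<in> I \<Longrightarrow> norm (vector_derivative \<gamma> (at s)) = 1"
    using c by (auto simp: unit_chart_def unit_speed_def)
  have oJ: "open J" by (rule unit_speed_open[OF \<alpha>])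
  have \<alpha>s: "smooth_on J \<alpha>" and \<alpha>n: "\<And>t. t \<in> J \<Longrightarrow> norm (vector_derivative \<alpha> (at t)) = 1"
    using \<alpha> by (auto simp: unit_speed_def)
  have \<alpha>XU: "\<alpha> ` J \<subseteq> X \<inter> U" using \<alpha> U by (auto simp: unit_speed_def)
  define u where "u t = G (\<alpha> t)" for t
  have "smooth_map J u"
    unfolding u_def by (rule smooth_map_compose[OF smooth_on_imp_smooth_map[OF \<alpha>s order_refl] G(1) \<alpha>XU])
  then have u: "smooth_on J u" by (rule smooth_map_open[OF oJ])
  have uI: "u t \<in> I" "\<gamma> (u t) = \<alpha> t" if t: "t \<in> J" for t
  proof -
    have "\<alpha> t \<in> \<gamma> ` I" using \<alpha>XU G(2) t by auto
    then obtain s where "s \<in> I" "\<alpha> t = \<gamma> s" by auto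
    then show "u t \<in> I" "\<gamma> (u t) = \<alpha> t" using G(3) by (auto simp: u_def)
  qed
  let ?u' = "\<lambda>t. vector_derivative u (at t)"
  have du: "(u has_vector_derivative ?u' t) (at t)" if "t \<in> J" for t
    by (rule smooth_on_curve_derivative[OF u that])
  have abs1: "?u' t = 1 \<or> ?u' t = -1" if t: "t \<in> J" for t
  proof -
    have "((\<gamma> \<circ> u) has_vector_derivative ?u' t *\<^sub>R vector_derivative \<gamma> (at (u t))) (at t)"
      by (rule vector_diff_chain_at[OF du[OF t] smooth_on_curve_derivative[OF \<gamma>(1) uI(1)[OF t]]])
    then have "(\<alpha> has_vector_derivative ?u' t *\<^sub>R vector_derivative \<gamma> (at (u t))) (at t)"
      by (rule has_vector_derivative_transform_within_open[OF _ oJ t]) (simp add: uI)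
    then have "vector_derivative \<alpha> (at t) = ?u' t *\<^sub>R vector_derivative \<gamma> (at (u t))"
      by (rule vector_derivative_at)
    then have "1 = \<bar>?u' t\<bar>" using \<alpha>n[OF t] \<gamma>(2)[OF uI(1)[OF t]] by simp
    then show ?thesis by linarith
  qed
  have "?u' ` J \<subseteq> {1,-1}" using abs1 by auto
  then have "finite (?u' ` J)" by (rule finite_subset) simp
  then have "?u' constant_on J"
    by (rule continuous_finite_range_constant[OF J smooth_on_imp_continuous_on[OF smooth_on_vector_derivative[OF u]]])
  then obtain e0 where e0: "\<And>t. t \<in> J \<Longrightarrow> ?u' t = e0" unfolding constant_on_def by auto
  show ?thesis
  proof (cases "J = {}")
    case False
    then obtain t1 where t1: "t1 \<in> J" by auto
    have e: "e0 \<in> {1,-1}" using abs1[OF t1] e0[OF t1] by auto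
    have "((\<lambda>t. u t - e0 * t) has_derivative (\<lambda>x. 0)) (at t)" if t: "t \<in> J" for t
    proof -
      have "(u has_real_derivative e0) (at t)"
        using du[OF t] e0[OF t] by (simp add: has_real_derivative_iff_has_vector_derivative)
      then have "((\<lambda>t. u t - e0 * t) has_real_derivative 0) (at t)"
        by (auto intro!: derivative_eq_intros)
      then show ?thesis by (simp add: has_field_derivative_def lambda_zero)
    qed
    then have const: "u t - e0 * t = u t1 - e0 * t1" if "t \<in> J" for t
      by (rule has_derivative_zero_unique_connected[OF oJ J _ that t1])
    have "e0 * t + (u t1 - e0 * t1) \<in> I \<and> \<alpha> t = \<gamma> (e0 * t + (u t1 - e0 * t1))" if t: "t \<in> J" for t
    proof -
      have "e0 * t + (u t1 - e0 * t1) = u t" using const[OF t] by simp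
      then show ?thesis using uI[OF t] by simp
    qed
    then show ?thesis using e by blast
  qed auto
qed

section \<open>Classification of compact one-dimensional manifolds\<close>

text \<open>On a compact manifold the charts can be given a common radius, which bounds from below how far
  any unit speed curve can be continued.\<close>

definition charts_of_radius :: "'a::euclidean_space set \<Rightarrow> real \<Rightarrow> bool" where
  "charts_of_radius X \<epsilon> \<longleftrightarrow>
     0 < \<epsilon> \<and> (\<forall>x\<in>X. \<exists>\<gamma> U G. unit_chart X {-\<epsilon><..<\<epsilon>} \<gamma> U G \<and> \<gamma> 0 = x)"

lemma charts_of_radiusE:
  assumes "charts_of_radius X \<epsilon>" "x \<in> X"
  obtains \<gamma> U G where "unit_chart X {-\<epsilon><..<\<epsilon>} \<gamma> U G" "\<gamma> 0 = x" "x \<in> U" "G x = 0" "0 < \<epsilon>"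
proof -
  obtain \<gamma> U G where c: "unit_chart X {-\<epsilon><..<\<epsilon>} \<gamma> U G" "\<gamma> 0 = x" "0 < \<epsilon>"
    using assms unfolding charts_of_radius_def by blast
  have "\<gamma> 0 \<in> X \<inter> U" "G (\<gamma> 0) = 0" using c(1,3) unfolding unit_chart_def by auto
  then show thesis using that c by auto
qed

lemma charts_of_radius_exists:
  assumes X: "compact X" and arcs: "\<And>p. p \<in> X \<Longrightarrow> interior_arc_point X p"
  shows "\<exists>\<epsilon>. charts_of_radius X \<epsilon>"
proof (cases "X = {}")
  case True
  then show ?thesis by (intro exI[of _ 1]) (simp add: charts_of_radius_def)
next
  case False
  have "\<exists>a \<gamma> U G. 0 < a \<and> unit_chart X {-a<..<a} \<gamma> U G \<and> \<gamma> 0 = p" if "p \<in> X" for p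
    using unit_chart_exists[OF arcs[OF that] that] by blast
  then obtain a \<gamma> U G where c: "\<And>p. p \<in> X \<Longrightarrow> 0 < a p \<and> unit_chart X {- a p<..<a p} (\<gamma> p) (U p) (G p) \<and> \<gamma> p 0 = p"
    by metis
  \<comment> \<open>a point of the half-size chart is the centre of a chart of at least half the size\<close>
  have "\<exists>V. unit_chart X {-(a p/2)<..<a p/2} (\<lambda>t. \<gamma> p (t + 0)) V (\<lambda>x. G p x - 0)" if "p \<in> X" for p
  proof -
    have "{0 - a p/2<..<0 + a p/2} \<subseteq> {- a p<..<a p}" using c[OF that] by auto
    from unit_chart_restrict[OF _ this] c[OF that] show ?thesis by blast
  qed
  then obtain V where V: "\<And>p. p \<in> X \<Longrightarrow> unit_chart X {-(a p/2)<..<a p/2} (\<gamma> p) (V p) (G p)"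
    by simp metis
  have pV: "p \<in> V p" "open (V p)" "(\<gamma> p) ` {-(a p/2)<..<a p/2} = X \<inter> V p" if "p \<in> X" for p
  proof -
    show im: "(\<gamma> p) ` {-(a p/2)<..<a p/2} = X \<inter> V p" "open (V p)" using V[OF that] by (auto simp: unit_chart_def)
    have "\<gamma> p 0 \<in> (\<gamma> p) ` {-(a p/2)<..<a p/2}" by (rule imageI) (use c[OF that] in auto)
    then show "p \<in> V p" using im(1) c[OF that] by auto
  qed
  have "X \<subseteq> (\<Union>p\<in>X. V p)" using pV by blast
  then obtain C where C: "C \<subseteq> X" "finite C" "X \<subseteq> (\<Union>p\<in>C. V p)"
    using compactE_image[where S=X and C=X and f=V] X pV(2) by blast
  have "C \<noteq> {}" using C(3) False by auto
  define \<epsilon> where "\<epsilon> = Min (a ` C) / 2"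
  have "0 < Min (a ` C)" using \<open>C \<noteq> {}\<close> C c by (subst Min_gr_iff) auto
  then have \<epsilon>: "0 < \<epsilon>" by (simp add: \<epsilon>_def)
  have \<epsilon>a: "\<epsilon> \<le> a p / 2" if "p \<in> C" for p using C(2) that by (simp add: \<epsilon>_def)
  have "\<exists>\<beta> W H. unit_chart X {-\<epsilon><..<\<epsilon>} \<beta> W H \<and> \<beta> 0 = x" if x: "x \<in> X" for x
  proof -
    obtain p where p: "p \<in> C" "x \<in> V p" using C(3) x by blast
    then have pX: "p \<in> X" using C(1) by auto
    have "x \<in> (\<gamma> p) ` {-(a p/2)<..<a p/2}" using pV(3)[OF pX] x p(2) by auto
    then obtain s where s: "s \<in> {-(a p/2)<..<a p/2}" "x = \<gamma> p s" by auto
    have "{s-\<epsilon><..<s+\<epsilon>} \<subseteq> {- a p<..<a p}" using s(1) \<epsilon>a[OF p(1)] by auto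
    from unit_chart_restrict[OF _ this] c[OF pX]
    obtain W where "unit_chart X {-\<epsilon><..<\<epsilon>} (\<lambda>t. \<gamma> p (t + s)) W (\<lambda>x. G p x - s)" by blast
    moreover have "\<gamma> p (0 + s) = x" using s(2) by simp
    ultimately show ?thesis by blast
  qed
  then show ?thesis using \<epsilon> unfolding charts_of_radius_def by blast
qed

text \<open>Two unit speed curves that agree near one time agree at all times. The set of times near which
  they agree is open and closed: where the curves meet, both are the same chart read at affine
  parameters, and two affine functions that agree at two times are equal.\<close>

lemma unit_speed_unique:
  assumes R: "charts_of_radius X \<epsilon>" and \<alpha>: "unit_speed X J \<alpha>" and \<beta>: "unit_speed X J \<beta>"
    and J: "connected J" and t0: "t0 \<in> J" "0 < d" "\<And>t. t \<in> J \<Longrightarrow> \<bar>t - t0\<bar> < d \<Longrightarrow> \<alpha> t = \<beta> t"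
    and t: "t \<in> J"
  shows "\<alpha> t = \<beta> t"
proof -
  define P where "P t \<longleftrightarrow> (\<exists>d>0. \<forall>s\<in>J. \<bar>s - t\<bar> < d \<longrightarrow> \<alpha> s = \<beta> s)" for t
  have oJ: "open J" by (rule unit_speed_open[OF \<alpha>])
  note ca = unit_speed_continuous[OF \<alpha>] and cb = unit_speed_continuous[OF \<beta>]
  have step: "\<exists>T. openin (top_of_set J) T \<and> t1 \<in> T \<and> (\<forall>x\<in>T. \<forall>y\<in>T. P x \<longrightarrow> P y)" if t1: "t1 \<in> J" for t1
  proof (cases "\<alpha> t1 = \<beta> t1")
    case False
    let ?T = "J \<inter> (\<lambda>t. \<alpha> t - \<beta> t) -` (-{0})"
    have "openin (top_of_set J) ?T"
      by (rule continuous_openin_preimage_gen[OF continuous_on_diff[OF ca cb]]) auto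
    moreover have "\<not> P x" if "x \<in> ?T" for x
      using that unfolding P_def by (metis Int_iff abs_zero diff_self singletonI vimage_eq ComplD)
    ultimately show ?thesis using False t1 by (intro exI[of _ ?T]) auto
  next
    case True
    obtain \<gamma> U G where c: "unit_chart X {-\<epsilon><..<\<epsilon>} \<gamma> U G" "\<alpha> t1 \<in> U"
      by (rule charts_of_radiusE[OF R unit_speed_in[OF \<alpha> t1]]) (rule that)
    have G: "open U" "\<And>s. s \<in> {-\<epsilon><..<\<epsilon>} \<Longrightarrow> G (\<gamma> s) = s" using c(1) by (auto simp: unit_chart_def)
    have "open (J \<inter> \<alpha> -` U)" "open (J \<inter> \<beta> -` U)"
      by (rule continuous_open_preimage[OF ca oJ G(1)], rule continuous_open_preimage[OF cb oJ G(1)])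
    then have "open ((J \<inter> \<alpha> -` U) \<inter> (J \<inter> \<beta> -` U))" by (rule open_Int)
    moreover have "t1 \<in> (J \<inter> \<alpha> -` U) \<inter> (J \<inter> \<beta> -` U)" using t1 c(2) True by simp
    ultimately obtain r where r: "0 < r" "ball t1 r \<subseteq> (J \<inter> \<alpha> -` U) \<inter> (J \<inter> \<beta> -` U)"
      by (rule openE)
    let ?T = "ball t1 r"
    have TJ: "?T \<subseteq> J" using r(2) by auto
    obtain e1 c1 where 1: "\<And>t. t \<in> ?T \<Longrightarrow> e1 * t + c1 \<in> {-\<epsilon><..<\<epsilon>} \<and> \<alpha> t = \<gamma> (e1 * t + c1)"
      using unit_speed_in_chart[OF c(1) unit_speed_subset[OF \<alpha> open_ball TJ] connected_ball] r(2) by blast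
    obtain e2 c2 where 2: "\<And>t. t \<in> ?T \<Longrightarrow> e2 * t + c2 \<in> {-\<epsilon><..<\<epsilon>} \<and> \<beta> t = \<gamma> (e2 * t + c2)"
      using unit_speed_in_chart[OF c(1) unit_speed_subset[OF \<beta> open_ball TJ] connected_ball] r(2) by blast
    have "\<alpha> y = \<beta> y" if x: "x \<in> ?T" "P x" and y: "y \<in> ?T" for x y
    proof -
      obtain d where d: "0 < d" "\<And>s. s \<in> J \<Longrightarrow> \<bar>s - x\<bar> < d \<Longrightarrow> \<alpha> s = \<beta> s" using x(2) unfolding P_def by blast
      have "\<bar>x - t1\<bar> < r" using x(1) by (simp add: dist_real_def abs_minus_commute)
      then have "0 < min d (r - \<bar>x - t1\<bar>)" using d(1) by simp
      then obtain m where m: "0 < m" "m < min d (r - \<bar>x - t1\<bar>)" using dense by blast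
      define s where "s = x + m"
      have s: "s \<noteq> x" "\<bar>s - x\<bar> < d" "\<bar>s - t1\<bar> < r" using m unfolding s_def by auto
      have sT: "s \<in> ?T" using s(3) by (simp add: dist_real_def abs_minus_commute)
      have eq: "e1 * u + c1 = e2 * u + c2" if u: "u \<in> ?T" "\<bar>u - x\<bar> < d" for u
      proof -
        have "\<alpha> u = \<beta> u" by (rule d(2)) (use u TJ in auto)
        then have "\<gamma> (e1 * u + c1) = \<gamma> (e2 * u + c2)" using 1[OF u(1)] 2[OF u(1)] by simp
        then have "G (\<gamma> (e1 * u + c1)) = G (\<gamma> (e2 * u + c2))" by simp
        then show ?thesis using G(2) 1[OF u(1)] 2[OF u(1)] by simp
      qed
      have "e1 * x + c1 = e2 * x + c2" "e1 * s + c1 = e2 * s + c2"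
        using eq[OF x(1)] eq[OF sT s(2)] d(1) by simp_all
      then have "(e1 - e2) * (s - x) = 0" by (simp add: algebra_simps)
      then have "e1 = e2" using s(1) by simp
      moreover have "c1 = c2" using \<open>e1 * x + c1 = e2 * x + c2\<close> \<open>e1 = e2\<close> by simp
      ultimately show ?thesis using 1[OF y] 2[OF y] by simp
    qed
    then have all: "\<forall>s\<in>?T. \<alpha> s = \<beta> s" if "x \<in> ?T" "P x" for x using that by blast
    have "P y" if xy: "x \<in> ?T" "y \<in> ?T" "P x" for x y
    proof -
      obtain r' where r': "0 < r'" "ball y r' \<subseteq> ?T" by (rule openE[OF open_ball xy(2)])
      have "\<alpha> s = \<beta> s" if "\<bar>s - y\<bar> < r'" for s
      proof -
        have "s \<in> ball y r'" using that by (simp add: dist_real_def abs_minus_commute)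
        then show ?thesis using r'(2) all[OF xy(1,3)] by blast
      qed
      then show ?thesis unfolding P_def using r'(1) by blast
    qed
    moreover have "openin (top_of_set J) ?T" by (rule open_openin_trans[OF oJ open_ball TJ])
    moreover have "t1 \<in> ?T" using r(1) by simp
    ultimately show ?thesis by blast
  qed
  have "P t0" unfolding P_def using t0 by blast
  then have "P t" by (rule connected_induction_simple[OF J t0(1) t _ step])
  then obtain d' where "0 < d'" "\<forall>s\<in>J. \<bar>s - t\<bar> < d' \<longrightarrow> \<alpha> s = \<beta> s" unfolding P_def by blast
  then show ?thesis using t by simp
qed

lemma affine_preimage_interval:
  fixes e c :: real
  assumes "connected I" "connected J" "e \<in> {1,-1}"
  shows "connected (J \<inter> {t. e * t + c \<in> I})"
proof -
  have I: "x \<in> I" if "a \<in> I" "b \<in> I" "a \<le> x" "x \<le> b" for a b x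
    using assms(1) that unfolding connected_iff_interval by blast
  have "is_interval {t. e * t + c \<in> I}"
    unfolding is_interval_1
  proof (intro ballI allI impI, elim conjE)
    fix a b x assume ab: "a \<in> {t. e * t + c \<in> I}" "b \<in> {t. e * t + c \<in> I}" and x: "a \<le> x" "x \<le> b"
    show "x \<in> {t. e * t + c \<in> I}"
    proof (cases "e = 1")
      case True
      then show ?thesis using I[of "a + c" "b + c" "x + c"] ab x by simp
    next
      case False
      then have "e = -1" using assms(3) by simp
      then show ?thesis using I[of "- b + c" "- a + c" "- x + c"] ab x by simp
    qed
  qed
  moreover have "is_interval J" using assms(2) by (simp add: is_interval_connected_1)
  ultimately show ?thesis by (simp add: is_interval_Int is_interval_connected)
qed

text \<open>The affine description of a unit speed curve in a chart, valid near one time, stays valid for as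
  long as the affine parameter stays in the chart, by uniqueness.\<close>

lemma unit_speed_follows_chart:
  assumes R: "charts_of_radius X \<epsilon>" and \<alpha>: "unit_speed X J \<alpha>" and J: "connected J"
    and c: "unit_chart X I \<gamma> U G" and I: "connected I" and t1: "t1 \<in> J" and U: "\<alpha> t1 \<in> U"
  shows "\<exists>e\<in>{1,-1}. \<exists>c. e * t1 + c = G (\<alpha> t1) \<and> e * t1 + c \<in> I \<and>
           (\<forall>t\<in>J. e * t + c \<in> I \<longrightarrow> \<alpha> t = \<gamma> (e * t + c))"
proof -
  have oJ: "open J" by (rule unit_speed_open[OF \<alpha>])
  have G: "open U" "\<And>s. s \<in> I \<Longrightarrow> G (\<gamma> s) = s" and \<gamma>: "unit_speed X I \<gamma>" using c by (auto simp: unit_chart_def)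
  have "open (J \<inter> \<alpha> -` U)" by (rule continuous_open_preimage[OF unit_speed_continuous[OF \<alpha>] oJ G(1)])
  moreover have "t1 \<in> J \<inter> \<alpha> -` U" using t1 U by simp
  ultimately obtain r where r: "0 < r" "ball t1 r \<subseteq> J \<inter> \<alpha> -` U" by (rule openE)
  have TJ: "ball t1 r \<subseteq> J" using r(2) by auto
  obtain e c where e: "e \<in> {1,-1}" and ec: "\<And>t. t \<in> ball t1 r \<Longrightarrow> e * t + c \<in> I \<and> \<alpha> t = \<gamma> (e * t + c)"
    using unit_speed_in_chart[OF c unit_speed_subset[OF \<alpha> open_ball TJ] connected_ball] r(2) by blast
  have t1c: "e * t1 + c \<in> I" "\<alpha> t1 = \<gamma> (e * t1 + c)" using ec[of t1] r(1) by auto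
  let ?K = "J \<inter> {t. e * t + c \<in> I}"
  have us: "unit_speed X {t. e * t + c \<in> I} (\<lambda>t. \<gamma> (e * t + c))" by (rule unit_speed_affine[OF \<gamma> e])
  have oK: "open ?K" by (rule open_Int[OF oJ unit_speed_open[OF us]])
  have "\<alpha> t = \<gamma> (e * t + c)" if t: "t \<in> J" "e * t + c \<in> I" for t
  proof (rule unit_speed_unique[OF R, where J="?K" and ?t0.0=t1 and d=r and \<alpha>=\<alpha> and \<beta>="\<lambda>t. \<gamma> (e * t + c)" and t=t])
    show "unit_speed X ?K \<alpha>" by (rule unit_speed_subset[OF \<alpha> oK]) auto
    show "unit_speed X ?K (\<lambda>t. \<gamma> (e * t + c))" by (rule unit_speed_subset[OF us oK]) auto
    show "connected ?K" by (rule affine_preimage_interval[OF I J e])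
    show "\<alpha> t = \<gamma> (e * t + c)" if "t \<in> ?K" "\<bar>t - t1\<bar> < r" for t
      using ec[of t] that by (simp add: dist_real_def abs_minus_commute)
  qed (use t t1 t1c r in auto)
  then show ?thesis using e t1c G(2)[OF t1c(1)] by (intro bexI[OF _ e] exI[of _ c]) auto
qed

lemma unit_speed_follows_chartE:
  assumes "charts_of_radius X \<epsilon>" "unit_speed X J \<alpha>" "connected J"
    and "unit_chart X I \<gamma> U G" "connected I" "t1 \<in> J" "\<alpha> t1 \<in> U"
  obtains e c where "e \<in> {1,-1}" "e * t1 + c = G (\<alpha> t1)" "e * t1 + c \<in> I"
    "\<And>t. t \<in> J \<Longrightarrow> e * t + c \<in> I \<Longrightarrow> \<alpha> t = \<gamma> (e * t + c)"
proof -
  obtain e where e: "e \<in> {1,-1}" "\<exists>c. e * t1 + c = G (\<alpha> t1) \<and> e * t1 + c \<in> I \<and>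
           (\<forall>t\<in>J. e * t + c \<in> I \<longrightarrow> \<alpha> t = \<gamma> (e * t + c))"
    using unit_speed_follows_chart[OF assms] by (rule bexE) (rule that)
  from e(2) obtain c where c: "e * t1 + c = G (\<alpha> t1) \<and> e * t1 + c \<in> I \<and>
           (\<forall>t\<in>J. e * t + c \<in> I \<longrightarrow> \<alpha> t = \<gamma> (e * t + c))" by (rule exE) (rule that)
  show thesis
    by (rule that[OF e(1) c[THEN conjunct1] c[THEN conjunct2, THEN conjunct1]])
       (rule c[THEN conjunct2, THEN conjunct2, rule_format])
qed

text \<open>Continue the curve by the chart centred at the point reached at time \<open>b - \<epsilon>/2\<close>; that chart lasts
  until time \<open>b + \<epsilon>/2\<close>.\<close>

lemma unit_speed_extend:
  assumes R: "charts_of_radius X \<epsilon>" and \<alpha>: "unit_speed X {a<..<b} \<alpha>" and ab: "a + \<epsilon> \<le> b"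
  shows "\<exists>\<beta>. unit_speed X {a<..<b + \<epsilon>/2} \<beta> \<and> (\<forall>t\<in>{a<..<b}. \<beta> t = \<alpha> t)"
proof -
  have \<epsilon>: "0 < \<epsilon>" using R by (simp add: charts_of_radius_def)
  define t1 where "t1 = b - \<epsilon>/2"
  have t1: "t1 \<in> {a<..<b}" using ab \<epsilon> by (auto simp: t1_def)
  let ?I = "{-\<epsilon><..<\<epsilon>}"
  obtain \<gamma> U G where c: "unit_chart X ?I \<gamma> U G" "\<alpha> t1 \<in> U" "G (\<alpha> t1) = 0"
    by (rule charts_of_radiusE[OF R unit_speed_in[OF \<alpha> t1]]) (rule that)
  have con: "connected {a<..<b}" "connected ?I" by (simp_all only: connected_Ioo)
  obtain e c0 where e: "e \<in> {1,-1}" "e * t1 + c0 = G (\<alpha> t1)"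
    and eq: "\<And>t. t \<in> {a<..<b} \<Longrightarrow> e * t + c0 \<in> ?I \<Longrightarrow> \<alpha> t = \<gamma> (e * t + c0)"
    by (rule unit_speed_follows_chartE[OF R \<alpha> con(1) c(1) con(2) t1 c(2)]) (rule that)
  have us: "unit_speed X {t. e * t + c0 \<in> ?I} (\<lambda>t. \<gamma> (e * t + c0))"
    by (rule unit_speed_affine[OF _ e(1)]) (use c(1) in \<open>simp add: unit_chart_def\<close>)
  have near: "e * t + c0 \<in> ?I" if "\<bar>t - t1\<bar> < \<epsilon>" for t
  proof -
    have "e * t + c0 = e * (t - t1)" using e(2) c(3) by (simp add: algebra_simps)
    then show ?thesis using e(1) that by auto
  qed
  define \<beta> where "\<beta> t = (if t < b then \<alpha> t else \<gamma> (e * t + c0))" for t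
  have "unit_speed X {a<..<b + \<epsilon>/2} \<beta>"
  proof (rule unit_speed_local)
    fix t assume t: "t \<in> {a<..<b + \<epsilon>/2}"
    show "\<exists>V \<delta>. t \<in> V \<and> unit_speed X V \<delta> \<and> (\<forall>s\<in>V. \<beta> s = \<delta> s)"
    proof (cases "t < b")
      case True
      have "\<forall>s\<in>{a<..<b}. \<beta> s = \<alpha> s" by (simp add: \<beta>_def)
      then show ?thesis using True t \<alpha> by (intro exI[of _ "{a<..<b}"] exI[of _ \<alpha>]) simp
    next
      case False
      let ?V = "{t1<..<t1+\<epsilon>}"
      have VI: "e * s + c0 \<in> ?I" if "s \<in> ?V" for s by (rule near) (use that in auto)
      then have "unit_speed X ?V (\<lambda>t. \<gamma> (e * t + c0))"
        by (intro unit_speed_subset[OF us]) auto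
      moreover have "\<beta> s = \<gamma> (e * s + c0)" if s: "s \<in> ?V" for s
        using eq[of s, OF _ VI[OF s]] t1 s by (auto simp: \<beta>_def)
      moreover have "t \<in> ?V" using False t \<epsilon> by (auto simp: t1_def)
      ultimately show ?thesis by blast
    qed
  qed simp
  then show ?thesis by (intro exI[of _ \<beta>]) (simp add: \<beta>_def)
qed

lemma unit_speed_reflect:
  assumes "unit_speed X {a<..<b} \<alpha>" shows "unit_speed X {-b<..<-a} (\<lambda>t. \<alpha> (- t))"
proof -
  have "{t. -1 * t + 0 \<in> {a<..<b}} = {-b<..<-a}" by auto
  then show ?thesis using unit_speed_affine[OF assms, of "-1" 0] by simp
qed

lemma unit_speed_extend_both:
  assumes R: "charts_of_radius X \<epsilon>" and \<alpha>: "unit_speed X {-b<..<b} \<alpha>" and b: "\<epsilon> \<le> b"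
  shows "\<exists>\<beta>. unit_speed X {-(b + \<epsilon>/2)<..<b + \<epsilon>/2} \<beta> \<and> (\<forall>t\<in>{-b<..<b}. \<beta> t = \<alpha> t)"
proof -
  have \<epsilon>: "0 < \<epsilon>" using R by (simp add: charts_of_radius_def)
  have "-b + \<epsilon> \<le> b" using b \<epsilon> by simp
  then obtain \<beta> where \<beta>: "unit_speed X {-b<..<b+\<epsilon>/2} \<beta>" "\<And>t. t \<in> {-b<..<b} \<Longrightarrow> \<beta> t = \<alpha> t"
    using unit_speed_extend[OF R \<alpha>] by blast
  have r: "unit_speed X {-(b+\<epsilon>/2)<..<b} (\<lambda>t. \<beta> (- t))" using unit_speed_reflect[OF \<beta>(1)] by simp
  have "-(b+\<epsilon>/2) + \<epsilon> \<le> b" using b \<epsilon> by simp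
  then obtain \<delta> where \<delta>: "unit_speed X {-(b+\<epsilon>/2)<..<b+\<epsilon>/2} \<delta>" "\<And>t. t \<in> {-(b+\<epsilon>/2)<..<b} \<Longrightarrow> \<delta> t = \<beta> (- t)"
    using unit_speed_extend[OF R r] by blast
  have "unit_speed X {-(b+\<epsilon>/2)<..<b+\<epsilon>/2} (\<lambda>t. \<delta> (- t))" using unit_speed_reflect[OF \<delta>(1)] by (simp only: minus_minus)
  moreover have "\<delta> (- t) = \<alpha> t" if "t \<in> {-b<..<b}" for t
    using \<delta>(2)[of "-t"] \<beta>(2)[of t] that \<epsilon> by auto
  ultimately show ?thesis by blast
qed

text \<open>Each extension gains the fixed length \<open>\<epsilon>/2\<close> at both ends, so countably many of them cover the line.\<close>

lemma unit_speed_line: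
  assumes R: "charts_of_radius X \<epsilon>" and x: "x \<in> X"
  shows "\<exists>\<gamma>. unit_speed X UNIV \<gamma> \<and> \<gamma> 0 = x"
proof -
  have \<epsilon>: "0 < \<epsilon>" using R by (simp add: charts_of_radius_def)
  define b where "b n = \<epsilon> + real n * (\<epsilon>/2)" for n
  have bS: "b (Suc n) = b n + \<epsilon>/2" for n unfolding b_def of_nat_Suc distrib_right by simp
  obtain \<gamma>0 U G where c: "unit_chart X {-\<epsilon><..<\<epsilon>} \<gamma>0 U G" "\<gamma>0 0 = x"
    by (rule charts_of_radiusE[OF R x]) (rule that)
  have "\<exists>A. \<forall>n. (unit_speed X {-b n<..<b n} (A n) \<and> A n 0 = x) \<and> (\<forall>t\<in>{-b n<..<b n}. A (Suc n) t = A n t)"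
  proof (rule dependent_nat_choice)
    show "\<exists>\<alpha>. unit_speed X {-b 0<..<b 0} \<alpha> \<and> \<alpha> 0 = x"
      using c unfolding b_def unit_chart_def by auto
    fix \<alpha> n assume \<alpha>: "unit_speed X {-b n<..<b n} \<alpha> \<and> \<alpha> 0 = x"
    have "\<epsilon> \<le> b n" using \<epsilon> by (simp add: b_def)
    then obtain \<beta> where \<beta>: "unit_speed X {-(b n + \<epsilon>/2)<..<b n + \<epsilon>/2} \<beta>" "\<forall>t\<in>{-b n<..<b n}. \<beta> t = \<alpha> t"
      using unit_speed_extend_both[OF R conjunct1[OF \<alpha>]] by blast
    moreover have "0 \<in> {-b n<..<b n}" using \<epsilon> \<open>\<epsilon> \<le> b n\<close> by auto
    ultimately have "unit_speed X {-b (Suc n)<..<b (Suc n)} \<beta>" "\<beta> 0 = x" "\<forall>t\<in>{-b n<..<b n}. \<beta> t = \<alpha> t"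
      using \<alpha> by (auto simp: bS)
    then show "\<exists>\<beta>. (unit_speed X {-b (Suc n)<..<b (Suc n)} \<beta> \<and> \<beta> 0 = x) \<and> (\<forall>t\<in>{-b n<..<b n}. \<beta> t = \<alpha> t)"
      by blast
  qed
  then obtain A where A: "\<And>n. unit_speed X {-b n<..<b n} (A n)" "\<And>n. A n 0 = x"
    "\<And>n t. t \<in> {-b n<..<b n} \<Longrightarrow> A (Suc n) t = A n t"
    by blast
  have mono: "b n \<le> b m" if "n \<le> m" for n m
    using \<epsilon> that by (simp add: b_def mult_right_mono)
  have coh: "A m t = A n t" if "n \<le> m" "t \<in> {-b n<..<b n}" for n m t
    using that(1)
  proof (induction rule: dec_induct)
    case (step k)
    have "t \<in> {-b k<..<b k}" using that(2) mono[OF step(1)] by auto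
    then show ?case using A(3) step by simp
  qed simp
  have ex: "\<exists>n. t \<in> {-b n<..<b n}" for t
  proof -
    obtain n where "\<bar>t\<bar> < real n * (\<epsilon>/2)" using reals_Archimedean3[of "\<epsilon>/2"] \<epsilon> by (auto simp: mult.commute)
    then show ?thesis using \<epsilon> by (intro exI[of _ n]) (auto simp: b_def)
  qed
  define \<gamma> where "\<gamma> t = A (LEAST n. t \<in> {-b n<..<b n}) t" for t
  have \<gamma>A: "\<gamma> t = A n t" if "t \<in> {-b n<..<b n}" for t n
    unfolding \<gamma>_def
    using coh[of "LEAST n. t \<in> {-b n<..<b n}" n t] Least_le[of "\<lambda>n. t \<in> {-b n<..<b n}" n] 
      LeastI_ex[OF ex, of t] that by simp
  have "unit_speed X UNIV \<gamma>"
  proof (rule unit_speed_local)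
    fix t
    obtain n where n: "t \<in> {-b n<..<b n}" using ex by blast
    then show "\<exists>V \<beta>. t \<in> V \<and> unit_speed X V \<beta> \<and> (\<forall>s\<in>V. \<gamma> s = \<beta> s)"
      using A(1)[of n] \<gamma>A[of _ n] by blast
  qed simp
  moreover have "\<gamma> 0 = x" using \<gamma>A[of 0 0] A(2) \<epsilon> by (simp add: b_def)
  ultimately show ?thesis by blast
qed

lemma unit_speed_line_covers_chart:
  assumes R: "charts_of_radius X \<epsilon>" and \<gamma>: "unit_speed X UNIV \<gamma>"
    and c: "unit_chart X I \<delta> U G" "connected I" and meet: "range \<gamma> \<inter> U \<noteq> {}"
  shows "X \<inter> U \<subseteq> range \<gamma>"
proof
  fix x assume "x \<in> X \<inter> U"
  then obtain s where s: "s \<in> I" "x = \<delta> s" using c(1) unfolding unit_chart_def by blast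
  obtain t1 where "\<gamma> t1 \<in> U" using meet by blast
  then obtain e c0 where e: "e \<in> {1,-1}" and eq: "\<And>t. t \<in> UNIV \<Longrightarrow> e * t + c0 \<in> I \<Longrightarrow> \<gamma> t = \<delta> (e * t + c0)"
    by (rule unit_speed_follows_chartE[OF R \<gamma> connected_UNIV c UNIV_I]) (rule that)
  have "e * (e * (s - c0)) + c0 = s" using e by auto
  then have "x = \<gamma> (e * (s - c0))" using eq[of "e * (s - c0)"] s by simp
  then show "x \<in> range \<gamma>" by (rule range_eqI)
qed

text \<open>A line that meets a chart contains it. Hence both its image and the complement of its image are
  unions of relatively open pieces, so the connected image is a whole component.\<close>

lemma range_unit_speed_line:
  assumes R: "charts_of_radius X \<epsilon>" and \<gamma>: "unit_speed X UNIV \<gamma>"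
  shows "range \<gamma> \<in> components X" "openin (top_of_set X) (range \<gamma>)"
proof -
  have \<gamma>X: "range \<gamma> \<subseteq> X" using \<gamma> by (simp add: unit_speed_def)
  have chart: "\<exists>U. open U \<and> x \<in> U \<and> (range \<gamma> \<inter> U \<noteq> {} \<longrightarrow> X \<inter> U \<subseteq> range \<gamma>)" if x: "x \<in> X" for x
  proof -
    obtain \<delta> U G where c: "unit_chart X {-\<epsilon><..<\<epsilon>} \<delta> U G" "x \<in> U"
      by (rule charts_of_radiusE[OF R x]) (rule that)
    have "open U" using c(1) by (simp add: unit_chart_def)
    then show ?thesis
      using unit_speed_line_covers_chart[OF R \<gamma> c(1)] c(2) by (intro exI[of _ U]) simp
  qed
  show op: "openin (top_of_set X) (range \<gamma>)"
  proof (subst openin_subopen, rule ballI)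
    fix x assume x: "x \<in> range \<gamma>"
    then obtain U where U: "open U" "x \<in> U" "range \<gamma> \<inter> U \<noteq> {} \<longrightarrow> X \<inter> U \<subseteq> range \<gamma>"
      using chart \<gamma>X by blast
    then have "openin (top_of_set X) (X \<inter> U)" "x \<in> X \<inter> U" "X \<inter> U \<subseteq> range \<gamma>"
      using x \<gamma>X by (auto simp: openin_open_Int)
    then show "\<exists>T. openin (top_of_set X) T \<and> x \<in> T \<and> T \<subseteq> range \<gamma>" by blast
  qed
  have "openin (top_of_set X) (X - range \<gamma>)"
  proof (subst openin_subopen, rule ballI)
    fix x assume x: "x \<in> X - range \<gamma>"
    then obtain U where U: "open U" "x \<in> U" "range \<gamma> \<inter> U \<noteq> {} \<longrightarrow> X \<inter> U \<subseteq> range \<gamma>"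
      using chart by blast
    then have "openin (top_of_set X) (X \<inter> U)" "x \<in> X \<inter> U" "X \<inter> U \<subseteq> X - range \<gamma>"
      using x by (auto simp: openin_open_Int)
    then show "\<exists>T. openin (top_of_set X) T \<and> x \<in> T \<and> T \<subseteq> X - range \<gamma>" by blast
  qed
  then have cl: "closedin (top_of_set X) (range \<gamma>)" using \<gamma>X by (simp add: closedin_def)
  have con: "connected (range \<gamma>)"
    by (rule connected_continuous_image[OF unit_speed_continuous[OF \<gamma>] connected_UNIV])
  have "D = range \<gamma>" if D: "range \<gamma> \<subseteq> D" "D \<subseteq> X" "connected D" for D
  proof -
    have "openin (top_of_set D) (range \<gamma>)" by (rule openin_subset_trans[OF op D(1,2)])
    moreover have "closedin (top_of_set D) (range \<gamma>)" by (rule closedin_subset_trans[OF cl D(1,2)])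
    ultimately have "range \<gamma> = {} \<or> range \<gamma> = D" using D(3) unfolding connected_clopen by blast
    then show ?thesis by auto
  qed
  then show "range \<gamma> \<in> components X"
    unfolding in_components_maximal using \<gamma>X con by blast
qed

text \<open>A return to the same point in the opposite direction would fold the curve at the midpoint.\<close>

lemma unit_speed_return_is_period:
  assumes R: "charts_of_radius X \<epsilon>" and \<gamma>: "unit_speed X UNIV \<gamma>" and ab: "a < b" "\<gamma> a = \<gamma> b"
  shows "\<gamma> (t + (b - a)) = \<gamma> t"
proof -
  let ?I = "{-\<epsilon><..<\<epsilon>}"
  have con: "connected ?I" by (rule connected_Ioo)
  have \<epsilon>: "0 < \<epsilon>" using R by (simp add: charts_of_radius_def)
  obtain \<delta> U G where c: "unit_chart X ?I \<delta> U G" "\<gamma> a \<in> U" "G (\<gamma> a) = 0"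
    by (rule charts_of_radiusE[OF R unit_speed_in[OF \<gamma> UNIV_I]]) (rule that)
  obtain e1 c1 where 1: "e1 \<in> {1,-1}" "e1 * a + c1 = G (\<gamma> a)" "\<And>t. t \<in> UNIV \<Longrightarrow> e1 * t + c1 \<in> ?I \<Longrightarrow> \<gamma> t = \<delta> (e1 * t + c1)"
    by (rule unit_speed_follows_chartE[OF R \<gamma> connected_UNIV c(1) con UNIV_I c(2)]) (rule that)
  have cb: "\<gamma> b \<in> U" "G (\<gamma> b) = 0" using c ab(2) by simp_all
  obtain e2 c2 where 2: "e2 \<in> {1,-1}" "e2 * b + c2 = G (\<gamma> b)" "\<And>t. t \<in> UNIV \<Longrightarrow> e2 * t + c2 \<in> ?I \<Longrightarrow> \<gamma> t = \<delta> (e2 * t + c2)"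
    by (rule unit_speed_follows_chartE[OF R \<gamma> connected_UNIV c(1) con UNIV_I cb(1)]) (rule that)
  have A: "\<gamma> t = \<delta> (e1 * (t - a))" if "\<bar>t - a\<bar> < \<epsilon>" for t
  proof -
    have "e1 * t + c1 = e1 * (t - a)" using 1(2) c(3) by (simp add: algebra_simps)
    moreover have "e1 * (t - a) \<in> ?I" using 1(1) that by auto
    ultimately show ?thesis using 1(3)[of t] by simp
  qed
  have B: "\<gamma> t = \<delta> (e2 * (t - b))" if "\<bar>t - b\<bar> < \<epsilon>" for t
  proof -
    have "e2 * t + c2 = e2 * (t - b)" using 2(2) cb(2) by (simp add: algebra_simps)
    moreover have "e2 * (t - b) \<in> ?I" using 2(1) that by auto
    ultimately show ?thesis using 2(3)[of t] by simp
  qed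
  show ?thesis
  proof (cases "e1 = e2")
    case True
    have us: "unit_speed X UNIV (\<lambda>t. \<gamma> (t + (b - a)))"
      using unit_speed_affine[OF \<gamma>, of 1 "b - a"] by simp
    show ?thesis
    proof (rule unit_speed_unique[OF R us \<gamma> connected_UNIV, where ?t0.0=a and d=\<epsilon>])
      fix t assume "\<bar>t - a\<bar> < \<epsilon>"
      then show "\<gamma> (t + (b - a)) = \<gamma> t" using A[of t] B[of "t + (b - a)"] True by simp
    qed (use \<epsilon> in auto)
  next
    case False
    then have e: "e2 = - e1" using 1(1) 2(1) by auto
    have us: "unit_speed X UNIV (\<lambda>t. \<gamma> (-1 * t + (a + b)))"
      using unit_speed_affine[OF \<gamma>, of "-1" "a + b"] by simp
    have refl: "\<gamma> (-1 * t + (a + b)) = \<gamma> t" for t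
    proof (rule unit_speed_unique[OF R us \<gamma> connected_UNIV, where ?t0.0=a and d=\<epsilon>])
      fix t assume "\<bar>t - a\<bar> < \<epsilon>"
      then show "\<gamma> (-1 * t + (a + b)) = \<gamma> t" using A[of t] B[of "-1 * t + (a + b)"] e by (simp add: algebra_simps)
    qed (use \<epsilon> in auto)
    define m where "m = (a + b) / 2"
    obtain \<eta> V H where h: "unit_chart X ?I \<eta> V H" "\<gamma> m \<in> V" "H (\<gamma> m) = 0"
      by (rule charts_of_radiusE[OF R unit_speed_in[OF \<gamma> UNIV_I]]) (rule that)
    obtain e3 c3 where 3: "e3 \<in> {1,-1}" "e3 * m + c3 = H (\<gamma> m)" "\<And>t. t \<in> UNIV \<Longrightarrow> e3 * t + c3 \<in> ?I \<Longrightarrow> \<gamma> t = \<eta> (e3 * t + c3)"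
      by (rule unit_speed_follows_chartE[OF R \<gamma> connected_UNIV h(1) con UNIV_I h(2)]) (rule that)
    have C: "e3 * (m + u) + c3 = e3 * u" for u using 3(2) h(3) by (simp add: algebra_simps)
    have Hinv: "H (\<eta> s) = s" if "s \<in> ?I" for s using h(1) that by (simp add: unit_chart_def)
    have in1: "e3 * (\<epsilon>/2) \<in> ?I" "e3 * (-(\<epsilon>/2)) \<in> ?I" using 3(1) \<epsilon> by auto
    have "\<gamma> (m + \<epsilon>/2) = \<eta> (e3 * (\<epsilon>/2))" using 3(3)[of "m + \<epsilon>/2"] C[of "\<epsilon>/2"] in1 by simp
    moreover have "\<gamma> (m + -(\<epsilon>/2)) = \<eta> (e3 * (-(\<epsilon>/2)))" using 3(3)[of "m + -(\<epsilon>/2)"] C[of "-(\<epsilon>/2)"] in1 by simp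
    moreover have "-1 * (m + \<epsilon>/2) + (a + b) = m + -(\<epsilon>/2)" by (simp add: m_def field_simps)
    then have "\<gamma> (m + -(\<epsilon>/2)) = \<gamma> (m + \<epsilon>/2)" using refl[of "m + \<epsilon>/2"] by (simp only:)
    ultimately have "\<eta> (e3 * (\<epsilon>/2)) = \<eta> (e3 * (-(\<epsilon>/2)))" by simp
    then have "H (\<eta> (e3 * (\<epsilon>/2))) = H (\<eta> (e3 * (-(\<epsilon>/2))))" by simp
    then have "e3 * (\<epsilon>/2) = e3 * (-(\<epsilon>/2))" unfolding Hinv[OF in1(1)] Hinv[OF in1(2)] .
    then show ?thesis using 3(1) \<epsilon> by auto
  qed
qed

lemma unit_speed_locally_injective:
  assumes R: "charts_of_radius X \<epsilon>" and \<gamma>: "unit_speed X UNIV \<gamma>" and st: "\<bar>s - t\<bar> < \<epsilon>" "\<gamma> s = \<gamma> t"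
  shows "s = t"
proof -
  let ?I = "{-\<epsilon><..<\<epsilon>}"
  have \<epsilon>: "0 < \<epsilon>" using R by (simp add: charts_of_radius_def)
  obtain \<delta> U G where c: "unit_chart X ?I \<delta> U G" "\<gamma> t \<in> U" "G (\<gamma> t) = 0"
    by (rule charts_of_radiusE[OF R unit_speed_in[OF \<gamma> UNIV_I]]) (rule that)
  obtain e c0 where e: "e \<in> {1,-1}" "e * t + c0 = G (\<gamma> t)" "\<And>t. t \<in> UNIV \<Longrightarrow> e * t + c0 \<in> ?I \<Longrightarrow> \<gamma> t = \<delta> (e * t + c0)"
    by (rule unit_speed_follows_chartE[OF R \<gamma> connected_UNIV c(1) connected_Ioo UNIV_I c(2)]) (rule that)
  have "e * s + c0 = e * (s - t)" using e(2) c(3) by (simp add: algebra_simps)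
  then have s: "e * s + c0 \<in> ?I" using e(1) st(1) by auto
  have Ginv: "G (\<delta> s) = s" if "s \<in> ?I" for s using c(1) that by (simp add: unit_chart_def)
  have "e * s + c0 = G (\<gamma> s)" using e(3)[OF UNIV_I s] Ginv[OF s] by simp
  then have "e * s + c0 = 0" using st(2) c(3) by simp
  then show ?thesis using e(1,2) c(3) by auto
qed

text \<open>An injective line would leave every chart for good, so its values at equally spaced times
  could not accumulate.\<close>

lemma unit_speed_line_returns:
  assumes X: "compact X" and R: "charts_of_radius X \<epsilon>" and \<gamma>: "unit_speed X UNIV \<gamma>"
  shows "\<exists>a b. a < b \<and> \<gamma> a = \<gamma> b"
proof -
  let ?I = "{-\<epsilon><..<\<epsilon>}"
  have \<epsilon>: "0 < \<epsilon>" using R by (simp add: charts_of_radius_def)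
  \<comment> \<open>a passage through a chart takes time \<open>2 * \<epsilon>\<close>, hence this spacing\<close>
  define x where "x n = \<gamma> (real n * (2 * \<epsilon>))" for n
  have "\<forall>n. x n \<in> X" using \<gamma> by (auto simp: x_def unit_speed_def)
  then obtain y r where y: "y \<in> X" "strict_mono r" "(x \<circ> r) \<longlonglongrightarrow> y"
    using X unfolding compact_def by blast
  obtain \<delta> U G where c: "unit_chart X ?I \<delta> U G" "y \<in> U"
    by (rule charts_of_radiusE[OF R y(1)]) (rule that)
  have "open U" using c(1) by (simp add: unit_chart_def)
  then have "eventually (\<lambda>n. (x \<circ> r) n \<in> U) sequentially"
    using y(3) c(2) by (metis topological_tendstoD)
  then obtain N where N: "\<And>n. n \<ge> N \<Longrightarrow> x (r n) \<in> U" unfolding eventually_sequentially by auto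
  define t1 where "t1 = real (r N) * (2 * \<epsilon>)"
  define t2 where "t2 = real (r (Suc N)) * (2 * \<epsilon>)"
  have "r N + 1 \<le> r (Suc N)" using y(2) by (simp add: strict_mono_Suc_iff Suc_le_eq)
  then have "real (r N) + 1 \<le> real (r (Suc N))" by linarith
  then have "(real (r N) + 1) * (2 * \<epsilon>) \<le> t2" unfolding t2_def using \<epsilon> by (intro mult_right_mono) auto
  then have t12: "t1 + 2 * \<epsilon> \<le> t2" by (simp add: t1_def algebra_simps)
  have U12: "\<gamma> t1 \<in> U" "\<gamma> t2 \<in> U" using N[of N] N[of "Suc N"] by (auto simp: x_def t1_def t2_def)
  obtain e c0 where e: "e \<in> {1,-1}" "e * t1 + c0 \<in> ?I" "\<And>t. t \<in> UNIV \<Longrightarrow> e * t + c0 \<in> ?I \<Longrightarrow> \<gamma> t = \<delta> (e * t + c0)"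
    by (rule unit_speed_follows_chartE[OF R \<gamma> connected_UNIV c(1) connected_Ioo UNIV_I U12(1)]) (rule that)
  have "\<gamma> t2 \<in> X \<inter> U" using U12(2) unit_speed_in[OF \<gamma>] by simp
  then obtain s where s: "s \<in> ?I" "\<gamma> t2 = \<delta> s" using c(1) unfolding unit_chart_def by blast
  define t where "t = e * (s - c0)"
  have et: "e * t + c0 = s" using e(1) by (auto simp: t_def)
  have "\<gamma> t = \<gamma> t2" using e(3)[of t] et s by simp
  moreover have "t < t2"
  proof -
    have "\<bar>t - t1\<bar> = \<bar>e * (t - t1)\<bar>" using e(1) by auto
    also have "e * (t - t1) = s - (e * t1 + c0)" using et by (simp add: algebra_simps)
    also have "\<bar>s - (e * t1 + c0)\<bar> < 2 * \<epsilon>" using s(1) e(2) by auto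
    finally show ?thesis using t12 by linarith
  qed
  ultimately show ?thesis by blast
qed

text \<open>Return times are bounded below by \<open>\<epsilon>\<close> and form a closed set, so there is a least one \<open>\<tau>\<close>. Every
  coincidence of values is a period, hence a multiple of \<open>\<tau>\<close> by division with remainder.\<close>

lemma embedded_circle_range_unit_speed:
  assumes X: "compact X" and R: "charts_of_radius X \<epsilon>" and \<gamma>: "unit_speed X UNIV \<gamma>"
  shows "embedded_circle (range \<gamma>)"
proof -
  have \<epsilon>: "0 < \<epsilon>" using R by (simp add: charts_of_radius_def)
  define P where "P = {d. \<epsilon> \<le> d \<and> \<gamma> d = \<gamma> 0}"
  have per: "\<gamma> (t + (b - a)) = \<gamma> t" if "\<gamma> a = \<gamma> b" "a < b" for a b t
    by (rule unit_speed_return_is_period[OF R \<gamma> that(2,1)])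
  have PI: "d \<in> P" if "0 < d" "\<gamma> d = \<gamma> 0" for d
    using unit_speed_locally_injective[OF R \<gamma>, of d 0] that by (force simp: P_def)
  obtain a b where ab: "a < b" "\<gamma> a = \<gamma> b" using unit_speed_line_returns[OF X R \<gamma>] by blast
  then have "b - a \<in> P" using per[OF ab(2,1), of 0] by (intro PI) simp_all
  then have ne: "P \<noteq> {}" by auto
  have bdd: "bdd_below P" by (rule bdd_belowI[of _ \<epsilon>]) (simp add: P_def)
  have "closed ({\<epsilon>..} \<inter> \<gamma> -` {\<gamma> 0})"
    by (rule continuous_closed_preimage[OF continuous_on_subset[OF unit_speed_continuous[OF \<gamma>]]]) auto
  moreover have "P = {\<epsilon>..} \<inter> \<gamma> -` {\<gamma> 0}" by (auto simp: P_def)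
  ultimately have "closed P" by simp
  define \<tau> where "\<tau> = Inf P"
  have "\<tau> \<in> P" unfolding \<tau>_def by (rule closed_contains_Inf[OF ne bdd \<open>closed P\<close>])
  then have \<tau>: "0 < \<tau>" "\<gamma> \<tau> = \<gamma> 0" using \<epsilon> by (auto simp: P_def)
  have min: "\<tau> \<le> d" if "d \<in> P" for d unfolding \<tau>_def by (rule cInf_lower[OF that bdd])
  have step: "\<gamma> (t + \<tau>) = \<gamma> t" for t using per[of 0 \<tau> t] \<tau> by simp
  have stepn: "\<gamma> (t + of_nat n * \<tau>) = \<gamma> t" for t n
  proof (induction n)
    case (Suc n)
    have "t + of_nat (Suc n) * \<tau> = (t + of_nat n * \<tau>) + \<tau>" by (simp add: algebra_simps)
    then show ?case using step[of "t + of_nat n * \<tau>"] Suc by (simp only:)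
  qed simp
  have stepi: "\<gamma> (t + of_int n * \<tau>) = \<gamma> t" for t and n :: int
  proof (cases "0 \<le> n")
    case True
    then show ?thesis using stepn[of t "nat n"] by simp
  next
    case False
    then have "(t + of_int n * \<tau>) + of_nat (nat (- n)) * \<tau> = t" by (simp add: algebra_simps)
    then show ?thesis using stepn[of "t + of_int n * \<tau>" "nat (- n)"] by (simp only:)
  qed
  have iff: "\<gamma> s = \<gamma> t \<longleftrightarrow> (\<exists>n::int. s = t + of_int n * \<tau>)" for s t
  proof
    assume eq: "\<gamma> s = \<gamma> t"
    obtain n :: int where n: "t \<le> s + of_int n * \<tau>" "s + of_int n * \<tau> < t + \<tau>"
      by (rule int_shift_into_period[OF \<tau>(1)]) (rule that)
    define s' where "s' = s + of_int n * \<tau>"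
    have "\<gamma> s' = \<gamma> t" using eq stepi[of s n] by (simp add: s'_def)
    have "s' = t"
    proof (rule ccontr)
      assume "s' \<noteq> t"
      then have lt: "t < s'" using n(1) by (simp add: s'_def)
      have "\<gamma> (0 + (s' - t)) = \<gamma> 0" by (rule per) (use lt \<open>\<gamma> s' = \<gamma> t\<close> in auto)
      then have "s' - t \<in> P" using lt by (intro PI) simp_all
      then show False using min n(2) by (force simp: s'_def)
    qed
    then have "s = t + of_int (- n) * \<tau>" by (simp add: s'_def)
    then show "\<exists>n::int. s = t + of_int n * \<tau>" by blast
  next
    assume "\<exists>n::int. s = t + of_int n * \<tau>"
    then show "\<gamma> s = \<gamma> t" using stepi by auto
  qed
  have "smooth_on UNIV \<gamma>" using \<gamma> by (simp add: unit_speed_def)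
  moreover have "vector_derivative \<gamma> (at t) \<noteq> 0" for t
  proof -
    have "norm (vector_derivative \<gamma> (at t)) = 1" using \<gamma> by (simp add: unit_speed_def)
    then show ?thesis by auto
  qed
  ultimately show ?thesis by (rule embedded_circle_range_periodic[OF _ _ \<tau>(1) iff])
qed

text \<open>Every point lies on a unit speed line whose image is its component, relatively open and a circle;
  compactness leaves finitely many components.\<close>

theorem compact_one_manifold_circle_union:
  assumes X: "compact X" and arcs: "\<And>p. p \<in> X \<Longrightarrow> interior_arc_point X p"
  shows "circle_union X"
proof -
  obtain \<epsilon> where R: "charts_of_radius X \<epsilon>" using charts_of_radius_exists[OF X arcs] by blast
  have comp: "\<exists>\<gamma>. unit_speed X UNIV \<gamma> \<and> C = range \<gamma>" if C: "C \<in> components X" for C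
  proof -
    obtain x where x: "x \<in> C" "x \<in> X" using in_components_nonempty[OF C] in_components_subset[OF C] by blast
    obtain \<gamma> where \<gamma>: "unit_speed X UNIV \<gamma>" "\<gamma> 0 = x" using unit_speed_line[OF R x(2)] by blast
    have "x \<in> range \<gamma>" using \<gamma>(2) by blast
    then have "C = range \<gamma>"
      using components_eq[OF C range_unit_speed_line(1)[OF R \<gamma>(1)]] x(1) by blast
    then show ?thesis using \<gamma>(1) by blast
  qed
  have "embedded_circle C" if "C \<in> components X" for C
    using comp[OF that] embedded_circle_range_unit_speed[OF X R] by blast
  moreover have "finite (components X)"
  proof -
    have "\<forall>C\<in>components X. \<exists>T. open T \<and> C = X \<inter> T"
    proof
      fix C assume "C \<in> components X"
      then obtain \<gamma> where "unit_speed X UNIV \<gamma>" "C = range \<gamma>" using comp by blast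
      then have "openin (top_of_set X) C" using range_unit_speed_line(2)[OF R] by simp
      then show "\<exists>T. open T \<and> C = X \<inter> T" unfolding openin_open .
    qed
    then obtain T where T: "\<forall>C\<in>components X. open (T C) \<and> C = X \<inter> T C"
      using bchoice[of "components X" "\<lambda>C T. open T \<and> C = X \<inter> T"] by blast
    have oT: "open (T C)" if "C \<in> components X" for C using T that by blast
    have CT: "x \<in> C \<longleftrightarrow> x \<in> T C" if "C \<in> components X" "x \<in> X" for C x using T that by blast
    have "X \<subseteq> (\<Union>C\<in>components X. T C)"
    proof
      fix x assume x: "x \<in> X"
      then have "x \<in> \<Union>(components X)" by simp
      then show "x \<in> (\<Union>C\<in>components X. T C)" using CT[OF _ x] by blast
    qed
    then obtain F where F: "F \<subseteq> components X" "finite F" "X \<subseteq> (\<Union>C\<in>F. T C)"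
      using compactE_image[where S=X and C="components X" and f=T] X oT by blast
    have "components X \<subseteq> F"
    proof
      fix C assume C: "C \<in> components X"
      obtain x where x: "x \<in> C" "x \<in> X" using in_components_nonempty[OF C] in_components_subset[OF C] by blast
      obtain D where D: "D \<in> F" "x \<in> T D" using F(3) x(2) by blast
      then have DX: "D \<in> components X" "x \<in> D" using CT[of D x] F(1) x(2) by blast+
      then have "C = D" using components_eq[OF C DX(1)] x(1) by blast
      then show "C \<in> F" using D(1) by simp
    qed
    then show ?thesis using F(2) finite_subset by blast
  qed
  ultimately show ?thesis unfolding circle_union_def by blast
qed

section \<open>The smoothed crossing\<close>

text \<open>This family is closed under differentiation up to linear combinations, which proves the smoothness
  of \<open>flat\<close> by induction.\<close>

definition flat_pow :: "nat \<Rightarrow> real \<Rightarrow> real" where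
  "flat_pow n t = (if 0 < t then inverse t ^ n * exp (- inverse t) else 0)"

lemma flat_eq_flat_pow: "flat = flat_pow 0"
  by (simp add: fun_eq_iff flat_def flat_pow_def divide_inverse)

text \<open>The exponential beats every power of \<open>1/t\<close>.\<close>

lemma flat_pow_tendsto_0: "(flat_pow n \<longlongrightarrow> 0) (at 0)"
proof (rule filterlim_split_at)
  have "eventually (\<lambda>t. flat_pow n t = 0) (at_left 0)"
    by (auto simp: eventually_at_filter flat_pow_def)
  then show "(flat_pow n \<longlongrightarrow> 0) (at_left 0)" by (rule tendsto_eventually)
  have "((\<lambda>x::real. x ^ n / exp x) \<longlongrightarrow> 0) at_top" by (rule tendsto_power_div_exp_0)
  then have "((\<lambda>t::real. inverse t ^ n / exp (inverse t)) \<longlongrightarrow> 0) (at_right 0)"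
    by (rule filterlim_compose[OF _ filterlim_inverse_at_top_right])
  moreover have "eventually (\<lambda>t. inverse t ^ n / exp (inverse t) = flat_pow n t) (at_right 0)"
    by (auto simp: eventually_at_filter flat_pow_def exp_minus divide_inverse)
  ultimately show "(flat_pow n \<longlongrightarrow> 0) (at_right 0)"
    by (rule Lim_transform_eventually)
qed

lemma flat_pow_has_derivative:
  "(flat_pow n has_real_derivative flat_pow (n + 2) t - real n * flat_pow (n + 1) t) (at t)"
proof -
  consider "t < 0" | "t = 0" | "0 < t" by linarith
  then show ?thesis
  proof cases
    case 1
    have "((\<lambda>_. 0) has_real_derivative 0) (at t)" by simp
    then have "(flat_pow n has_real_derivative 0) (at t)"
      by (rule has_field_derivative_transform_within_open[where S="{..<0}"]) (use 1 in \<open>auto simp: flat_pow_def\<close>)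
    then show ?thesis using 1 by (simp add: flat_pow_def)
  next
    case 2
    have "eventually (\<lambda>h. flat_pow (Suc n) h = (flat_pow n (0 + h) - flat_pow n 0) / h) (at 0)"
      by (auto simp: eventually_at_filter flat_pow_def divide_inverse)
    then have "(flat_pow n has_real_derivative 0) (at 0)"
      unfolding DERIV_def by (rule Lim_transform_eventually[OF flat_pow_tendsto_0])
    then show ?thesis using 2 by (simp add: flat_pow_def)
  next
    case 3
    let ?d = "real n * inverse t ^ (n - 1) * (- (inverse t * inverse t)) * exp (- inverse t)
        + inverse t ^ n * (exp (- inverse t) * (inverse t * inverse t))"
    have di: "(inverse has_real_derivative - (inverse t * inverse t)) (at t)"
      using DERIV_inverse[of t UNIV] 3 by (simp add: power2_eq_square)
    have "((\<lambda>t. inverse t ^ n * exp (- inverse t)) has_real_derivative ?d) (at t)"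
      by (rule derivative_eq_intros di refl | simp)+
    then have "(flat_pow n has_real_derivative ?d) (at t)"
      by (rule has_field_derivative_transform_within_open[where S="{0<..}"]) (use 3 in \<open>auto simp: flat_pow_def\<close>)
    moreover have "?d = flat_pow (n + 2) t - real n * flat_pow (n + 1) t"
      using 3 by (cases n) (simp_all add: flat_pow_def algebra_simps)
    ultimately show ?thesis by simp
  qed
qed

lemma smooth_on_flat_pow: "smooth_on UNIV (flat_pow n)"
proof -
  have "Ck_on k UNIV (flat_pow n)" for k n
  proof (induction k arbitrary: n)
    case 0
    have "isCont (flat_pow n) t" for t using DERIV_isCont[OF flat_pow_has_derivative] .
    then show ?case by (simp add: continuous_at_imp_continuous_on)
  next
    case (Suc k)
    have "Ck_on k UNIV (\<lambda>t. (- real n) * flat_pow (n + 1) t)"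
      by (rule Ck_on_bilinear[OF open_UNIV bounded_bilinear_mult Ck_on_const[OF open_UNIV] Suc])
    from Ck_on_add[OF open_UNIV Suc[of "n + 2"] this]
    have "Ck_on k UNIV (\<lambda>t. flat_pow (n + 2) t - real n * flat_pow (n + 1) t)" by simp
    then show ?case
      using Ck_on_Suc_vector_derivative[OF open_UNIV
          flat_pow_has_derivative[unfolded has_real_derivative_iff_has_vector_derivative]] by simp
  qed
  then show ?thesis by (simp add: smooth_on_def)
qed

lemma smooth_on_flat: "smooth_on UNIV flat"
  unfolding flat_eq_flat_pow by (rule smooth_on_flat_pow)

lemma flat_nonneg: "0 \<le> flat t" and flat_less_1: "flat t < 1" and flat_pos: "0 < t \<Longrightarrow> 0 < flat t"
  and flat_0: "t \<le> 0 \<Longrightarrow> flat t = 0"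
  by (auto simp: flat_def)

lemma flat_mono: "s \<le> t \<Longrightarrow> flat s \<le> flat t"
  by (auto simp: flat_def field_simps)

lemma flat_le: "t \<le> 2 \<Longrightarrow> flat t \<le> exp (- 1/2)"
  using flat_mono[of t 2] by (simp add: flat_def)

lemma flat_onto:
  assumes "exp (- 1/2) \<le> y" "y < 1"
  shows "\<exists>t\<ge>2. flat t = y"
proof (intro exI conjI)
  have y: "0 < y" using assms(1) by (meson exp_gt_zero less_le_trans)
  have l: "ln y < 0" using assms(2) y by simp
  have "- 1/2 \<le> ln y" using assms(1) y by (simp add: ln_ge_iff)
  then show "2 \<le> - 1 / ln y" using l by (simp add: field_simps)
  then show "flat (- 1 / ln y) = y" using y l by (simp add: flat_def)
qed

text \<open>One of the two arcs of the smoothing; the other is its negative.\<close>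

definition corner :: "nat \<Rightarrow> real \<Rightarrow> complex" where
  "corner k s = Complex (flat (1 + s)) (if k = 0 then - flat (1 - s) else flat (1 - s))"

lemma smoothing_eq: "smoothing k = range (corner k) \<union> uminus ` range (corner k)"
  unfolding smoothing_def corner_def Let_def by simp

definition corner_sign :: "nat \<Rightarrow> real" where
  "corner_sign k = (if k = 0 then -1 else 1)"

lemma corner_coords:
  "Re (corner k s) = flat (1 + s)" "Im (corner k s) = corner_sign k * flat (1 - s)"
  by (simp_all add: corner_def corner_sign_def)

lemma corner_sign: "corner_sign k \<in> {1, -1}" "corner_sign k * (corner_sign k * x) = x"
  by (simp_all add: corner_sign_def)

text \<open>The coordinate \<open>Re z - corner_sign k * Im z\<close> along the arc. It is linear in \<open>z\<close> and strictly
  increasing in the parameter, so its inverse reparametrises the arc with a linear left inverse.\<close>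

definition corner_param :: "real \<Rightarrow> real" where
  "corner_param s = flat (1 + s) - flat (1 - s)"

lemma corner_param_eq: "Re (corner k s) - corner_sign k * Im (corner k s) = corner_param s"
  by (simp add: corner_coords corner_sign corner_param_def)

lemma smooth_on_corner_param: "smooth_on UNIV corner_param"
  and corner_param_derivative:
    "(corner_param has_real_derivative flat_pow 2 (1 + s) + flat_pow 2 (1 - s)) (at s)"
  and smooth_on_corner: "smooth_on UNIV (corner k)"
proof -
  have 1: "smooth_on UNIV (\<lambda>s. flat (1 + s))"
    by (rule smooth_on_compose[OF smooth_on_add[OF smooth_on_const smooth_on_ident] smooth_on_flat]) auto
  have 2: "smooth_on UNIV (\<lambda>s. flat (1 - s))"
    by (rule smooth_on_compose[OF smooth_on_diff[OF smooth_on_const smooth_on_ident] smooth_on_flat]) auto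
  show "smooth_on UNIV corner_param"
    unfolding corner_param_def[abs_def] by (rule smooth_on_diff[OF 1 2])
  have d: "(flat has_real_derivative flat_pow 2 t) (at t)" for t
    using flat_pow_has_derivative[of 0 t] by (simp add: flat_eq_flat_pow numeral_2_eq_2)
  have "((\<lambda>s. flat (1 + s)) has_real_derivative flat_pow 2 (1 + s) * 1) (at s)"
    by (rule DERIV_chain2[OF d]) (auto intro!: derivative_eq_intros)
  moreover have "((\<lambda>s. flat (1 - s)) has_real_derivative flat_pow 2 (1 - s) * (-1)) (at s)"
    by (rule DERIV_chain2[OF d]) (auto intro!: derivative_eq_intros)
  ultimately have "((\<lambda>s. flat (1 + s) - flat (1 - s)) has_real_derivative
      flat_pow 2 (1 + s) * 1 - flat_pow 2 (1 - s) * (-1)) (at s)" by (rule DERIV_diff)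
  then show "(corner_param has_real_derivative flat_pow 2 (1 + s) + flat_pow 2 (1 - s)) (at s)"
    unfolding corner_param_def[abs_def] by simp
  have "corner k s = flat (1 + s) *\<^sub>R 1 + flat (1 - s) *\<^sub>R (of_real (corner_sign k) * \<i>)" for s
    by (simp add: complex_eq_iff corner_coords)
  then have "corner k = (\<lambda>s. flat (1 + s) *\<^sub>R 1 + flat (1 - s) *\<^sub>R (of_real (corner_sign k) * \<i>))" by auto
  moreover have "smooth_on UNIV (\<lambda>s. flat (1 + s) *\<^sub>R (1::complex) + flat (1 - s) *\<^sub>R (of_real (corner_sign k) * \<i>))"
    by (rule smooth_on_add[OF smooth_on_scaleR[OF 1 smooth_on_const] smooth_on_scaleR[OF 2 smooth_on_const]]) auto
  ultimately show "smooth_on UNIV (corner k)" by simp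
qed

lemma corner_param_derivative_pos: "0 < flat_pow 2 (1 + s) + flat_pow 2 (1 - s)"
  by (auto simp: flat_pow_def add_pos_pos)

lemma corner_param_strict_mono: "s < t \<Longrightarrow> corner_param s < corner_param t"
  by (rule DERIV_pos_imp_increasing) (use corner_param_derivative corner_param_derivative_pos in blast)+

lemma corner_param_range: "range corner_param = {-1<..<1}"
proof
  show "range corner_param \<subseteq> {-1<..<1}"
  proof (rule image_subsetI)
    fix s show "corner_param s \<in> {-1<..<1}"
      using flat_nonneg[of "1+s"] flat_nonneg[of "1-s"] flat_less_1[of "1+s"] flat_less_1[of "1-s"]
      by (simp add: corner_param_def)
  qed
  show "{-1<..<1} \<subseteq> range corner_param"
  proof
    fix u :: real assume u: "u \<in> {-1<..<1}"
    define y where "y = max \<bar>u\<bar> (exp (- 1/2))"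
    have "exp (- 1/2) < (1::real)" by simp
    then have y: "exp (- 1/2) \<le> y" "y < 1" "\<bar>u\<bar> \<le> y" using u by (auto simp: y_def)
    obtain t where t: "2 \<le> t" "flat t = y" using flat_onto[OF y(1,2)] by blast
    have "corner_param (t - 1) = y" "corner_param (-(t - 1)) = - y" using t by (simp_all add: corner_param_def flat_0)
    moreover have "continuous_on {-(t-1)..t-1} corner_param"
      by (rule continuous_on_subset[OF smooth_on_imp_continuous_on[OF smooth_on_corner_param]]) simp
    moreover have "- y \<le> u" "u \<le> y" "-(t-1) \<le> t - 1" using y(3) t(1) by auto
    ultimately obtain s where "corner_param s = u"
      using IVT'[of corner_param "-(t-1)" u "t-1"] by force
    then show "u \<in> range corner_param" by blast
  qed
qed

lemma corner_param_inverse: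
  obtains \<kappa> where "smooth_on {-1<..<1} \<kappa>" "\<And>u. u \<in> {-1<..<1} \<Longrightarrow> corner_param (\<kappa> u) = u"
    "\<And>s. \<kappa> (corner_param s) = s"
proof -
  have inj: "inj corner_param"
    by (rule linorder_injI) (use corner_param_strict_mono in force)
  let ?k = "inv corner_param"
  have k1: "?k (corner_param s) = s" for s by (rule inv_f_f[OF inj])
  have k2: "corner_param (?k u) = u" if "u \<in> {-1<..<1}" for u
    by (rule f_inv_into_f) (use that corner_param_range in blast)
  have "smooth_on {-1<..<1} ?k"
  proof (rule smooth_on_local)
    fix u :: real assume u: "u \<in> {-1<..<1}"
    define s where "s = ?k u"
    have s: "corner_param s = u" using k2[OF u] by (simp add: s_def)
    have "vector_derivative corner_param (at s) = flat_pow 2 (1 + s) + flat_pow 2 (1 - s)"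
      by (rule vector_derivative_at) (use corner_param_derivative in \<open>simp add: has_real_derivative_iff_has_vector_derivative\<close>)
    then have pos: "0 < vector_derivative corner_param (at s)" using corner_param_derivative_pos by simp
    obtain d e k where k: "0 < e" "smooth_on {corner_param s - e<..<corner_param s + e} k"
      "\<And>y. \<bar>y - corner_param s\<bar> < e \<Longrightarrow> corner_param (k y) = y"
      by (rule local_inverse_real[OF smooth_on_corner_param UNIV_I pos]) (rule that)
    have "smooth_on {corner_param s - e<..<corner_param s + e} ?k"
    proof (rule smooth_on_cong[OF k(2)])
      fix y assume "y \<in> {corner_param s - e<..<corner_param s + e}"
      then have "corner_param (k y) = y" by (intro k(3)) auto
      then show "k y = ?k y" using k1[of "k y"] by simp
    qed
    then show "\<exists>V. u \<in> V \<and> smooth_on V ?k" using s k(1) by (intro exI[of _ "{corner_param s - e<..<corner_param s + e}"]) simp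
  qed simp
  then show thesis by (rule that[OF _ k2 k1])
qed

lemma diffeo_uminus_image:
  assumes "diffeo X Y f" shows "diffeo X (uminus ` Y) (\<lambda>x. - f x)"
proof -
  have sm: "smooth_map A (uminus :: 'b \<Rightarrow> 'b)" for A
    by (rule smooth_on_imp_smooth_map[OF smooth_on_minus[OF smooth_on_ident[OF open_UNIV]]]) simp
  have "diffeo Y (uminus ` Y) uminus"
    by (rule diffeoI[where g=uminus]) (auto simp: sm)
  from diffeo_compose[OF assms this] show ?thesis .
qed

lemma corner_diffeo: "\<exists>g. diffeo {-1<..<1::real} (range (corner k)) g"
proof -
  obtain \<kappa> where \<kappa>: "smooth_on {-1<..<1} \<kappa>" "\<And>u. u \<in> {-1<..<1} \<Longrightarrow> corner_param (\<kappa> u) = u"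
    "\<And>s. \<kappa> (corner_param s) = s" by (rule corner_param_inverse) (rule that)
  let ?g = "\<lambda>z. Re z - corner_sign k * Im z"
  have "bounded_linear ?g"
    by (intro bounded_linear_sub bounded_linear_Re bounded_linear_const_mult bounded_linear_Im)
  then have g: "smooth_map (range (corner k)) ?g"
    by (rule smooth_on_imp_smooth_map[OF smooth_on_bounded_linear[OF open_UNIV]]) simp
  have "smooth_on {-1<..<1} (\<lambda>u. corner k (\<kappa> u))"
    by (rule smooth_on_compose[OF \<kappa>(1) smooth_on_corner]) simp
  then have f: "smooth_map {-1<..<1} (\<lambda>u. corner k (\<kappa> u))"
    by (rule smooth_on_imp_smooth_map) simp
  have "diffeo {-1<..<1} (range (corner k)) (\<lambda>u. corner k (\<kappa> u))"
  proof (rule diffeoI[OF f g])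
    show "?g ` range (corner k) \<subseteq> {-1<..<1}"
      using corner_param_range by (auto simp: corner_param_eq)
    show "?g (corner k (\<kappa> u)) = u" if "u \<in> {-1<..<1}" for u
      using \<kappa>(2)[OF that] by (simp add: corner_param_eq)
    show "corner k (\<kappa> (?g z)) = z" if "z \<in> range (corner k)" for z
      using that \<kappa>(3) by (auto simp: corner_param_eq)
  qed auto
  then show ?thesis by blast
qed

text \<open>The two arcs lie on the two sides of the line \<open>Re z + corner_sign k * Im z = 0\<close>, so each of them is
  relatively open in the smoothing.\<close>

lemma smoothing_interior_arc_point:
  assumes "z \<in> smoothing k" shows "interior_arc_point (smoothing k) z"
proof -
  let ?A = "range (corner k)" and ?l = "\<lambda>z. Re z + corner_sign k * Im z"
  have c: "continuous_on UNIV ?l" by (intro continuous_intros)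
  have o: "open (?l -` {0<..})" "open (?l -` {..<0})"
    by (rule open_vimage[OF _ c], simp)+
  have pos: "0 < ?l (corner k s)" for s
    using flat_pos[of "1+s"] flat_pos[of "1-s"] flat_nonneg[of "1+s"] flat_nonneg[of "1-s"]
    by (cases "0 < 1 + s") (auto simp: corner_coords corner_sign intro: add_pos_nonneg add_nonneg_pos)
  have neg: "?l (- w) = - ?l w" for w by simp
  have i1: "smoothing k \<inter> ?l -` {0<..} = ?A"
  proof
    show "smoothing k \<inter> ?l -` {0<..} \<subseteq> ?A"
    proof
      fix w assume w: "w \<in> smoothing k \<inter> ?l -` {0<..}"
      have False if "w = - corner k s" for s using w pos[of s] neg[of "corner k s"] that by simp
      then show "w \<in> ?A" using w unfolding smoothing_eq by blast
    qed
    show "?A \<subseteq> smoothing k \<inter> ?l -` {0<..}" using pos unfolding smoothing_eq by blast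
  qed
  have i2: "smoothing k \<inter> ?l -` {..<0} = uminus ` ?A"
  proof
    show "smoothing k \<inter> ?l -` {..<0} \<subseteq> uminus ` ?A"
    proof
      fix w assume w: "w \<in> smoothing k \<inter> ?l -` {..<0}"
      have False if "w = corner k s" for s using w pos[of s] that by simp
      then show "w \<in> uminus ` ?A" using w unfolding smoothing_eq by blast
    qed
    show "uminus ` ?A \<subseteq> smoothing k \<inter> ?l -` {..<0}"
    proof (rule image_subsetI)
      fix w assume "w \<in> ?A"
      then obtain s where "w = corner k s" by blast
      then show "- w \<in> smoothing k \<inter> ?l -` {..<0}"
        using pos[of s] neg[of w] unfolding smoothing_eq by simp
    qed
  qed
  obtain g where g: "diffeo {-1<..<1::real} ?A g" using corner_diffeo by blast
  consider "z \<in> ?A" | "z \<in> uminus ` ?A" using assms unfolding smoothing_eq by blast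
  then show ?thesis
  proof cases
    case 1
    then have "z \<in> ?l -` {0<..}" using i1 by blast
    moreover have "diffeo {-1<..<1::real} (smoothing k \<inter> ?l -` {0<..}) g" using g i1 by simp
    ultimately show ?thesis unfolding interior_arc_point_def using o(1) by blast
  next
    case 2
    then have "z \<in> ?l -` {..<0}" using i2 by blast
    moreover have "diffeo {-1<..<1::real} (smoothing k \<inter> ?l -` {..<0}) (\<lambda>x. - g x)"
      using diffeo_uminus_image[OF g] i2 by simp
    ultimately show ?thesis unfolding interior_arc_point_def using o(2) by blast
  qed
qed

lemma corner_norm_middle:
  assumes "\<bar>s\<bar> < 1" shows "(norm (corner k s))\<^sup>2 \<le> 2 * exp (-1)"
proof -
  have "exp (- 1/2) * exp (- 1/2) = (exp (-1) :: real)" by (simp flip: exp_add)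
  moreover have "flat (1 + s) * flat (1 + s) \<le> exp (- 1/2) * exp (- 1/2)"
    "flat (1 - s) * flat (1 - s) \<le> exp (- 1/2) * exp (- 1/2)"
    using assms by (intro mult_mono flat_le flat_nonneg; simp)+
  moreover have "(norm (corner k s))\<^sup>2 = flat (1 + s) * flat (1 + s) + flat (1 - s) * flat (1 - s)"
  proof -
    have "(norm (corner k s))\<^sup>2 = (flat (1 + s))\<^sup>2 + (corner_sign k * flat (1 - s))\<^sup>2"
      by (simp add: cmod_power2 corner_coords)
    then show ?thesis using corner_sign(1)[of k] by (auto simp: power2_eq_square)
  qed
  ultimately show ?thesis by linarith
qed

lemma corner_norm_ends:
  "1 \<le> s \<Longrightarrow> norm (corner k s) = flat (1 + s)" "1 \<le> s \<Longrightarrow> Im (corner k s) = 0"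
  "s \<le> -1 \<Longrightarrow> norm (corner k s) = flat (1 - s)" "s \<le> -1 \<Longrightarrow> Re (corner k s) = 0"
  using flat_nonneg[of "1+s"] flat_nonneg[of "1-s"] corner_sign(1)[of k]
  by (auto simp: cmod_def corner_coords flat_0)

text \<open>For \<open>\<bar>s\<bar> < 1\<close> both coordinates of the arc are at most \<open>exp (- 1/2)\<close>, so outside this radius only
  the parts on the axes remain and the smoothing is the original cross.\<close>

definition smoothing_radius :: real where
  "smoothing_radius = sqrt (2 * exp (-1))"

lemma smoothing_radius: "0 < smoothing_radius" "smoothing_radius < 1" "exp (- 1/2) < smoothing_radius"
proof -
  show "0 < smoothing_radius" by (simp add: smoothing_radius_def)
  have "2 < exp (1::real)" using exp_lower_Taylor_quadratic[of "1::real"] by simp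
  then have "2 * exp (-1) < (1::real)" by (simp add: exp_minus field_simps)
  then show "smoothing_radius < 1" by (simp add: smoothing_radius_def)
  have "exp (- 1/2) = sqrt (exp (-1) :: real)"
    by (rule real_sqrt_unique[symmetric]) (simp_all add: power2_eq_square flip: exp_add)
  then show "exp (- 1/2) < smoothing_radius" by (simp add: smoothing_radius_def)
qed

lemma smoothing_in_ball: "smoothing k \<subseteq> ball 0 1"
proof -
  have "norm (corner k s) < 1" for s
  proof -
    consider "\<bar>s\<bar> < 1" | "1 \<le> s" | "s \<le> -1" by linarith
    then show ?thesis
    proof cases
      case 1
      have "(norm (corner k s))\<^sup>2 \<le> smoothing_radius\<^sup>2"
        using corner_norm_middle[OF 1] by (simp add: smoothing_radius_def)
      then have "norm (corner k s) \<le> smoothing_radius"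
        using smoothing_radius(1) by (simp add: power2_le_iff_abs_le)
      then show ?thesis using smoothing_radius(2) by simp
    qed (simp_all add: corner_norm_ends flat_less_1)
  qed
  then show ?thesis unfolding smoothing_eq by auto
qed

lemma smoothing_outside_radius:
  assumes "smoothing_radius < norm z" "norm z < 1"
  shows "z \<in> smoothing k \<longleftrightarrow> Re z = 0 \<or> Im z = 0"
proof
  assume "z \<in> smoothing k"
  then obtain s where s: "z = corner k s \<or> z = - corner k s" unfolding smoothing_eq by blast
  then have n: "norm (corner k s) = norm z" by auto
  have "1 \<le> \<bar>s\<bar>"
  proof (rule ccontr)
    assume "\<not> 1 \<le> \<bar>s\<bar>"
    then have "(norm z)\<^sup>2 \<le> smoothing_radius\<^sup>2"
      using corner_norm_middle[of s k] n by (simp add: smoothing_radius_def)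
    then show False using assms(1) smoothing_radius(1) by (simp add: power2_le_iff_abs_le)
  qed
  then have "1 \<le> s \<or> s \<le> -1" by linarith
  then show "Re z = 0 \<or> Im z = 0" using corner_norm_ends(2,4)[of s k] s by auto
next
  assume ax: "Re z = 0 \<or> Im z = 0"
  have "exp (- 1/2) \<le> norm z" using smoothing_radius(3) assms(1) by simp
  then obtain t where t: "2 \<le> t" "flat t = norm z" using flat_onto[of "norm z"] assms(2) by blast
  have a: "corner k (t - 1) = of_real (norm z)" "corner k (1 - t) = of_real (corner_sign k * norm z) * \<i>"
    using t by (simp_all add: complex_eq_iff corner_coords flat_0)
  have in1: "w \<in> smoothing k" "- w \<in> smoothing k" if "w = corner k s" for w s
    using that unfolding smoothing_eq by auto
  from ax show "z \<in> smoothing k"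
  proof
    assume r: "Re z = 0"
    then have "norm z = \<bar>Im z\<bar>" by (simp add: cmod_def)
    then have "z = corner k (1 - t) \<or> z = - corner k (1 - t)"
      using r corner_sign(1)[of k] unfolding a(2) by (auto simp: complex_eq_iff abs_if split: if_splits)
    then show ?thesis using in1[OF refl] by metis
  next
    assume r: "Im z = 0"
    then have "norm z = \<bar>Re z\<bar>" by (simp add: cmod_def)
    then have "z = corner k (t - 1) \<or> z = - corner k (t - 1)"
      using r unfolding a(1) by (auto simp: complex_eq_iff abs_if split: if_splits)
    then show ?thesis using in1[OF refl] by metis
  qed
qed

text \<open>The ends of the arcs approach the unit circle, so a smaller disc only meets a compact range of
  parameters.\<close>

lemma compact_smoothing_Int_cball:
  assumes "r < 1" shows "compact (smoothing k \<inter> cball 0 r)"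
proof -
  define y where "y = max ((r + 1) / 2) (exp (- 1/2))"
  have "exp (- 1/2) < (1::real)" by simp
  then have y: "exp (- 1/2) \<le> y" "y < 1" "(r + 1) / 2 \<le> y" using assms by (auto simp: y_def)
  have ry: "r < y" using y(3) assms by simp
  obtain t where t: "2 \<le> t" "flat t = y" using flat_onto[OF y(1,2)] by blast
  let ?C = "corner k ` {-(t-1)..t-1}"
  have "compact ?C"
    by (rule compact_continuous_image[OF continuous_on_subset[OF smooth_on_imp_continuous_on[OF smooth_on_corner]]]) auto
  then have "compact ((?C \<union> uminus ` ?C) \<inter> cball 0 r)"
    by (intro compact_Int_closed compact_Un compact_negations) auto
  moreover have in_C: "corner k s \<in> ?C" if "norm (corner k s) \<le> r" for s
  proof (rule imageI, rule ccontr)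
    assume "s \<notin> {-(t-1)..t-1}"
    then have "t - 1 < s \<or> s < -(t-1)" by auto
    then have "y \<le> norm (corner k s)"
    proof
      assume "t - 1 < s"
      then show ?thesis using flat_mono[of t "1+s"] t corner_norm_ends(1)[of s k] by simp
    next
      assume "s < -(t-1)"
      then show ?thesis using flat_mono[of t "1-s"] t corner_norm_ends(3)[of s k] by simp
    qed
    then show False using that ry by simp
  qed
  have "smoothing k \<inter> cball 0 r = (?C \<union> uminus ` ?C) \<inter> cball 0 r"
    unfolding smoothing_eq using in_C by auto
  ultimately show ?thesis by simp
qed

section \<open>Resolving crossings of link diagrams\<close>

text \<open>Invariance of domain on the sphere: near a point, remove its antipode and identify the punctured
  sphere with a plane.\<close>

lemma openin_sphere_image:
  fixes f :: "complex \<Rightarrow> point"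
  assumes V: "open V" and f: "continuous_on V f" "inj_on f V" "f ` V \<subseteq> S2"
  shows "openin (top_of_set S2) (f ` V)"
proof (subst openin_subopen, rule ballI)
  fix p assume p: "p \<in> f ` V"
  then have pS: "p \<in> S2" "- p \<in> S2" using f(3) by auto
  have pn: "p \<noteq> - p"
  proof
    assume "p = - p"
    then have "2 *\<^sub>R p = 0" by (simp add: scaleR_2)
    then show False using pS(1) by simp
  qed
  let ?c = "axis 1 1 :: point"
  have c: "?c \<noteq> 0" by simp
  have "(S2 - {- p}) homeomorphic {x. ?c \<bullet> x = 0}"
    by (rule homeomorphic_punctured_sphere_hyperplane[OF _ pS(2) c]) simp
  then obtain h k where hk: "homeomorphism (S2 - {- p}) {x. ?c \<bullet> x = 0} h k"
    unfolding homeomorphic_def by blast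
  let ?V = "V \<inter> f -` (- {- p})"
  have oV: "open ?V" by (rule continuous_open_preimage[OF f(1) V]) auto
  have fV: "f ` ?V \<subseteq> S2 - {- p}" using f(3) by auto
  have cf: "continuous_on ?V f" by (rule continuous_on_subset[OF f(1)]) auto
  have "openin (top_of_set {x. ?c \<bullet> x = 0}) ((h \<circ> f) ` ?V)"
  proof (rule invariance_of_domain_affine_sets[where U="UNIV :: complex set"])
    show "openin (top_of_set (UNIV :: complex set)) ?V" using oV by simp
    show "aff_dim {x::point. ?c \<bullet> x = 0} \<le> aff_dim (UNIV :: complex set)"
      using c by (simp add: aff_dim_hyperplane)
    show "continuous_on ?V (h \<circ> f)"
      by (rule continuous_on_compose[OF cf continuous_on_subset[OF _ fV]])
         (use hk in \<open>simp add: homeomorphism_def\<close>)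
    show "h \<circ> f \<in> ?V \<rightarrow> {x. ?c \<bullet> x = 0}"
    proof
      fix z assume "z \<in> ?V"
      then have "f z \<in> S2 - {- p}" using fV by blast
      then show "(h \<circ> f) z \<in> {x. ?c \<bullet> x = 0}" using hk unfolding homeomorphism_def by auto
    qed
    show "inj_on (h \<circ> f) ?V"
    proof (rule comp_inj_on)
      show "inj_on f ?V" by (rule inj_on_subset[OF f(2)]) auto
      have "inj_on h (S2 - {- p})" by (rule inj_on_inverseI[of _ k]) (use hk in \<open>auto simp: homeomorphism_def\<close>)
      then show "inj_on h (f ` ?V)" by (rule inj_on_subset[OF _ fV])
    qed
  qed (simp_all add: affine_hyperplane)
  then have "openin (top_of_set (S2 - {- p})) (k ` ((h \<circ> f) ` ?V))"
    by (rule homeomorphism_imp_open_map[OF homeomorphism_symD[OF hk]])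
  moreover have "k ` ((h \<circ> f) ` ?V) = f ` ?V"
  proof -
    have "k (h x) = x" if "x \<in> f ` ?V" for x
      by (rule homeomorphism_apply1[OF hk subsetD[OF fV that]])
    then have "(\<lambda>x. k (h x)) ` (f ` ?V) = (\<lambda>x. x) ` (f ` ?V)" by (rule image_cong[OF refl])
    then show ?thesis by (simp only: image_image o_def image_ident)
  qed
  ultimately have "openin (top_of_set (S2 - {- p})) (f ` ?V)" by simp
  moreover have "openin (top_of_set S2) (S2 - {- p})" using pS by (intro openin_diff) auto
  ultimately have "openin (top_of_set S2) (f ` ?V)" by (rule openin_trans)
  moreover have "p \<in> f ` ?V" using p pn by auto
  ultimately show "\<exists>T. openin (top_of_set S2) T \<and> p \<in> T \<and> T \<subseteq> f ` V" by blast
qed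

lemma unit_chart_imp_diffeo:
  assumes c: "unit_chart X {-r<..<r} \<gamma> U G" and r: "0 < r"
  shows "diffeo {-1<..<1::real} (X \<inter> U) (\<lambda>t. \<gamma> (r * t))"
proof -
  have G: "smooth_map (X \<inter> U) G" "\<gamma> ` {-r<..<r} = X \<inter> U" "\<And>s. s \<in> {-r<..<r} \<Longrightarrow> G (\<gamma> s) = s"
    and \<gamma>: "smooth_on {-r<..<r} \<gamma>" using c by (auto simp: unit_chart_def unit_speed_def)
  have sc: "r * t \<in> {-r<..<r}" if "t \<in> {-1<..<1}" for t
  proof -
    have "r * -1 < r * t" by (rule mult_strict_left_mono[OF _ r]) (use that in simp)
    moreover have "r * t < r * 1" by (rule mult_strict_left_mono[OF _ r]) (use that in simp)
    ultimately show ?thesis by (simp only: greaterThanLessThan_iff mult_1_right mult_minus1_right simp_thms)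
  qed
  have Gr: "G x / r \<in> {-1<..<1} \<and> \<gamma> (r * (G x / r)) = x" if xU: "x \<in> X \<inter> U" for x
  proof -
    obtain s where s: "s \<in> {-r<..<r}" "x = \<gamma> s" using G(2) xU by blast
    then have "G x = s" using G(3) by simp
    moreover have "s / r < 1" "-1 < s / r" "r * (s / r) = s"
      using s(1) r by (simp_all add: pos_divide_less_eq pos_less_divide_eq)
    ultimately show ?thesis using s(2) by simp
  qed
  have sm1: "smooth_on {-1<..<1} (\<lambda>t. r * t)"
    by (rule smooth_on_bounded_linear[OF _ bounded_linear_mult_right]) simp
  have "smooth_on {-1<..<1} (\<lambda>t. \<gamma> (r * t))"
    by (rule smooth_on_compose[OF sm1 \<gamma>]) (use sc in blast)
  then have f: "smooth_map {-1<..<1} (\<lambda>t. \<gamma> (r * t))" by (rule smooth_on_imp_smooth_map) simp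
  have "smooth_map UNIV (\<lambda>y::real. y / r)"
    by (rule smooth_on_imp_smooth_map[OF smooth_on_bounded_linear[OF open_UNIV bounded_linear_divide]]) simp
  then have g: "smooth_map (X \<inter> U) (\<lambda>x. G x / r)"
    using smooth_map_compose[OF G(1), of UNIV "\<lambda>y. y / r"] by simp
  show ?thesis
  proof (rule diffeoI[OF f g])
    show "(\<lambda>t. \<gamma> (r * t)) ` {-1<..<1} \<subseteq> X \<inter> U" using sc G(2) by blast
    show "(\<lambda>x. G x / r) ` (X \<inter> U) \<subseteq> {-1<..<1}" using Gr by blast
    show "G (\<gamma> (r * t)) / r = t" if "t \<in> {-1<..<1}" for t using G(3)[OF sc[OF that]] r by simp
    show "\<gamma> (r * (G y / r)) = y" if "y \<in> X \<inter> U" for y using Gr[OF that] by blast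
  qed
qed

text \<open>Being a one-dimensional manifold near \<open>p\<close> depends only on the germ of the set at \<open>p\<close>. The piece of
  the chart that fits into \<open>W\<close> is centred by a unit speed parametrisation and then rescaled.\<close>

lemma interior_arc_point_local:
  assumes X: "interior_arc_point X p" "p \<in> X" and W: "open W" "p \<in> W" "X \<inter> W = Y \<inter> W"
  shows "interior_arc_point Y p"
proof -
  obtain a \<gamma> U G where a: "0 < a" and c: "unit_chart X {-a<..<a} \<gamma> U G" "\<gamma> 0 = p"
    using unit_chart_exists[OF X] by blast
  have \<gamma>: "smooth_on {-a<..<a} \<gamma>" using c(1) by (simp add: unit_chart_def unit_speed_def)
  have "open ({-a<..<a} \<inter> \<gamma> -` W)"
    by (rule continuous_open_preimage[OF smooth_on_imp_continuous_on[OF \<gamma>] _ W(1)]) simp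
  moreover have "0 \<in> {-a<..<a} \<inter> \<gamma> -` W" using a c(2) W(2) by simp
  ultimately obtain r where r: "0 < r" "ball 0 r \<subseteq> {-a<..<a} \<inter> \<gamma> -` W" by (rule openE)
  have rI: "{-r<..<r} \<subseteq> {-a<..<a} \<inter> \<gamma> -` W" using r(2) by (simp add: ball_eq_greaterThanLessThan)
  then have "{0-r<..<0+r} \<subseteq> {-a<..<a}" by auto
  from unit_chart_restrict[OF c(1) this]
  obtain V where V: "unit_chart X {-r<..<r} \<gamma> V G" by auto
  have "\<gamma> ` {-r<..<r} = X \<inter> V" "open V" using V by (simp_all add: unit_chart_def)
  have "\<gamma> ` {-r<..<r} \<subseteq> W"
    by (rule image_subsetI) (use rI in blast)
  then have "X \<inter> V \<subseteq> W" unfolding \<open>\<gamma> ` {-r<..<r} = X \<inter> V\<close> .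
  then have "X \<inter> V = Y \<inter> (V \<inter> W)" using W(3) by blast
  then have d: "diffeo {-1<..<1::real} (Y \<inter> (V \<inter> W)) (\<lambda>t. \<gamma> (r * t))"
    using unit_chart_imp_diffeo[OF V r(1)] by simp
  have "\<gamma> 0 \<in> \<gamma> ` {-r<..<r}" by (rule imageI) (use r(1) in simp)
  then have p: "p \<in> V \<inter> W" unfolding \<open>\<gamma> ` {-r<..<r} = X \<inter> V\<close> using c(2) W(2) by simp
  have "open (V \<inter> W)" using \<open>open V\<close> W(1) by (rule open_Int)
  then show ?thesis unfolding interior_arc_point_def using p d by (intro exI conjI)
qed

lemma link_diagram_compact: "link_diagram L \<Longrightarrow> compact (curve L)"
  and link_diagram_finite: "link_diagram L \<Longrightarrow> finite (crossings L)"
  and link_diagram_sphere: "link_diagram L \<Longrightarrow> curve L \<subseteq> S2"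
  unfolding link_diagram_def diagram_in_def by (elim conjE, assumption)+

lemma link_diagram_arc:
  assumes "link_diagram L" "p \<in> curve L" "p \<notin> crossings L"
  shows "interior_arc_point (curve L) p"
proof -
  have "\<forall>p\<in>curve L \<inter> S2 - crossings L. interior_arc_point (curve L) p"
    using assms(1) unfolding link_diagram_def diagram_in_def by (elim conjE)
  moreover have "p \<in> curve L \<inter> S2 - crossings L"
    using assms(2,3) link_diagram_sphere[OF assms(1)] by blast
  ultimately show ?thesis by (rule bspec)
qed

lemma link_diagram_chart:
  assumes "link_diagram L" "c \<in> crossings L"
  shows "diffeo (cball 0 1) (chart L c ` cball 0 1) (chart L c)"
    "chart L c ` cball 0 1 \<subseteq> S2" "inj_on (chart L c) (cball 0 1)"
    "continuous_on (cball 0 1) (chart L c)" "chart L c 0 = c" "oriented_chart (chart L c)"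
    "curve L \<inter> chart L c ` cball 0 1 = chart L c ` {z \<in> cball 0 1. Re z = 0 \<or> Im z = 0}"
proof -
  have "\<forall>c\<in>crossings L. oriented_chart (chart L c) \<and> chart L c ` cball 0 1 \<subseteq> S2 \<and> chart L c 0 = c \<and>
      curve L \<inter> chart L c ` cball 0 1 = chart L c ` {z \<in> cball 0 1. Re z = 0 \<or> Im z = 0}"
    using assms(1) unfolding link_diagram_def diagram_in_def by (elim conjE)
  note D = bspec[OF this assms(2)]
  show o: "oriented_chart (chart L c)" by (rule D[THEN conjunct1])
  show "chart L c ` cball 0 1 \<subseteq> S2" by (rule D[THEN conjunct2, THEN conjunct1])
  show "chart L c 0 = c" by (rule D[THEN conjunct2, THEN conjunct2, THEN conjunct1])
  show "curve L \<inter> chart L c ` cball 0 1 = chart L c ` {z \<in> cball 0 1. Re z = 0 \<or> Im z = 0}"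
    by (rule D[THEN conjunct2, THEN conjunct2, THEN conjunct2])
  show d: "diffeo (cball 0 1) (chart L c ` cball 0 1) (chart L c)"
    using o by (simp add: oriented_chart_def)
  then show "inj_on (chart L c) (cball 0 1)" by (simp add: diffeo_def bij_betw_def)
  show "continuous_on (cball 0 1) (chart L c)"
    by (rule smooth_map_continuous_on) (use d in \<open>simp add: diffeo_def\<close>)
qed

lemma link_diagram_chart_on_curve:
  assumes L: "link_diagram L" "c \<in> crossings L" and z: "norm z \<le> 1"
  shows "chart L c z \<in> curve L \<longleftrightarrow> Re z = 0 \<or> Im z = 0"
proof
  assume "chart L c z \<in> curve L"
  then have "chart L c z \<in> chart L c ` {z \<in> cball 0 1. Re z = 0 \<or> Im z = 0}"
    using link_diagram_chart(7)[OF L] z by auto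
  then obtain w where w: "chart L c z = chart L c w" "w \<in> cball 0 1" "Re w = 0 \<or> Im w = 0" by blast
  then have "z = w" using inj_onD[OF link_diagram_chart(3)[OF L]] z by simp
  then show "Re z = 0 \<or> Im z = 0" using w by simp
next
  assume "Re z = 0 \<or> Im z = 0"
  then have "chart L c z \<in> chart L c ` {z \<in> cball 0 1. Re z = 0 \<or> Im z = 0}" using z by simp
  then show "chart L c z \<in> curve L" using link_diagram_chart(7)[OF L] by blast
qed

lemma link_diagram_charts_disjoint:
  assumes "link_diagram L" "c \<in> crossings L" "d \<in> crossings L" "norm z \<le> 1" "norm w \<le> 1"
    "chart L c z = chart L d w"
  shows "c = d" "z = w"
proof -
  show "c = d"
  proof (rule ccontr)
    assume "c \<noteq> d"
    then have "chart L c ` cball 0 1 \<inter> chart L d ` cball 0 1 = {}"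
      using assms(1-3) unfolding link_diagram_def diagram_in_def by blast
    moreover have "chart L c z \<in> chart L c ` cball 0 1" "chart L d w \<in> chart L d ` cball 0 1"
      using assms(4,5) by auto
    ultimately show False using assms(6) by auto
  qed
  then show "z = w"
    using inj_onD[OF link_diagram_chart(3)[OF assms(1,2)], of z w] assms(4-6) by simp
qed

lemma curve_resolve:
  "curve (resolve L Y \<rho>) =
     (curve L - (\<Union>c\<in>Y. chart L c ` ball 0 1)) \<union> (\<Union>c\<in>Y. chart L c ` smoothing (\<rho> c))"
  and crossings_resolve: "crossings (resolve L Y \<rho>) = crossings L - Y"
  and chart_resolve: "chart (resolve L Y \<rho>) = chart L"
  by (simp_all add: resolve_def)

lemma smoothing_norm: "z \<in> smoothing k \<Longrightarrow> norm z < 1"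
  using smoothing_in_ball[of k] by auto

lemma curve_resolve_in_chart:
  assumes L: "link_diagram L" and Y: "Y \<subseteq> crossings L" and c: "c \<in> Y" and z: "norm z < 1"
  shows "chart L c z \<in> curve (resolve L Y \<rho>) \<longleftrightarrow> z \<in> smoothing (\<rho> c)"
proof
  assume "chart L c z \<in> curve (resolve L Y \<rho>)"
  moreover have "chart L c z \<in> (\<Union>c\<in>Y. chart L c ` ball 0 1)"
    by (rule UN_I[OF c imageI]) (use z in simp)
  ultimately obtain d w where d: "d \<in> Y" "w \<in> smoothing (\<rho> d)" "chart L c z = chart L d w"
    unfolding curve_resolve by blast
  then have "c = d" "z = w"
    using link_diagram_charts_disjoint[OF L _ _ _ _ d(3)] Y c z smoothing_norm[OF d(2)] by force+
  then show "z \<in> smoothing (\<rho> c)" using d by simp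
next
  assume "z \<in> smoothing (\<rho> c)"
  then show "chart L c z \<in> curve (resolve L Y \<rho>)" using c unfolding curve_resolve by blast
qed

text \<open>Outside the small discs of radius \<open>smoothing_radius\<close> nothing has changed, because there the
  smoothing coincides with the cross.\<close>

lemma curve_resolve_away:
  assumes L: "link_diagram L" and Y: "Y \<subseteq> crossings L"
    and x: "x \<notin> (\<Union>c\<in>Y. chart L c ` cball 0 smoothing_radius)"
  shows "x \<in> curve (resolve L Y \<rho>) \<longleftrightarrow> x \<in> curve L"
proof (cases "x \<in> (\<Union>c\<in>Y. chart L c ` ball 0 1)")
  case True
  then obtain c z where c: "c \<in> Y" "norm z < 1" "x = chart L c z" by auto
  have "smoothing_radius < norm z"
  proof (rule ccontr)
    assume "\<not> smoothing_radius < norm z"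
    then have "chart L c z \<in> chart L c ` cball 0 smoothing_radius" by (intro imageI) simp
    then show False using x c by blast
  qed
  moreover have "c \<in> crossings L" using Y c(1) by blast
  ultimately show ?thesis
    using curve_resolve_in_chart[OF L Y c(1,2)] smoothing_outside_radius[of z] c(2,3)
      link_diagram_chart_on_curve[OF L, of c z] by simp
next
  case False
  have "chart L c ` smoothing (\<rho> c) \<subseteq> chart L c ` ball 0 1" for c
    by (rule image_mono[OF smoothing_in_ball])
  then show ?thesis using False unfolding curve_resolve by blast
qed

lemma curve_resolve_sphere:
  assumes L: "link_diagram L" and Y: "Y \<subseteq> crossings L"
  shows "curve (resolve L Y \<rho>) \<subseteq> S2"
proof
  fix x assume "x \<in> curve (resolve L Y \<rho>)"
  then consider "x \<in> curve L" | c z where "c \<in> Y" "z \<in> smoothing (\<rho> c)" "x = chart L c z"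
    unfolding curve_resolve by blast
  then show "x \<in> S2"
  proof cases
    case 1
    then show ?thesis using link_diagram_sphere[OF L] by blast
  next
    case 2
    then have "x \<in> chart L c ` cball 0 1" using smoothing_norm[OF 2(2)] by simp
    then show ?thesis using link_diagram_chart(2)[OF L] Y 2(1) by blast
  qed
qed

lemma chart_image_openin:
  assumes L: "link_diagram L" and c: "c \<in> crossings L" and V: "open V" "V \<subseteq> cball 0 1"
  shows "openin (top_of_set S2) (chart L c ` V)"
proof (rule openin_sphere_image[OF V(1)])
  show "continuous_on V (chart L c)" by (rule continuous_on_subset[OF link_diagram_chart(4)[OF L c] V(2)])
  show "inj_on (chart L c) V" by (rule inj_on_subset[OF link_diagram_chart(3)[OF L c] V(2)])
  show "chart L c ` V \<subseteq> S2" using link_diagram_chart(2)[OF L c] V(2) by blast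
qed

lemma chart_image_compact:
  assumes L: "link_diagram L" and c: "c \<in> crossings L" and V: "compact V" "V \<subseteq> cball 0 1"
  shows "compact (chart L c ` V)"
  by (rule compact_continuous_image[OF continuous_on_subset[OF link_diagram_chart(4)[OF L c] V(2)] V(1)])

text \<open>Cut along discs of a radius \<open>r\<close> strictly between \<open>smoothing_radius\<close> and 1. The outer part is closed in
  the old curve because the open discs are open in the sphere; the inner parts are compact pieces
  of smoothings.\<close>

lemma compact_curve_resolve:
  assumes L: "link_diagram L" and Y: "Y \<subseteq> crossings L"
  shows "compact (curve (resolve L Y \<rho>))"
proof -
  obtain r where r: "smoothing_radius < r" "r < 1" using dense smoothing_radius(2) by blast
  have fY: "finite Y" using link_diagram_finite[OF L] Y finite_subset by blast
  have sub: "ball 0 r \<subseteq> cball 0 (1::real)" "smoothing k \<inter> cball 0 r \<subseteq> cball 0 1"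
    "ball 0 r \<subseteq> cball (0::complex) 1" "cball 0 smoothing_radius \<subseteq> ball (0::complex) r" for k
    using r by (auto simp: subset_iff)
  have "openin (top_of_set S2) (\<Union>c\<in>Y. chart L c ` ball 0 r)"
    by (rule openin_Union) (use chart_image_openin[OF L _ open_ball sub(3)] Y in blast)
  then obtain T where T: "open T" "(\<Union>c\<in>Y. chart L c ` ball 0 r) = S2 \<inter> T" unfolding openin_open by blast
  have "curve L - (\<Union>c\<in>Y. chart L c ` ball 0 r) = curve L \<inter> - T"
    using link_diagram_sphere[OF L] T(2) by blast
  then have "compact (curve L - (\<Union>c\<in>Y. chart L c ` ball 0 r))"
    using compact_Int_closed[OF link_diagram_compact[OF L]] T(1) by (simp add: closed_Compl)
  moreover have "compact (\<Union>c\<in>Y. chart L c ` (smoothing (\<rho> c) \<inter> cball 0 r))"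
    by (rule compact_UN[OF fY chart_image_compact[OF L _ compact_smoothing_Int_cball[OF r(2)] sub(2)]])
       (use Y in blast)
  moreover have "curve (resolve L Y \<rho>) = (curve L - (\<Union>c\<in>Y. chart L c ` ball 0 r)) \<union>
      (\<Union>c\<in>Y. chart L c ` (smoothing (\<rho> c) \<inter> cball 0 r))" (is "?l = ?r")
  proof (rule set_eqI)
    fix x
    show "x \<in> ?l \<longleftrightarrow> x \<in> ?r"
    proof (cases "x \<in> (\<Union>c\<in>Y. chart L c ` ball 0 r)")
      case False
      then have away: "x \<notin> (\<Union>c\<in>Y. chart L c ` cball 0 smoothing_radius)" using sub(4) by blast
      have "x \<in> curve L" if "x \<in> (\<Union>c\<in>Y. chart L c ` (smoothing (\<rho> c) \<inter> cball 0 r))"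
      proof -
        have "x \<in> ?l" using that unfolding curve_resolve by blast
        then show ?thesis using curve_resolve_away[OF L Y away] by blast
      qed
      then show ?thesis using curve_resolve_away[OF L Y away, of \<rho>] False by blast
    next
      case True
      then obtain c z where c: "c \<in> Y" "norm z < r" "x = chart L c z" by auto
      then have z1: "norm z < 1" using r(2) by simp
      have B: "x \<in> (\<Union>c\<in>Y. chart L c ` (smoothing (\<rho> c) \<inter> cball 0 r)) \<longleftrightarrow> z \<in> smoothing (\<rho> c)"
      proof
        assume "x \<in> (\<Union>c\<in>Y. chart L c ` (smoothing (\<rho> c) \<inter> cball 0 r))"
        then have "x \<in> ?l" unfolding curve_resolve by blast
        then show "z \<in> smoothing (\<rho> c)" using curve_resolve_in_chart[OF L Y c(1) z1] c(3) by blast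
      next
        assume "z \<in> smoothing (\<rho> c)"
        then have "z \<in> smoothing (\<rho> c) \<inter> cball 0 r" using c(2) by simp
        then show "x \<in> (\<Union>c\<in>Y. chart L c ` (smoothing (\<rho> c) \<inter> cball 0 r))" using c(1,3) by blast
      qed
      have l: "x \<in> ?l \<longleftrightarrow> z \<in> smoothing (\<rho> c)"
        unfolding c(3) by (rule curve_resolve_in_chart[OF L Y c(1) z1])
      have A: "x \<notin> curve L - (\<Union>c\<in>Y. chart L c ` ball 0 r)" using True by blast
      show ?thesis
      proof
        assume "x \<in> ?l"
        then show "x \<in> ?r" using B l by (intro UnI2) (simp only:)
      next
        assume "x \<in> ?r"
        then show "x \<in> ?l"
        proof (rule UnE)
          assume "x \<in> curve L - (\<Union>c\<in>Y. chart L c ` ball 0 r)"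
          then show "x \<in> ?l" using A by contradiction
        next
          assume "x \<in> (\<Union>c\<in>Y. chart L c ` (smoothing (\<rho> c) \<inter> cball 0 r))"
          then show "x \<in> ?l" using B l by (simp only:)
        qed
      qed
    qed
  qed
  ultimately show ?thesis by (simp add: compact_Un)
qed

text \<open>In the open disc of a resolved crossing the local chart comes from the smoothing; elsewhere the
  resolved curve agrees near the point with the original one.\<close>

lemma curve_resolve_arc:
  assumes L: "link_diagram L" and Y: "Y \<subseteq> crossings L"
    and p: "p \<in> curve (resolve L Y \<rho>)" "p \<notin> crossings L - Y"
  shows "interior_arc_point (curve (resolve L Y \<rho>)) p"
proof (cases "p \<in> (\<Union>c\<in>Y. chart L c ` ball 0 1)")
  case True
  then obtain c z where c: "c \<in> Y" "norm z < 1" "p = chart L c z" by auto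
  have cL: "c \<in> crossings L" using Y c(1) by blast
  let ?f = "chart L c"
  have z: "z \<in> smoothing (\<rho> c)" using curve_resolve_in_chart[OF L Y c(1,2)] p(1) c(3) by blast
  obtain W g where W: "open W" "z \<in> W" "diffeo {-1<..<1::real} (smoothing (\<rho> c) \<inter> W) g"
    using smoothing_interior_arc_point[OF z] unfolding interior_arc_point_def by blast
  have SW: "smoothing (\<rho> c) \<inter> W \<subseteq> cball 0 1" using smoothing_norm by (fastforce simp: less_imp_le)
  have d: "diffeo {-1<..<1::real} (?f ` (smoothing (\<rho> c) \<inter> W)) (\<lambda>t. ?f (g t))"
    by (rule diffeo_compose[OF W(3) diffeo_restrict[OF link_diagram_chart(1)[OF L cL] SW]])
  have "openin (top_of_set S2) (?f ` (W \<inter> ball 0 1))"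
    by (rule chart_image_openin[OF L cL]) (use W(1) in auto)
  then obtain U where U: "open U" "?f ` (W \<inter> ball 0 1) = S2 \<inter> U" unfolding openin_open by blast
  have eq: "curve (resolve L Y \<rho>) \<inter> U = ?f ` (smoothing (\<rho> c) \<inter> W)"
  proof
    show "curve (resolve L Y \<rho>) \<inter> U \<subseteq> ?f ` (smoothing (\<rho> c) \<inter> W)"
    proof
      fix x assume x: "x \<in> curve (resolve L Y \<rho>) \<inter> U"
      then have "x \<in> ?f ` (W \<inter> ball 0 1)" using U(2) curve_resolve_sphere[OF L Y, of \<rho>] by blast
      then obtain w where w: "w \<in> W" "norm w < 1" "x = ?f w" by auto
      then have "w \<in> smoothing (\<rho> c)" using x curve_resolve_in_chart[OF L Y c(1) w(2), of \<rho>] by blast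
      then show "x \<in> ?f ` (smoothing (\<rho> c) \<inter> W)" using w by blast
    qed
    show "?f ` (smoothing (\<rho> c) \<inter> W) \<subseteq> curve (resolve L Y \<rho>) \<inter> U"
    proof (rule image_subsetI)
      fix w assume w: "w \<in> smoothing (\<rho> c) \<inter> W"
      then have "?f w \<in> curve (resolve L Y \<rho>)" using c(1) unfolding curve_resolve by blast
      moreover have "?f w \<in> ?f ` (W \<inter> ball 0 1)" using w smoothing_norm[of w "\<rho> c"] by (intro imageI) simp
      ultimately show "?f w \<in> curve (resolve L Y \<rho>) \<inter> U" using U(2) by blast
    qed
  qed
  have "p \<in> U"
  proof -
    have "?f z \<in> ?f ` (W \<inter> ball 0 1)" using W(2) c(2) by (intro imageI) simp
    then show ?thesis using U(2) c(3) by blast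
  qed
  then show ?thesis unfolding interior_arc_point_def
    using U(1) d[folded eq] by (intro exI conjI)
next
  case False
  let ?K = "\<Union>c\<in>Y. chart L c ` cball 0 smoothing_radius"
  have fY: "finite Y" using link_diagram_finite[OF L] Y finite_subset by blast
  have sub: "cball 0 smoothing_radius \<subseteq> ball (0::complex) 1" "cball 0 smoothing_radius \<subseteq> cball (0::complex) 1"
    using smoothing_radius(2) by auto
  have "compact ?K"
    by (rule compact_UN[OF fY chart_image_compact[OF L _ compact_cball sub(2)]]) (use Y in blast)
  then have W: "open (- ?K)" using compact_imp_closed by blast
  have pW: "p \<in> - ?K" using False sub(1) by blast
  have eq: "curve L \<inter> - ?K = curve (resolve L Y \<rho>) \<inter> - ?K"
    using curve_resolve_away[OF L Y, of _ \<rho>] by blast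
  have pL: "p \<in> curve L" using p(1) pW eq by blast
  have "p \<notin> crossings L"
  proof
    assume "p \<in> crossings L"
    then have "p \<in> Y" using p(2) by blast
    moreover have "chart L p 0 = p" using link_diagram_chart(5)[OF L] \<open>p \<in> crossings L\<close> by blast
    then have "p \<in> chart L p ` ball 0 1" using image_eqI[of p "chart L p" 0 "ball 0 1"] by simp
    ultimately show False using False by blast
  qed
  then have "interior_arc_point (curve L) p" by (rule link_diagram_arc[OF L pL])
  then show ?thesis by (rule interior_arc_point_local[OF _ pL W pW eq])
qed

lemma link_diagram_resolve:
  assumes L: "link_diagram L" and Y: "Y \<subseteq> crossings L"
  shows "link_diagram (resolve L Y \<rho>)"
proof -
  have sub: "cball 0 smoothing_radius \<subseteq> cball (0::complex) 1" using smoothing_radius(2) by auto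
  have far: "curve (resolve L Y \<rho>) \<inter> chart L c ` cball 0 1 = curve L \<inter> chart L c ` cball 0 1"
    if c: "c \<in> crossings L - Y" for c
  proof -
    have "x \<in> curve (resolve L Y \<rho>) \<longleftrightarrow> x \<in> curve L" if x: "x \<in> chart L c ` cball 0 1" for x
    proof (rule curve_resolve_away[OF L Y], rule notI)
      assume "x \<in> (\<Union>c\<in>Y. chart L c ` cball 0 smoothing_radius)"
      then obtain d where d: "d \<in> Y" "x \<in> chart L d ` cball 0 1" using sub by blast
      then obtain z w where "norm z \<le> 1" "norm w \<le> 1" "chart L c z = chart L d w" using x by auto
      then have "c = d" using link_diagram_charts_disjoint(1)[OF L] c d(1) Y by blast
      then show False using c d(1) by blast
    qed
    then show ?thesis by blast
  qed
  have chart_c: "oriented_chart (chart L c) \<and> chart L c ` cball 0 1 \<subseteq> S2 \<and> chart L c 0 = c \<and>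
        curve (resolve L Y \<rho>) \<inter> chart L c ` cball 0 1 = chart L c ` {z \<in> cball 0 1. Re z = 0 \<or> Im z = 0}"
    if c: "c \<in> crossings L - Y" for c
    unfolding far[OF c] using link_diagram_chart[OF L, of c] c by blast
  have dis: "chart L c ` cball 0 1 \<inter> chart L d ` cball 0 1 = {}"
    if "c \<in> crossings L - Y" "d \<in> crossings L - Y" "c \<noteq> d" for c d
    using L that unfolding link_diagram_def diagram_in_def by blast
  have arc: "interior_arc_point (curve (resolve L Y \<rho>)) p"
    if "p \<in> curve (resolve L Y \<rho>) \<inter> S2 - (crossings L - Y)" for p
    by (rule curve_resolve_arc[OF L Y]) (use that in simp_all)
  show ?thesis
    unfolding link_diagram_def diagram_in_def crossings_resolve chart_resolve
  proof (intro conjI)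
    show "finite (crossings L - Y)" using link_diagram_finite[OF L] by simp
    show "\<forall>c\<in>crossings L - Y. oriented_chart (chart L c) \<and> chart L c ` cball 0 1 \<subseteq> S2 \<and> chart L c 0 = c \<and>
        curve (resolve L Y \<rho>) \<inter> chart L c ` cball 0 1 = chart L c ` {z \<in> cball 0 1. Re z = 0 \<or> Im z = 0}"
      by (rule ballI) (rule chart_c)
    show "\<forall>c\<in>crossings L - Y. \<forall>d\<in>crossings L - Y. c \<noteq> d \<longrightarrow> chart L c ` cball 0 1 \<inter> chart L d ` cball 0 1 = {}"
      by (intro ballI impI) (rule dis)
    show "\<forall>p\<in>curve (resolve L Y \<rho>) \<inter> S2 - (crossings L - Y). interior_arc_point (curve (resolve L Y \<rho>)) p"
      by (rule ballI) (rule arc)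
  qed (rule curve_resolve_sphere[OF L Y] compact_curve_resolve[OF L Y])+
qed

lemma curve_resolve_resolve:
  assumes L: "link_diagram L" and c: "c \<in> crossings L"
  shows "curve (resolve (resolve L {c} (\<lambda>_. k)) (crossings L - {c}) \<rho>) =
    curve (resolve L (crossings L) (\<rho>(c := k)))"
proof -
  have dis: "chart L c ` smoothing k \<inter> chart L d ` ball 0 1 = {}" if d: "d \<in> crossings L - {c}" for d
  proof (rule ccontr)
    assume "chart L c ` smoothing k \<inter> chart L d ` ball 0 1 \<noteq> {}"
    then obtain z w where zw: "z \<in> smoothing k" "norm w < 1" "chart L c z = chart L d w" by auto
    then have "c = d"
      using link_diagram_charts_disjoint(1)[OF L c _ _ _ zw(3)] d smoothing_norm[OF zw(1)] by simp
    then show False using d by simp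
  qed
  define X where "X = crossings L - {c}"
  have X: "crossings L = insert c X" "c \<notin> X" using c by (auto simp: X_def)
  have "(\<Union>d\<in>X. chart L d ` smoothing ((\<rho>(c := k)) d)) = (\<Union>d\<in>X. chart L d ` smoothing (\<rho> d))"
    by (intro SUP_cong) (use X(2) in auto)
  then have 1: "(\<Union>d\<in>crossings L. chart L d ` smoothing ((\<rho>(c := k)) d)) =
        chart L c ` smoothing k \<union> (\<Union>d\<in>X. chart L d ` smoothing (\<rho> d))"
    unfolding X(1) by simp
  have 2: "(\<Union>d\<in>crossings L. chart L d ` ball 0 1) =
        chart L c ` ball 0 1 \<union> (\<Union>d\<in>X. chart L d ` ball 0 1)"
    unfolding X(1) by simp
  show ?thesis unfolding curve_resolve chart_resolve 1 2 using dis[folded X_def] unfolding X_def[symmetric] by auto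
qed

lemma disjoint_circle_avoids_charts:
  assumes L: "link_diagram L" and LU: "link_diagram (L\<lparr>curve := curve L \<union> U\<rparr>)"
    and dis: "curve L \<inter> U = {}" and c: "c \<in> crossings L"
  shows "U \<inter> chart L c ` cball 0 1 = {}"
proof -
  have "(curve L \<union> U) \<inter> chart L c ` cball 0 1 = curve L \<inter> chart L c ` cball 0 1"
    using link_diagram_chart(7)[OF LU, of c] link_diagram_chart(7)[OF L c] c by simp
  then show ?thesis using dis by blast
qed

lemma curve_resolve_union:
  assumes L: "link_diagram L" and LU: "link_diagram (L\<lparr>curve := curve L \<union> U\<rparr>)"
    and dis: "curve L \<inter> U = {}" and Y: "Y \<subseteq> crossings L"
  shows "curve (resolve (L\<lparr>curve := curve L \<union> U\<rparr>) Y \<rho>) = curve (resolve L Y \<rho>) \<union> U"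
    "curve (resolve L Y \<rho>) \<inter> U = {}"
proof -
  note av = disjoint_circle_avoids_charts[OF L LU dis]
  have b: "U \<inter> chart L c ` ball 0 1 = {}" if "c \<in> Y" for c
    using av[of c] image_mono[OF ball_subset_cball, of "chart L c" 0 1] that Y by blast
  have s: "U \<inter> chart L c ` smoothing k = {}" if "c \<in> Y" for c k
    using b[OF that] image_mono[OF smoothing_in_ball[of k], of "chart L c"] by blast
  show "curve (resolve (L\<lparr>curve := curve L \<union> U\<rparr>) Y \<rho>) = curve (resolve L Y \<rho>) \<union> U"
    unfolding curve_resolve using b by auto
  show "curve (resolve L Y \<rho>) \<inter> U = {}"
    unfolding curve_resolve using dis s by blast
qed

section \<open>The state sum and the bracket\<close>

lemma embedded_circle_connected_compact:
  assumes "embedded_circle K" shows "connected K" "compact K" "K \<noteq> {}"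
proof -
  obtain f where f: "diffeo (sphere (0::complex) 1) K f" using assms unfolding embedded_circle_def by blast
  have K: "K = f ` sphere 0 1" using f by (simp add: diffeo_def bij_betw_def)
  have c: "continuous_on (sphere 0 1) f" using f by (simp add: diffeo_def smooth_map_continuous_on)
  show "connected K" unfolding K by (rule connected_continuous_image[OF c]) (simp add: connected_sphere)
  show "compact K" unfolding K by (rule compact_continuous_image[OF c]) simp
  have "(1::complex) \<in> sphere 0 1" by simp
  then show "K \<noteq> {}" unfolding K by blast
qed

lemma components_Un_disjoint_closed:
  assumes A: "closed A" and U: "closed U" "connected U" "U \<noteq> {}" and dis: "A \<inter> U = {}"
  shows "components (A \<union> U) = insert U (components A)" "U \<notin> components A"
proof -
  have split: "K \<subseteq> A \<or> K \<subseteq> U" if K: "connected K" "K \<subseteq> A \<union> U" for K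
  proof -
    have "A \<inter> U \<inter> K = {}" using dis by blast
    then have "A \<inter> K = {} \<or> U \<inter> K = {}"
      using connected_closedD[OF K(1) _ K(2) A U(1)] by blast
    then show ?thesis using K(2) by blast
  qed
  show "U \<notin> components A"
    using in_components_subset[of U A] dis U(3) by blast
  show "components (A \<union> U) = insert U (components A)"
  proof
    show "components (A \<union> U) \<subseteq> insert U (components A)"
    proof
      fix K assume K: "K \<in> components (A \<union> U)"
      have "K \<subseteq> A \<or> K \<subseteq> U"
        by (rule split[OF in_components_connected[OF K] in_components_subset[OF K]])
      then show "K \<in> insert U (components A)"
      proof
        assume "K \<subseteq> A"
        then have "K \<in> components A" by (intro components_intermediate_subset[OF K]) auto
        then show ?thesis by simp
      next
        assume KU: "K \<subseteq> U"
        have "U \<subseteq> K"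
          by (rule components_maximal[OF K U(2)]) (use KU in_components_nonempty[OF K] in auto)
        then show ?thesis using KU by blast
      qed
    qed
    show "insert U (components A) \<subseteq> components (A \<union> U)"
    proof
      fix K assume "K \<in> insert U (components A)"
      then have K: "K = U \<or> K \<in> components A" by blast
      have Kc: "connected K" "K \<noteq> {}" "K \<subseteq> A \<union> U"
        using K U in_components_connected[of K A] in_components_nonempty[of K A] in_components_subset[of K A] by blast+
      have "D = K" if D: "K \<subseteq> D" "D \<subseteq> A \<union> U" "connected D" for D
      proof -
        from K show ?thesis
        proof
          assume "K = U"
          then show ?thesis using split[OF D(3,2)] D(1) Kc(2) dis by blast
        next
          assume KA: "K \<in> components A"
          then have "D \<subseteq> A" using split[OF D(3,2)] D(1) Kc(2) in_components_subset[OF KA] dis by blast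
          moreover have "K \<inter> D \<noteq> {}" using D(1) Kc(2) by blast
          ultimately have "D \<subseteq> K" by (intro components_maximal[OF KA D(3)])
          then show ?thesis using D(1) by blast
        qed
      qed
      then show "K \<in> components (A \<union> U)" unfolding in_components_maximal using Kc by blast
    qed
  qed
qed

lemma crossingless_circle_union:
  assumes L: "link_diagram L" and "crossings L = {}"
  shows "circle_union (curve L)"
  by (rule compact_one_manifold_circle_union[OF link_diagram_compact[OF L] link_diagram_arc[OF L]])
     (simp_all add: assms(2))

lemma circle_union_full_resolution:
  assumes "link_diagram L" shows "circle_union (curve (resolve L (crossings L) \<rho>))"
  by (rule crossingless_circle_union[OF link_diagram_resolve[OF assms order_refl]]) (simp add: crossings_resolve)

text \<open>The closed formula for the bracket: expand every crossing and count the circles of each full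
  resolution.\<close>

definition state_sum :: "('a) diagram_scheme \<Rightarrow> laurent" where
  "state_sum L =
     (\<Sum>\<rho>\<in>resolutions L. (- q) ^ (\<Sum>c\<in>crossings L. \<rho> c) *
        (q + q_inv) ^ card (components (curve (resolve L (crossings L) \<rho>))))"

lemma state_sum_crossingless:
  assumes "crossings L = {}"
  shows "state_sum L = (q + q_inv) ^ card (components (curve L))"
  by (simp add: state_sum_def resolutions_def assms curve_resolve)

lemma link_diagram_empty_curve:
  assumes "link_diagram L" "curve L = {}" shows "crossings L = {}"
  using link_diagram_chart_on_curve[OF assms(1), of _ 0] assms(2) by auto

lemma state_sum_add_circle:
  assumes L: "link_diagram L" and U: "embedded_circle U" and dis: "curve L \<inter> U = {}"
    and LU: "link_diagram (L\<lparr>curve := curve L \<union> U\<rparr>)"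
  shows "state_sum (L\<lparr>curve := curve L \<union> U\<rparr>) = (q + q_inv) * state_sum L"
proof -
  note Uc = embedded_circle_connected_compact[OF U]
  have "card (components (curve (resolve (L\<lparr>curve := curve L \<union> U\<rparr>) (crossings L) \<rho>))) =
      Suc (card (components (curve (resolve L (crossings L) \<rho>))))" for \<rho>
  proof -
    let ?R = "curve (resolve L (crossings L) \<rho>)"
    have fin: "finite (components ?R)"
      using circle_union_full_resolution[OF L] by (simp add: circle_union_def)
    have R: "closed ?R" by (rule compact_imp_closed[OF compact_curve_resolve[OF L order_refl]])
    have "curve (resolve (L\<lparr>curve := curve L \<union> U\<rparr>) (crossings L) \<rho>) = ?R \<union> U" "?R \<inter> U = {}"
      by (rule curve_resolve_union[OF L LU dis order_refl])+
    then show ?thesis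
      using components_Un_disjoint_closed[OF R compact_imp_closed[OF Uc(2)] Uc(1,3)] fin by simp
  qed
  then show ?thesis
    unfolding state_sum_def by (simp add: resolutions_def sum_distrib_left mult_ac)
qed

text \<open>Split the resolutions according to their value at \<open>c\<close>; resolving \<open>c\<close> first and the other crossings
  afterwards gives the same curve as resolving all of them at once.\<close>

lemma state_sum_skein:
  assumes L: "link_diagram L" and c: "c \<in> crossings L"
  shows "state_sum L = state_sum (resolve L {c} (\<lambda>_. 0)) - q * state_sum (resolve L {c} (\<lambda>_. 1))"
proof -
  define X where "X = crossings L - {c}"
  have X: "crossings L = insert c X" "c \<notin> X" "finite X"
    using c link_diagram_finite[OF L] by (auto simp: X_def)
  define n where "n \<rho> = card (components (curve (resolve L (crossings L) \<rho>)))" for \<rho>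
  have res: "state_sum (resolve L {c} (\<lambda>_. k)) =
      (\<Sum>\<rho>\<in>X \<rightarrow>\<^sub>E {0,1}. (- q) ^ (\<Sum>c\<in>X. \<rho> c) * (q + q_inv) ^ n (\<rho>(c := k)))" for k
    unfolding state_sum_def resolutions_def crossings_resolve X_def[symmetric] n_def
    using curve_resolve_resolve[OF L c, of k] by (simp add: X_def[symmetric])
  let ?g = "\<lambda>(k, \<rho>). \<rho>(c := k)" and ?t = "\<lambda>\<rho>. (- q) ^ (\<Sum>c\<in>crossings L. \<rho> c) * (q + q_inv) ^ n \<rho>"
  have inj: "inj_on ?g ({0,1} \<times> (X \<rightarrow>\<^sub>E {0,1::nat}))"
    using inj_combinator[OF X(2), of "\<lambda>_. {0,1::nat}"] by simp
  have img: "resolutions L = ?g ` ({0,1} \<times> (X \<rightarrow>\<^sub>E {0,1::nat}))"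
    unfolding resolutions_def X(1) by (rule PiE_insert_eq)
  have h: "(\<Sum>d\<in>crossings L. (\<rho>(c := k)) d) = k + (\<Sum>d\<in>X. \<rho> d)" for k and \<rho> :: "point \<Rightarrow> nat"
  proof -
    have "(\<Sum>d\<in>X. (\<rho>(c := k)) d) = (\<Sum>d\<in>X. \<rho> d)" by (rule sum.cong) (use X(2) in auto)
    then show ?thesis unfolding X(1) using X(2,3) by simp
  qed
  have "state_sum L = (\<Sum>\<rho>\<in>resolutions L. ?t \<rho>)" by (simp add: state_sum_def n_def)
  also have "\<dots> = (\<Sum>p\<in>{0,1} \<times> (X \<rightarrow>\<^sub>E {0,1::nat}). ?t (?g p))"
    unfolding img by (simp only: sum.reindex[OF inj] o_def)
  also have "\<dots> = (\<Sum>k\<in>{0,1}. \<Sum>\<rho>\<in>X \<rightarrow>\<^sub>E {0,1::nat}. ?t (\<rho>(c := k)))"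
    by (simp only: sum.cartesian_product split_def)
  also have "\<dots> = (\<Sum>\<rho>\<in>X \<rightarrow>\<^sub>E {0,1::nat}. ?t (\<rho>(c := 0))) + (\<Sum>\<rho>\<in>X \<rightarrow>\<^sub>E {0,1::nat}. ?t (\<rho>(c := 1)))"
    by simp
  also have "(\<Sum>\<rho>\<in>X \<rightarrow>\<^sub>E {0,1::nat}. ?t (\<rho>(c := 0))) = state_sum (resolve L {c} (\<lambda>_. 0))"
    unfolding res h by simp
  also have "(\<Sum>\<rho>\<in>X \<rightarrow>\<^sub>E {0,1::nat}. ?t (\<rho>(c := 1))) = - (q * state_sum (resolve L {c} (\<lambda>_. 1)))"
    unfolding res h by (simp add: sum_distrib_left sum_negf[symmetric] mult_ac)
  finally show ?thesis by simp
qed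

lemma bracket_relations_state_sum:
  "bracket_relations (restrict state_sum {L. link_diagram L})"
  unfolding bracket_relations_def
proof (intro conjI allI impI)
  fix L :: diagram assume L: "link_diagram L" "curve L = {}"
  then show "restrict state_sum {L. link_diagram L} L = 1"
    using link_diagram_empty_curve[OF L] by (simp add: state_sum_crossingless)
next
  fix L :: diagram assume L: "link_diagram L" "crossings L = {}" "embedded_circle (curve L)"
  have "components (curve L) = {curve L}"
    using embedded_circle_connected_compact[OF L(3)] by (simp add: components_eq_sing_iff)
  then show "restrict state_sum {L. link_diagram L} L = q + q_inv"
    using L(1,2) by (simp add: state_sum_crossingless)
next
  fix L :: diagram and U
  assume "link_diagram L" "embedded_circle U" "curve L \<inter> U = {}" "link_diagram (L\<lparr>curve := curve L \<union> U\<rparr>)"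
  then show "restrict state_sum {L. link_diagram L} (L\<lparr>curve := curve L \<union> U\<rparr>) =
      (q + q_inv) * restrict state_sum {L. link_diagram L} L"
    using state_sum_add_circle[of L U] by simp
next
  fix L :: diagram and c assume L: "link_diagram L" "c \<in> crossings L"
  have "link_diagram (resolve L {c} (\<lambda>_. k))" for k by (rule link_diagram_resolve[OF L(1)]) (use L(2) in simp)
  then show "restrict state_sum {L. link_diagram L} L =
      restrict state_sum {L. link_diagram L} (resolve L {c} (\<lambda>_. 0)) -
      q * restrict state_sum {L. link_diagram L} (resolve L {c} (\<lambda>_. 1))"
    using L(1) state_sum_skein[OF L] by simp
qed

text \<open>A crossingless diagram is a compact one-dimensional manifold on the sphere, hence a disjoint union
  of circles. Removing one of them and applying the circle relation reduces to the empty diagram.\<close>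

lemma bracket_relations_unique_crossingless:
  assumes "bracket_relations J" "bracket_relations J'"
    and "link_diagram L" "crossings L = {}"
  shows "J L = J' L"
  using assms(3,4)
proof (induction "card (components (curve L))" arbitrary: L rule: less_induct)
  case less
  note L = less.prems
  have circ: "finite (components (curve L))" "\<And>K. K \<in> components (curve L) \<Longrightarrow> embedded_circle K"
    using crossingless_circle_union[OF L] by (auto simp: circle_union_def)
  show ?case
  proof (cases "curve L = {}")
    case True
    then show ?thesis using assms(1,2) L(1) unfolding bracket_relations_def by simp
  next
    case False
    then obtain U where U: "U \<in> components (curve L)" by (metis components_eq_empty ex_in_conv)
    note Uc = embedded_circle_connected_compact[OF circ(2)[OF U]]
    have UL: "U \<subseteq> curve L" by (rule in_components_subset[OF U])
    let ?A = "curve L - U" and ?L = "L\<lparr>curve := curve L - U\<rparr>"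
    have "\<Union>(components (curve L) - {U}) = ?A"
    proof -
      have "K \<inter> U = {}" if "K \<in> components (curve L)" "K \<noteq> U" for K
        using components_nonoverlap[OF that(1) U] that(2) by blast
      then show ?thesis using Union_components[of "curve L"] U by blast
    qed
    moreover have "compact (\<Union>(components (curve L) - {U}))"
      using circ embedded_circle_connected_compact(2) by (intro compact_Union) auto
    ultimately have A: "compact ?A" by simp
    have oU: "open (- U)" using Uc(2) compact_imp_closed by blast
    have "interior_arc_point ?A p" if p: "p \<in> ?A" for p
      by (rule interior_arc_point_local[of "curve L" p "- U"])
         (use p oU link_diagram_arc[OF L(1), of p] L(2) in auto)
    then have L': "link_diagram ?L"
      using A L link_diagram_sphere[OF L(1)] unfolding link_diagram_def diagram_in_def by auto
    have eq: "?L\<lparr>curve := curve ?L \<union> U\<rparr> = L"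
      using UL by (simp add: Un_absorb1 Un_absorb2)
    have comp: "components (curve L) = insert U (components ?A)" "U \<notin> components ?A"
    proof -
      have "?A \<union> U = curve L" using UL by blast
      then show "components (curve L) = insert U (components ?A)" "U \<notin> components ?A"
        using components_Un_disjoint_closed[OF compact_imp_closed[OF A] compact_imp_closed[OF Uc(2)] Uc(1,3)] by auto
    qed
    have "card (components (curve ?L)) < card (components (curve L))"
      using comp circ(1) by simp
    then have IH: "J ?L = J' ?L" by (rule less.hyps) (use L' L(2) in simp_all)
    have step: "H L = (q + q_inv) * H ?L" if H: "bracket_relations H" for H
    proof -
      have "\<forall>L U. link_diagram L \<longrightarrow> embedded_circle U \<longrightarrow> curve L \<inter> U = {} \<longrightarrow>
        link_diagram (L\<lparr>curve := curve L \<union> U\<rparr>) \<longrightarrow> H (L\<lparr>curve := curve L \<union> U\<rparr>) = (q + q_inv) * H L"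
        using H unfolding bracket_relations_def by (elim conjE)
      from this[rule_format, of ?L U, unfolded eq] show ?thesis
        using L' L(1) circ(2)[OF U] by auto
    qed
    show ?thesis using step[OF assms(1)] step[OF assms(2)] IH by simp
  qed
qed

lemma bracket_relations_unique:
  assumes "bracket_relations J" "bracket_relations J'" and "link_diagram L"
  shows "J L = J' L"
  using assms(3)
proof (induction "card (crossings L)" arbitrary: L rule: less_induct)
  case less
  note L = less.prems
  show ?case
  proof (cases "crossings L = {}")
    case True
    then show ?thesis by (rule bracket_relations_unique_crossingless[OF assms(1,2) L])
  next
    case False
    then obtain c where c: "c \<in> crossings L" by blast
    have step: "H L = H (resolve L {c} (\<lambda>_. 0)) - q * H (resolve L {c} (\<lambda>_. 1))"
      if H: "bracket_relations H" for H
    proof -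
      have "\<forall>L c. link_diagram L \<longrightarrow> c \<in> crossings L \<longrightarrow>
        H L = H (resolve L {c} (\<lambda>_. 0)) - q * H (resolve L {c} (\<lambda>_. 1))"
        using H unfolding bracket_relations_def by (elim conjE)
      then show ?thesis using L c by blast
    qed
    have "J (resolve L {c} (\<lambda>_. k)) = J' (resolve L {c} (\<lambda>_. k))" for k
    proof (rule less.hyps)
      show "card (crossings (resolve L {c} (\<lambda>_. k))) < card (crossings L)"
        unfolding crossings_resolve using c link_diagram_finite[OF L] by (rule card_Diff1_less[rotated])
      show "link_diagram (resolve L {c} (\<lambda>_. k))"
        by (rule link_diagram_resolve[OF L]) (use c in simp)
    qed
    then show ?thesis using step[OF assms(1)] step[OF assms(2)] by simp
  qed
qed

text \<open>The state sum satisfies the relations. They determine the bracket, because the skein relation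
  lowers the number of crossings until none is left.\<close>

theorem bracket_eq_state_sum:
  assumes "link_diagram L" shows "bracket L = state_sum L"
proof -
  let ?S = "restrict state_sum {L :: diagram. link_diagram L}"
  have "bracket = ?S"
    unfolding bracket_def
  proof (rule the_equality)
    show "?S \<in> extensional {L. link_diagram L} \<and> bracket_relations ?S"
      using bracket_relations_state_sum by simp
    fix J :: "diagram \<Rightarrow> laurent"
    assume J: "J \<in> extensional {L. link_diagram L} \<and> bracket_relations J"
    show "J = ?S"
    proof (rule extensionalityI[of _ "{L. link_diagram L}"])
      fix L :: diagram assume "L \<in> {L. link_diagram L}"
      then show "J L = ?S L"
        using bracket_relations_unique[OF conjunct2[OF J] bracket_relations_state_sum, of L] by blast
    qed (use J in simp_all)
  qed
  from fun_cong[OF this, of L] have "bracket L = ?S L" .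
  moreover have "L \<in> {L. link_diagram L}" using assms by simp
  ultimately show ?thesis by (simp only: restrict_apply')
qed

section \<open>Annular disc configurations\<close>

lemma embedded_disc_compact: "embedded_disc D \<Longrightarrow> compact D"
proof -
  assume "embedded_disc D"
  then obtain f where f: "diffeo (cball (0::complex) 1) D f" unfolding embedded_disc_def by blast
  have D: "D = f ` cball 0 1" using f by (simp add: diffeo_def bij_betw_def)
  have "continuous_on (cball 0 1) f" using f by (simp add: diffeo_def smooth_map_continuous_on)
  then show "compact D" unfolding D by (rule compact_continuous_image) simp
qed

lemma scale_single: "scale r (Poly_Mapping.single b x) = Poly_Mapping.single b (r * x)"
  by (simp add: scale_def)

lemma linear_extension_single: "linear_extension f (Poly_Mapping.single b x) = scale x (f b)"
proof (cases "x = 0")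
  case True
  have "scale 0 y = 0" for y :: "'c \<Rightarrow>\<^sub>0 laurent"
    by (rule poly_mapping_eqI) (simp add: scale_def Poly_Mapping.map.rep_eq)
  then show ?thesis using True by (simp add: linear_extension_def)
qed (simp add: linear_extension_def)

lemma sum_single: "(\<Sum>i\<in>I. Poly_Mapping.single k (f i)) = Poly_Mapping.single k (\<Sum>i\<in>I. f i)"
  by (induction I rule: infinite_finite_induct) (simp_all add: single_add)

lemma sum_decorations:
  assumes "finite A"
  shows "(\<Sum>\<sigma>\<in>A \<rightarrow>\<^sub>E (UNIV :: sgn_dec set). \<Prod>K\<in>A. (case \<sigma> K of Plus \<Rightarrow> a | Minus \<Rightarrow> b)) =
    ((a + b) ^ card A :: laurent)"
proof -
  have U: "(UNIV :: sgn_dec set) = {Plus, Minus}" using sgn_dec.exhaust by auto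
  have "(\<Prod>K\<in>A. \<Sum>y\<in>(UNIV :: sgn_dec set). (case y of Plus \<Rightarrow> a | Minus \<Rightarrow> b)) =
    (\<Sum>\<sigma>\<in>A \<rightarrow>\<^sub>E (UNIV :: sgn_dec set). \<Prod>K\<in>A. (case \<sigma> K of Plus \<Rightarrow> a | Minus \<Rightarrow> b))"
    by (rule prod_sum_PiE) (simp_all add: assms U)
  moreover have "(\<Sum>y\<in>(UNIV :: sgn_dec set). (case y of Plus \<Rightarrow> a | Minus \<Rightarrow> b)) = a + b"
    by (simp add: U)
  ultimately show ?thesis by simp
qed

lemma connected_misses_boundary:
  assumes K: "connected K" "K \<subseteq> S2" "K \<inter> bd D = {}" and D: "closed D" "D \<subseteq> S2"
  shows "K \<subseteq> inner D \<or> K \<subseteq> S2 - D"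
proof -
  have i: "inner D \<subseteq> D" by (rule interior_of_subset)
  have "openin (top_of_set S2) (inner D)" by (rule openin_interior_of)
  then obtain A where A: "open A" "inner D = S2 \<inter> A" unfolding openin_open by blast
  have Dsub: "D \<subseteq> top_of_set S2 closure_of D" by (rule closure_of_subset) (simp add: D(2))
  have cover: "K \<subseteq> A \<union> - D"
  proof
    fix x assume x: "x \<in> K"
    show "x \<in> A \<union> - D"
    proof (cases "x \<in> D")
      case True
      have "x \<notin> bd D" using x K(3) by blast
      then have "x \<in> inner D" using True Dsub unfolding frontier_of_def by blast
      then show ?thesis using A(2) by blast
    qed simp
  qed
  have "A \<inter> - D \<inter> K = {}" using i A(2) K(2) by blast
  then have "A \<inter> K = {} \<or> - D \<inter> K = {}"
    by (rule connectedD[OF K(1) A(1) open_Compl[OF D(1)] _ cover])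
  then show ?thesis
  proof
    assume "A \<inter> K = {}"
    then have "K \<subseteq> S2 - D" using cover K(2) by blast
    then show ?thesis ..
  next
    assume "- D \<inter> K = {}"
    then have "K \<subseteq> inner D" using cover A(2) K(2) by blast
    then show ?thesis ..
  qed
qed

lemma annulusD:
  assumes D: "disc_configuration \<D>" and h: "holes \<D> = 1"
  shows "i \<le> 1 \<Longrightarrow> disc \<D> i \<subseteq> S2" "i \<le> 1 \<Longrightarrow> embedded_disc (disc \<D> i)"
    "i \<le> 1 \<Longrightarrow> mark \<D> i \<in> dcirc \<D> i" "i \<le> 1 \<Longrightarrow> closed (disc \<D> i)"
    "Sig \<D> = disc \<D> 0 - inner (disc \<D> 1)" "Sig_int \<D> = inner (disc \<D> 0) - disc \<D> 1"
    "disc \<D> 1 \<subseteq> inner (disc \<D> 0)"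
proof -
  have *: "\<forall>i\<le>holes \<D>. disc \<D> i \<subseteq> S2 \<and> embedded_disc (disc \<D> i) \<and> mark \<D> i \<in> bd (disc \<D> i)"
    using D unfolding disc_configuration_def by (elim conjE)
  show "i \<le> 1 \<Longrightarrow> disc \<D> i \<subseteq> S2" "i \<le> 1 \<Longrightarrow> mark \<D> i \<in> dcirc \<D> i" 
    using * h by (simp_all add: dcirc_def)
  show e: "i \<le> 1 \<Longrightarrow> embedded_disc (disc \<D> i)" using * h by simp
  show "i \<le> 1 \<Longrightarrow> closed (disc \<D> i)" using compact_imp_closed[OF embedded_disc_compact[OF e]] .
  show "Sig \<D> = disc \<D> 0 - inner (disc \<D> 1)" "Sig_int \<D> = inner (disc \<D> 0) - disc \<D> 1"
    by (simp_all add: Sig_def Sig_int_def h)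
  show "disc \<D> 1 \<subseteq> inner (disc \<D> 0)" using D h unfolding disc_configuration_def by simp
qed

lemma annulus_boundary_in_Sig:
  assumes D: "disc_configuration \<D>" and h: "holes \<D> = 1" and i: "i \<le> 1"
  shows "dcirc \<D> i \<subseteq> Sig \<D>" "dcirc \<D> i \<inter> Sig_int \<D> = {}"
proof -
  note A = annulusD[OF D h]
  have bd: "dcirc \<D> i \<subseteq> disc \<D> i" "dcirc \<D> i \<inter> inner (disc \<D> i) = {}" if "i \<le> 1" for i
  proof -
    have "closedin (top_of_set S2) (disc \<D> i)" 
      using A(1,4)[OF that] closedin_closed_subset[of S2 "disc \<D> i"] by (simp add: closed_subset)
    then have "top_of_set S2 closure_of disc \<D> i = disc \<D> i" by (simp add: closure_of_eq)
    then show "dcirc \<D> i \<subseteq> disc \<D> i" "dcirc \<D> i \<inter> inner (disc \<D> i) = {}"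
      unfolding dcirc_def frontier_of_def by auto
  qed
  have inn: "inner (disc \<D> j) \<subseteq> disc \<D> j" for j by (rule interior_of_subset)
  have "i = 0 \<or> i = 1" using i by auto
  then show "dcirc \<D> i \<subseteq> Sig \<D>" "dcirc \<D> i \<inter> Sig_int \<D> = {}"
    unfolding A(5,6) using bd[of 0] bd[of 1] inn[of 0] inn[of 1] A(7) by auto
qed

lemma Sig_minus_boundary:
  assumes D: "disc_configuration \<D>" and h: "holes \<D> = 1"
    and x: "x \<in> Sig \<D>" "x \<notin> dcirc \<D> 0" "x \<notin> dcirc \<D> 1"
  shows "x \<in> Sig_int \<D>"
proof -
  note A = annulusD[OF D h]
  have cl: "disc \<D> i \<subseteq> top_of_set S2 closure_of disc \<D> i" if "i \<le> 1" for i
    by (rule closure_of_subset) (use A(1)[OF that] in simp)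
  show ?thesis
    using x cl[of 0] cl[of 1] unfolding A(5,6) dcirc_def frontier_of_def by auto
qed

text \<open>A component of \<open>M\<close> cannot cross the two boundary circles, which \<open>P\<close> avoids, and may not lie in the
  inner disc or outside the outer disc. So it lies in the annulus, and \<open>M\<close> is \<open>P\<close> itself.\<close>

lemma annulus_multi_reps:
  assumes D: "disc_configuration \<D>" and h: "holes \<D> = 1"
    and P: "P \<subseteq> Sig_int \<D>" "circle_union P"
  shows "multi_reps \<D> P = {P} \<times> (components P \<rightarrow>\<^sub>E UNIV)"
proof -
  note A = annulusD[OF D h] and B = annulus_boundary_in_Sig[OF D h]
  have inn: "inner (disc \<D> j) \<subseteq> disc \<D> j" for j by (rule interior_of_subset)
  have int: "Sig_int \<D> \<subseteq> Sig \<D>" unfolding A(5,6) using inn by blast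
  have PB: "P \<inter> dcirc \<D> i = {}" if "i \<le> 1" for i using B(2)[OF that] P(1) by blast
  have PS: "P \<subseteq> S2" using P(1) A(1)[of 0] inn[of 0] unfolding A(6) by blast
  have eq: "M = P" if M: "multi_cleaved_link \<D> (M, \<sigma>)" "M \<inter> Sig \<D> = P" for M \<sigma>
  proof -
    have MS: "M \<subseteq> S2" and comp: "\<forall>K\<in>components M. \<not> K \<subseteq> S2 - disc \<D> 0 \<and>
        (\<forall>i\<in>{1..holes \<D>}. \<not> K \<subseteq> inner (disc \<D> i))"
      using M(1) unfolding multi_cleaved_link.simps by - (elim conjE, assumption)+
    have MB: "M \<inter> dcirc \<D> i = {}" if "i \<le> 1" for i using B(1)[OF that] PB[OF that] M(2) by blast
    have "K \<subseteq> Sig \<D>" if K: "K \<in> components M" for K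
    proof -
      have KM: "K \<subseteq> M" by (rule in_components_subset[OF K])
      have "K \<subseteq> inner (disc \<D> i) \<or> K \<subseteq> S2 - disc \<D> i" if i: "i \<le> 1" for i
        by (rule connected_misses_boundary[OF in_components_connected[OF K] _ _ A(4)[OF i] A(1)[OF i]])
           (use KM MS MB[OF i] in \<open>auto simp: dcirc_def\<close>)
      from this[of 0] this[of 1] bspec[OF comp K] have "K \<subseteq> inner (disc \<D> 0)" "K \<subseteq> S2 - disc \<D> 1"
        by (simp_all add: h)
      then show ?thesis using inn unfolding A(5) by blast
    qed
    then have "M \<subseteq> Sig \<D>" using Union_components[of M] by blast
    then show ?thesis using M(2) by blast
  qed
  have dec: "multi_cleaved_link \<D> (P, \<sigma>) \<longleftrightarrow> \<sigma> \<in> components P \<rightarrow>\<^sub>E UNIV" for \<sigma>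
  proof -
    have 1: "\<forall>i\<le>holes \<D>. mark \<D> i \<notin> P \<and> (\<forall>x\<in>P \<inter> dcirc \<D> i. transverse_at P (dcirc \<D> i) x)"
      using PB A(3) by (auto simp: h)
    have 2: "\<forall>K\<in>components P. \<not> K \<subseteq> S2 - disc \<D> 0 \<and> (\<forall>i\<in>{1..holes \<D>}. \<not> K \<subseteq> inner (disc \<D> i))"
    proof
      fix K assume K: "K \<in> components P"
      obtain x where x: "x \<in> K" using in_components_nonempty[OF K] by blast
      then have "x \<in> Sig_int \<D>" using in_components_subset[OF K] P(1) by blast
      then show "\<not> K \<subseteq> S2 - disc \<D> 0 \<and> (\<forall>i\<in>{1..holes \<D>}. \<not> K \<subseteq> inner (disc \<D> i))"
        using x inn unfolding A(6) by (auto simp: h)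
    qed
    show ?thesis unfolding multi_cleaved_link.simps using 1 2 PS P(2) by (intro iffI conjI) (elim conjE, assumption)+
  qed
  have PSig: "P \<inter> Sig \<D> = P" using P(1) int by blast
  show ?thesis
  proof (rule set_eqI)
    fix x :: multi_link
    obtain M \<sigma> where x: "x = (M, \<sigma>)" by (cases x)
    have "x \<in> multi_reps \<D> P \<longleftrightarrow> multi_cleaved_link \<D> (M, \<sigma>) \<and> M \<inter> Sig \<D> = P"
      unfolding multi_reps_def x by (simp only: mem_Collect_eq fst_conv)
    also have "\<dots> \<longleftrightarrow> M = P \<and> \<sigma> \<in> components P \<rightarrow>\<^sub>E UNIV"
      using eq[of M \<sigma>] dec[of \<sigma>] PSig by metis
    finally show "x \<in> multi_reps \<D> P \<longleftrightarrow> x \<in> {P} \<times> (components P \<rightarrow>\<^sub>E UNIV)"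
      unfolding x by (simp only: mem_Sigma_iff singleton_iff)
  qed
qed

text \<open>An isomorphism is the identity on the annulus, hence maps every component of \<open>P\<close> to itself and
  forces the decorations to agree.\<close>

lemma annulus_MCL:
  assumes D: "disc_configuration \<D>" and h: "holes \<D> = 1"
    and P: "P \<subseteq> Sig_int \<D>" "circle_union P"
  shows "MCL \<D> P = (\<lambda>\<sigma>. {(P, \<sigma>)}) ` (components P \<rightarrow>\<^sub>E UNIV)"
proof -
  let ?R = "multi_reps \<D> P"
  note R = annulus_multi_reps[OF D h P]
  have PS: "P \<subseteq> Sig \<D>"
    using P(1) annulusD(5,6)[OF D h] interior_of_subset[of "top_of_set S2"] by blast
  have iso: "multi_iso \<D> x y \<longleftrightarrow> x = y" if xy: "x \<in> ?R" "y \<in> ?R" for x y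
  proof -
    obtain \<sigma> \<sigma>' where s: "x = (P, \<sigma>)" "y = (P, \<sigma>')" "\<sigma> \<in> components P \<rightarrow>\<^sub>E UNIV" "\<sigma>' \<in> components P \<rightarrow>\<^sub>E UNIV"
      using xy unfolding R by blast
    have "\<sigma> = \<sigma>'" if iso: "multi_iso \<D> (P, \<sigma>) (P, \<sigma>')"
    proof -
      obtain f where f: "\<forall>x\<in>Sig \<D>. f x = x" "\<forall>K\<in>components P. \<sigma>' (f ` K) = \<sigma> K"
        using iso unfolding multi_iso.simps by blast
      have "\<sigma> K = \<sigma>' K" if K: "K \<in> components P" for K
      proof -
        have "f ` K = (\<lambda>x. x) ` K"
          by (rule image_cong[OF refl]) (use f(1) in_components_subset[OF K] PS in blast)
        then show ?thesis using bspec[OF f(2) K] by simp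
      qed
      then show ?thesis by (rule PiE_ext[OF s(3,4)])
    qed
    moreover have "multi_iso \<D> (P, \<sigma>) (P, \<sigma>)"
      unfolding multi_iso.simps by (rule exI[of _ "\<lambda>x. x"]) (simp add: diffeo_id)
    ultimately show ?thesis unfolding s by auto
  qed
  have "{(x, y). x \<in> ?R \<and> y \<in> ?R \<and> multi_iso \<D> x y} `` {x} = {x}" if x: "x \<in> ?R" for x
  proof (rule set_eqI)
    fix y
    have "y \<in> {(x, y). x \<in> ?R \<and> y \<in> ?R \<and> multi_iso \<D> x y} `` {x} \<longleftrightarrow> y \<in> ?R \<and> multi_iso \<D> x y"
      using x by (simp only: Image_singleton_iff mem_Collect_eq prod.case simp_thms)
    also have "\<dots> \<longleftrightarrow> y = x" using iso[OF x, of y] iso[OF x x] x by metis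
    finally show "y \<in> {(x, y). x \<in> ?R \<and> y \<in> ?R \<and> multi_iso \<D> x y} `` {x} \<longleftrightarrow> y \<in> {x}"
      by (simp only: singleton_iff)
  qed
  then have "MCL \<D> P = (\<lambda>x. {x}) ` ?R" unfolding MCL_def quotient_def by auto
  also have "\<dots> = (\<lambda>\<sigma>. {(P, \<sigma>)}) ` (components P \<rightarrow>\<^sub>E UNIV)" unfolding R by auto
  finally show ?thesis .
qed

text \<open>Only the decorations of the circles of \<open>P\<close> are summed over. A circle in the interior of the annulus
  meets no boundary circle and has weight \<open>q\<close> or \<open>q\<^sup>-\<^sup>1\<close>, so each circle contributes a factor
  \<open>q + q\<^sup>-\<^sup>1\<close>; both boundaries are the empty cleaved link.\<close>

lemma annulus_partition_map:
  assumes D: "disc_configuration \<D>" and h: "holes \<D> = 1"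
    and P: "P \<subseteq> Sig_int \<D>" "circle_union P"
  shows "partition_map \<D> P (Poly_Mapping.single [empty_class \<D> 1] x) =
    Poly_Mapping.single (empty_class \<D> 0) ((q + q_inv) ^ card (components P) * x)"
proof -
  note A = annulusD[OF D h] and B = annulus_boundary_in_Sig[OF D h]
  have PB: "P \<inter> dcirc \<D> i = {}" if "i \<le> 1" for i using B(2)[OF that] P(1) by blast
  have hp: "half_points \<D> P i = 0" if "i \<le> 1" for i using PB[OF that] by (simp add: half_points_def)
  have KB: "K \<inter> dcirc \<D> i = {}" if "K \<in> components P" "i \<le> 1" for K i
    using PB[OF that(2)] in_components_subset[OF that(1)] by blast
  have bdy: "boundary \<D> i {(P, \<sigma>)} = empty_class \<D> i" if i: "i \<le> 1" for i \<sigma>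
  proof -
    have K: "{K \<in> components P. K \<inter> dcirc \<D> i \<noteq> {}} = {}" using KB[OF _ i] by blast
    have "boundary_rep \<D> i (P, \<sigma>) = empty_class \<D> i"
      unfolding boundary_rep.simps K Let_def hp[OF i] empty_class_def by (simp add: restrict_def)
    then show ?thesis by (simp add: boundary_def)
  qed
  have wt: "weight \<D> {(P, \<sigma>)} = (\<Prod>K\<in>components P. (case \<sigma> K of Plus \<Rightarrow> q | Minus \<Rightarrow> q_inv))" for \<sigma>
  proof -
    have "num_circles_met \<D> K = 0" if "K \<in> components P" for K
      using KB[OF that] by (simp add: num_circles_met_def h)
    then show ?thesis by (simp add: weight_def cong: prod.cong sgn_dec.case_cong)
  qed
  let ?S = "components P \<rightarrow>\<^sub>E (UNIV :: sgn_dec set)"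
  have fin: "finite (components P)" using P(2) by (simp add: circle_union_def)
  have inj: "inj_on (\<lambda>\<sigma>. {(P, \<sigma>)}) ?S" by (rule inj_onI) simp
  have "{\<mu>. \<mu> \<in> MCL \<D> P \<and> (\<forall>i<holes \<D>. boundary \<D> (Suc i) \<mu> = [empty_class \<D> 1] ! i)} = (\<lambda>\<sigma>. {(P, \<sigma>)}) ` ?S"
    unfolding annulus_MCL[OF D h P] using bdy[of 1] by (auto simp: h)
  then have "partition_basis \<D> P [empty_class \<D> 1] =
      (\<Sum>\<mu>\<in>(\<lambda>\<sigma>. {(P, \<sigma>)}) ` ?S. Poly_Mapping.single (boundary \<D> 0 \<mu>) (weight \<D> \<mu>))"
    unfolding partition_basis_def by simp
  also have "\<dots> = (\<Sum>\<sigma>\<in>?S. Poly_Mapping.single (empty_class \<D> 0)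
      (\<Prod>K\<in>components P. (case \<sigma> K of Plus \<Rightarrow> q | Minus \<Rightarrow> q_inv)))"
    by (simp add: sum.reindex[OF inj] bdy wt)
  also have "\<dots> = Poly_Mapping.single (empty_class \<D> 0) ((q + q_inv) ^ card (components P))"
    unfolding sum_single sum_decorations[OF fin] ..
  finally have basis: "partition_basis \<D> P [empty_class \<D> 1] =
      Poly_Mapping.single (empty_class \<D> 0) ((q + q_inv) ^ card (components P))" .
  have "cleaved_link 0 (disc \<D> 1, mark \<D> 1, {}, \<lambda>K. undefined)"
    using A(1)[of 1] A(2)[of 1] A(3)[of 1] by (simp add: circle_union_def dcirc_def)
  then have "empty_class \<D> 1 \<in> CL 0"
    unfolding empty_class_def CL_def by (intro quotientI) simp
  then have "[empty_class \<D> 1] \<in> listset (map CL [0])"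
    by (simp add: set_Cons_def)
  moreover have "tl (signature \<D> P) = [0]"
    using hp[of 0] hp[of 1] by (simp add: signature_def h)
  ultimately have "Poly_Mapping.single [empty_class \<D> 1] x \<in> tensor_I (tl (signature \<D> P))"
    unfolding tensor_I_def by simp
  then show ?thesis
    unfolding partition_map_def
    by (simp only: restrict_apply' linear_extension_single basis scale_single mult.commute)
qed

section \<open>The tangle map of an annular diagram\<close>

text \<open>Signature zero and an even number of endpoints mean that there are no endpoints at all, so the
  tangle and all its resolutions stay in the interior of the annulus.\<close>

lemma tangle_without_endpoints:
  assumes D: "disc_configuration \<D>" and h: "holes \<D> = 1"
    and T: "tangle_diagram \<D> T" and s: "signature \<D> (curve T) = [0, 0]"
  shows "curve T \<subseteq> Sig_int \<D>" "link_diagram T"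
    "\<And>\<rho>. curve (resolve T (crossings T) \<rho>) \<subseteq> Sig_int \<D>"
proof -
  note A = annulusD[OF D h]
  have T1: "curve T \<subseteq> Sig \<D>" "diagram_in (Sig_int \<D>) T"
    and T2: "\<forall>i\<le>holes \<D>. mark \<D> i \<notin> curve T \<and>
        finite (curve T \<inter> dcirc \<D> i) \<and> even (card (curve T \<inter> dcirc \<D> i)) \<and>
        (\<forall>p\<in>curve T \<inter> dcirc \<D> i.
           arc_endpoint (curve T) p \<and> transverse_at (curve T) (dcirc \<D> i) p)"
    using T unfolding tangle_diagram_def by - (elim conjE, assumption)+
  have hp: "half_points \<D> (curve T) i = 0" if "i \<le> 1" for i
  proof -
    have "half_points \<D> (curve T) 0 = 0 \<and> half_points \<D> (curve T) 1 = 0"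
      using s by (simp add: signature_def h)
    moreover have "i = 0 \<or> i = 1" using that by auto
    ultimately show ?thesis by blast
  qed
  have "curve T \<inter> dcirc \<D> i = {}" if i: "i \<le> 1" for i
  proof -
    have fe: "finite (curve T \<inter> dcirc \<D> i)" "even (card (curve T \<inter> dcirc \<D> i))" using T2 i by (simp_all add: h)
    have "card (curve T \<inter> dcirc \<D> i) div 2 = 0" using hp[OF i] by (simp add: half_points_def)
    then have "card (curve T \<inter> dcirc \<D> i) = 0" using fe(2) by presburger
    then show ?thesis using fe(1) by simp
  qed
  then show sub: "curve T \<subseteq> Sig_int \<D>" using Sig_minus_boundary[OF D h] T1(1) by blast
  have SS: "Sig_int \<D> \<subseteq> S2"
    using A(1)[of 0] interior_of_subset[of "top_of_set S2" "disc \<D> 0"] unfolding A(6) by blast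
  have T3: "compact (curve T)" "finite (crossings T)"
    "\<forall>c\<in>crossings T. oriented_chart (chart T c) \<and> chart T c ` cball 0 1 \<subseteq> Sig_int \<D> \<and> chart T c 0 = c \<and>
        curve T \<inter> chart T c ` cball 0 1 = chart T c ` {z \<in> cball 0 1. Re z = 0 \<or> Im z = 0}"
    "\<forall>c\<in>crossings T. \<forall>d\<in>crossings T. c \<noteq> d \<longrightarrow> chart T c ` cball 0 1 \<inter> chart T d ` cball 0 1 = {}"
    "\<forall>p\<in>curve T \<inter> Sig_int \<D> - crossings T. interior_arc_point (curve T) p"
    using T1(2) unfolding diagram_in_def by - (elim conjE, assumption)+
  have ch: "chart T c ` cball 0 1 \<subseteq> Sig_int \<D>" if "c \<in> crossings T" for c using T3(3) that by blast
  show "link_diagram T"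
    unfolding link_diagram_def diagram_in_def
  proof (intro conjI)
    show "curve T \<subseteq> S2" using sub SS by blast
    show "\<forall>c\<in>crossings T. oriented_chart (chart T c) \<and> chart T c ` cball 0 1 \<subseteq> S2 \<and> chart T c 0 = c \<and>
        curve T \<inter> chart T c ` cball 0 1 = chart T c ` {z \<in> cball 0 1. Re z = 0 \<or> Im z = 0}"
      using T3(3) SS by (meson subset_trans)
    show "\<forall>p\<in>curve T \<inter> S2 - crossings T. interior_arc_point (curve T) p"
      using T3(5) sub by blast
  qed (rule T3)+
  show "curve (resolve T (crossings T) \<rho>) \<subseteq> Sig_int \<D>" for \<rho>
  proof
    fix x assume "x \<in> curve (resolve T (crossings T) \<rho>)"
    then consider "x \<in> curve T" | c z where "c \<in> crossings T" "z \<in> smoothing (\<rho> c)" "x = chart T c z"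
      unfolding curve_resolve by blast
    then show "x \<in> Sig_int \<D>"
    proof cases
      case 2
      then have "x \<in> chart T c ` cball 0 1" using smoothing_norm[OF 2(2)] by simp
      then show ?thesis using ch[OF 2(1)] by blast
    qed (use sub in blast)
  qed
qed

lemma truncate_diagram:
  "link_diagram (diagram.truncate T) \<longleftrightarrow> link_diagram T"
  "state_sum (diagram.truncate T) = state_sum T"
  by (simp_all add: diagram.truncate_def link_diagram_def diagram_in_def state_sum_def resolutions_def curve_resolve)

theorem theorem31:
  fixes \<D> :: disc_config and T :: oriented_diagram
  assumes "disc_configuration \<D>"
    and "holes \<D> = 1"
    and "oriented_tangle_diagram \<D> T"
    and "signature \<D> (curve T) = [0, 0]"
  shows "oriented_link_diagram T \<and>
    (\<forall>x :: laurent.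
       tangle_map \<D> T (Poly_Mapping.single [empty_class \<D> 1] x) =
         Poly_Mapping.single (empty_class \<D> 0) (jones T * x))"
proof (intro conjI allI)
  have T: "tangle_diagram \<D> T" "is_orientation T" using assms(3) by (simp_all add: oriented_tangle_diagram_def)
  note TT = tangle_without_endpoints[OF assms(1,2) T(1) assms(4)]
  show "oriented_link_diagram T" using TT(2) T(2) by (simp add: oriented_link_diagram_def)
  fix x :: laurent
  let ?n = "\<lambda>\<rho>. card (components (curve (resolve T (crossings T) \<rho>)))"
  have "tangle_sum \<D> T (Poly_Mapping.single [empty_class \<D> 1] x) =
      (\<Sum>\<rho>\<in>resolutions T. Poly_Mapping.single (empty_class \<D> 0)
        ((- q) ^ (\<Sum>c\<in>crossings T. \<rho> c) * ((q + q_inv) ^ ?n \<rho> * x)))"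
    unfolding tangle_sum_def
    by (simp only: annulus_partition_map[OF assms(1,2) TT(3) circle_union_full_resolution[OF TT(2)]] scale_single)
  also have "\<dots> = Poly_Mapping.single (empty_class \<D> 0) (state_sum T * x)"
    unfolding sum_single state_sum_def by (simp add: sum_distrib_right mult.assoc)
  finally have "tangle_map \<D> T (Poly_Mapping.single [empty_class \<D> 1] x) =
      Poly_Mapping.single (empty_class \<D> 0) (writhe_factor T * (state_sum T * x))"
    by (simp add: tangle_map_def scale_single)
  moreover have "jones T = writhe_factor T * state_sum T"
    using bracket_eq_state_sum[of "diagram.truncate T"] TT(2) by (simp add: jones_def truncate_diagram)
  ultimately show "tangle_map \<D> T (Poly_Mapping.single [empty_class \<D> 1] x) =
      Poly_Mapping.single (empty_class \<D> 0) (jones T * x)"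
    by (simp add: mult.assoc)
qed

end
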